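(* Let $R(x):=x^b\ell(x)$ be a positive and increasing function on $(0,\infty)$ with $0<b\le1$ and $\ell(x)$ slowly varying as $x\to\infty$. Define $\phi_2(t):=t^\alpha R^{-1}(\log(e\vee|\log t|))$. Suppose that $\phi_2\in\Phi$ and $$-\log P(W>x)\asymp R(x)\quad\text{as }x\to\infty.$$ Then $$\phi_2\text{-}H(\partial\mathbf T)=\xi_RW\quad\text{a.s. on }\{\partial\mathbf T\ne\varnothing\},$$ where $\xi_R$ is a positive (finite) constant determined by $$E\exp(R(\delta W))\begin{cases}<\infty,&0<\delta<\xi_R,\\=\infty,&\delta>\xi_R.\end{cases}$$
   Context: Words and metric: $\mathbb Z_+=\{0,1,2,\dots\}$, $\mathbb R_+=[0,\infty)$, $\mathbf U=\bigcup_{n\ge0}\mathbb Z_+^n$ (finite words, with $\mathbb Z_+^0$ consisting of the empty word $\varnothing$), $\mathbf I=\mathbb Z_+^{\mathbb N}$ (infinite words). $|\mathbf i|$ is the length of $\mathbf i$, $\mathbf i|n$ its prefix of length $n$, $\mathbf i*\mathbf j$ is concatenation, $\mathbf i\wedge\mathbf j$ is the longest common prefix. $\mathbf I$ has the ultrametric $d(\mathbf i,\mathbf j)=e^{-|\mathbf i\wedge\mathbf j|}$ and Borel $\sigma$-algebra $\mathcal B(\mathbf I)$. Tree: $\{N_{\mathbf i}\}_{\mathbf i\in\mathbf U}$ are i.i.d. $\mathbb Z_+$-valued random variables on $(\Omega,\mathcal F,P)$, $N:=N_\varnothing$, $p_n=P(N=n)$. Standing assumptions: the distribution of $N$ is not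 concentrated at one point, $a:=E(N)>1$, $E(N\log N)<\infty$. $\alpha:=\log a$. The Galton–Watson tree $\mathbf T\subset\mathbf U$ is the random set with $\varnothing\in\mathbf T$; for $\mathbf i\in\mathbf T$, $i\in\mathbb Z_+$: $\mathbf i*i\in\mathbf T$ iff $0\le i\le N_{\mathbf i}-1$; prefixes of elements of $\mathbf T$ are in $\mathbf T$. Boundary: $\partial\mathbf T=\{\mathbf i\in\mathbf I:\mathbf i|n\in\mathbf T\ \forall n\}$. $Z_n=\mathrm{Card}\{\mathbf i\in\mathbf T:|\mathbf i|=n\}$ and $W=\lim_n Z_n/a^n$ (exists a.s., $E(W)=1$). Conventions: "increasing" is in the wide sense (flatness allowed). $x\vee y=\max(x,y)$. For a positive increasing function $h$ on $(0,\infty)$, $h^{-1}(x):=\sup\{y:h(y)<x\}$, with $\sup\varnothing=0$. $h_1(x)\asymp h_2(x)$ as $x\to\infty$ means $\limsup_{x\to\infty}h_2/h_1<\infty$ and $\liminf_{x\to\infty}h_2/h_1>0$. Gauge functions: $\mathcal G$ is the set of functions $g>0$ on $\mathbb R_+$ with $\limsup_{n\to\infty}g(n+1)/g(n)<a$ ($n$ integer). $\Phi$ is the set of functions $\phi(t)=t^\alpha g(|\log t|)$ on $(0,\infty)$ with $g\in\mathcal G$, such that $\phi$ is positive and increasing on $(0,\delta_1)$ for some $\delta_1>0$ and $\phi(0):=\phi(0+)=0$. Hausdorff measure: for a Borel set $E\subset\mathbf I$, $\phi\text{-}H(E)=\lim_{\delta\to0+}\inf\{\sum_{n\ge1}\phi(|D_n|):E\subset\bigcup_nD_n,\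 D_n\in\mathcal B(\mathbf I),\ |D_n|\le\delta\}$, $|D|$ denoting diameter. *)

theory Defs
  imports "HOL-Probability.Probability" "HOL-Library.Stream"
begin

text \<open>Finite words are lists of natural numbers; infinite words are streams of natural numbers, and
  \<open>stake n x\<close> is the prefix of length \<open>n\<close> of the infinite word \<open>x\<close>.\<close>

definition common_prefix_length :: "'a stream \<Rightarrow> 'a stream \<Rightarrow> nat" where
  "common_prefix_length x y = (GREATEST n. stake n x = stake n y)"

lemma stake_eq_mono: "stake n x = stake n y \<Longrightarrow> m \<le> n \<Longrightarrow> stake m x = stake m y"
  by (metis min.absorb1 take_stake)

lemma stream_eq_iff_stake: "x = y \<longleftrightarrow> (\<forall>n. stake n x = stake n y)"
proof
  assume h: "\<forall>n. stake n x = stake n y"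
  have "x !! n = y !! n" for n
    using h[rule_format, of "Suc n"] by (metis lessI stake_nth)
  then show "x = y"
    by (metis ext stream_smap_nats)
qed auto

lemma stake_eq_iff_le_common_prefix_length:
  assumes "x \<noteq> y"
  shows "stake n x = stake n y \<longleftrightarrow> n \<le> common_prefix_length x y"
proof -
  obtain k where k: "stake k x \<noteq> stake k y"
    using assms stream_eq_iff_stake by blast
  have b: "m \<le> k" if "stake m x = stake m y" for m
    using k stake_eq_mono[OF that] by (meson nle_le)
  have "stake (common_prefix_length x y) x = stake (common_prefix_length x y) y"
    unfolding common_prefix_length_def
    by (rule GreatestI_nat[where k = 0 and b = k]) (use b in auto)
  moreover have "n \<le> common_prefix_length x y" if "stake n x = stake n y"
    unfolding common_prefix_length_def
    by (rule Greatest_le_nat[where b = k]) (use b that in auto)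
  ultimately show ?thesis
    using stake_eq_mono by blast
qed

instantiation stream :: (type) metric_space
begin

definition dist_stream_def:
  "dist x y = (if x = y then 0 else exp (- real (common_prefix_length x y)))"

definition uniformity_stream_def:
  "(uniformity :: ('a stream \<times> 'a stream) filter)
     = (INF e\<in>{0 <..}. principal {(x, y). dist x y < e})"

definition open_stream_def:
  "open (U :: 'a stream set) \<longleftrightarrow> (\<forall>x\<in>U. eventually (\<lambda>(x', y). x' = x \<longrightarrow> y \<in> U) uniformity)"

instance
proof
  fix x y z :: "'a stream"
  show "(dist x y = 0) = (x = y)"
    by (simp add: dist_stream_def)
  have sym: "dist x z = dist z x" for x z :: "'a stream"
    by (simp add: dist_stream_def common_prefix_length_def eq_commute)
  have "dist x y \<le> max (dist x z) (dist z y)"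
  proof (cases "x = y \<or> x = z \<or> z = y")
    case False
    define m where "m = min (common_prefix_length x z) (common_prefix_length z y)"
    have "stake m x = stake m z" "stake m z = stake m y"
      using False by (auto simp: stake_eq_iff_le_common_prefix_length m_def)
    then have "m \<le> common_prefix_length x y"
      using False by (simp flip: stake_eq_iff_le_common_prefix_length)
    then show ?thesis
      using False by (auto simp: dist_stream_def m_def min_def split: if_splits)
  qed (auto simp: dist_stream_def max_def)
  moreover have "0 \<le> dist x z" "0 \<le> dist z y"
    by (auto simp: dist_stream_def)
  ultimately show "dist x y \<le> dist x z + dist y z"
    using sym[of y z] by linarith
qed (simp_all only: uniformity_stream_def open_stream_def)

end

text \<open>Every subset of the space of infinite words has diameter at most 1, so the library's
  \<^const>\<open>diameter\<close> is never applied to an unbounded set here.\<close>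

definition hausdorff_pre :: "(real \<Rightarrow> real) \<Rightarrow> real \<Rightarrow> nat stream set \<Rightarrow> ennreal" where
  "hausdorff_pre \<phi> \<delta> E =
     (INF D \<in> {D :: nat \<Rightarrow> nat stream set.
                 E \<subseteq> (\<Union>n. D n) \<and> (\<forall>n. D n \<in> sets borel \<and> diameter (D n) \<le> \<delta>)}.
        (\<Sum>n. ennreal (\<phi> (diameter (D n)))))"

definition hausdorff_measure :: "(real \<Rightarrow> real) \<Rightarrow> nat stream set \<Rightarrow> ennreal" where
  "hausdorff_measure \<phi> E = Lim (at_right 0) (\<lambda>\<delta>. hausdorff_pre \<phi> \<delta> E)"

text \<open>The limit always exists.\<close>

lemma hausdorff_pre_antimono: "\<delta> \<le> \<delta>' \<Longrightarrow> hausdorff_pre \<phi> \<delta>' E \<le> hausdorff_pre \<phi> \<delta> E"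
  unfolding hausdorff_pre_def by (rule INF_superset_mono) (auto intro: order_trans)

lemma hausdorff_pre_tendsto:
  "((\<lambda>\<delta>. hausdorff_pre \<phi> \<delta> E) \<longlongrightarrow> (SUP \<delta>\<in>{0<..}. hausdorff_pre \<phi> \<delta> E)) (at_right 0)"
proof (rule increasing_tendsto)
  show "\<forall>\<^sub>F \<delta> in at_right 0. hausdorff_pre \<phi> \<delta> E \<le> (SUP \<delta>\<in>{0<..}. hausdorff_pre \<phi> \<delta> E)"
    using eventually_at_right_less[of "0::real"]
    by (rule eventually_mono) (auto intro: SUP_upper)
next
  fix x assume "x < (SUP \<delta>\<in>{0<..}. hausdorff_pre \<phi> \<delta> E)"
  then obtain d where d: "d > 0" "x < hausdorff_pre \<phi> d E"
    by (auto simp: less_SUP_iff)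
  then show "\<forall>\<^sub>F \<delta> in at_right 0. x < hausdorff_pre \<phi> \<delta> E"
    unfolding eventually_at_right_field
    by (intro exI[of _ d]) (auto intro!: less_le_trans[OF d(2) hausdorff_pre_antimono])
qed

lemma hausdorff_measure_eq_SUP:
  "hausdorff_measure \<phi> E = (SUP \<delta>\<in>{0<..}. hausdorff_pre \<phi> \<delta> E)"
  unfolding hausdorff_measure_def by (rule tendsto_Lim) (auto intro: hausdorff_pre_tendsto)

inductive_set gw_tree :: "(nat list \<Rightarrow> nat) \<Rightarrow> nat list set" for \<nu> :: "nat list \<Rightarrow> nat" where
  root: "[] \<in> gw_tree \<nu>"
| child: "u \<in> gw_tree \<nu> \<Longrightarrow> k < \<nu> u \<Longrightarrow> u @ [k] \<in> gw_tree \<nu>"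

lemma gw_tree_snoc_iff: "u @ [k] \<in> gw_tree \<nu> \<longleftrightarrow> u \<in> gw_tree \<nu> \<and> k < \<nu> u"
  by (auto elim: gw_tree.cases intro: gw_tree.child)

lemma gw_tree_prefix: "u @ v \<in> gw_tree \<nu> \<Longrightarrow> u \<in> gw_tree \<nu>"
proof (induction v rule: rev_induct)
  case (snoc k v)
  then show ?case
    using gw_tree_snoc_iff[of "u @ v" k] by simp
qed simp

definition gw_boundary :: "(nat list \<Rightarrow> nat) \<Rightarrow> nat stream set" where
  "gw_boundary \<nu> = {x. \<forall>n. stake n x \<in> gw_tree \<nu>}"

definition gw_level :: "(nat list \<Rightarrow> nat) \<Rightarrow> nat \<Rightarrow> nat" where
  "gw_level \<nu> n = card {u \<in> gw_tree \<nu>. length u = n}"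

text \<open>In the locale, \<open>N u \<omega>\<close> is the number of children of \<open>u\<close>. The expectation is a Bochner
  integral, which is 0 when the integrand is not integrable; so \<open>mean_gt_1\<close> includes
  integrability. In \<open>LlogL\<close>, \<open>0 log 0 = 0\<close> because \<open>ln 0 = 0\<close> in the library.\<close>

locale galton_watson = prob_space M for M :: "'w measure" +
  fixes N :: "nat list \<Rightarrow> 'w \<Rightarrow> nat"
  assumes indep: "indep_vars (\<lambda>_. count_space UNIV) N UNIV"
    and ident: "\<And>u. distr M (count_space UNIV) (N u) = distr M (count_space UNIV) (N [])"
    and nondegenerate: "\<And>k. prob {\<omega> \<in> space M. N [] \<omega> = k} \<noteq> 1"
    and mean_gt_1: "expectation (\<lambda>\<omega>. real (N [] \<omega>)) > 1"
    and LlogL: "integrable M (\<lambda>\<omega>. real (N [] \<omega>) * ln (real (N [] \<omega>)))"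

definition gw_mean :: "'w measure \<Rightarrow> (nat list \<Rightarrow> 'w \<Rightarrow> nat) \<Rightarrow> real" where
  "gw_mean M N = (\<integral>\<omega>. real (N [] \<omega>) \<partial>M)"

definition gw_limit :: "'w measure \<Rightarrow> (nat list \<Rightarrow> 'w \<Rightarrow> nat) \<Rightarrow> 'w \<Rightarrow> real" where
  "gw_limit M N \<omega> = lim (\<lambda>n. real (gw_level (\<lambda>u. N u \<omega>) n) / gw_mean M N ^ n)"

definition slowly_varying :: "(real \<Rightarrow> real) \<Rightarrow> bool" where
  "slowly_varying l \<longleftrightarrow> (\<forall>\<^sub>F x in at_top. l x > 0) \<and>
     (\<forall>c>0. ((\<lambda>x. l (c * x) / l x) \<longlongrightarrow> 1) at_top)"

definition asymp_comparable :: "(real \<Rightarrow> real) \<Rightarrow> (real \<Rightarrow> real) \<Rightarrow> bool" where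
  "asymp_comparable h1 h2 \<longleftrightarrow>
     Limsup at_top (\<lambda>x. ereal (h2 x / h1 x)) < \<infinity> \<and>
     Liminf at_top (\<lambda>x. ereal (h2 x / h1 x)) > 0"

text \<open>Generalised inverse of a positive increasing function on the open half-line. The case
  distinction fixes \<open>sup {} = 0\<close>, which is unspecified for real \<^const>\<open>Sup\<close>.\<close>

definition gen_inverse :: "(real \<Rightarrow> real) \<Rightarrow> real \<Rightarrow> real" where
  "gen_inverse h x = (if {y. 0 < y \<and> h y < x} = {} then 0 else Sup {y. 0 < y \<and> h y < x})"

definition gauge_factors :: "real \<Rightarrow> (real \<Rightarrow> real) set" where
  "gauge_factors a = {g. (\<forall>s\<ge>0. g s > 0) \<and>
     limsup (\<lambda>n. ereal (g (real (n + 1)) / g (real n))) < ereal a}"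

definition gauges :: "real \<Rightarrow> (real \<Rightarrow> real) set" where
  "gauges a = {\<phi>. (\<exists>g\<in>gauge_factors a. \<forall>t>0. \<phi> t = t powr (ln a) * g \<bar>ln t\<bar>) \<and>
     (\<exists>\<delta>1>0. (\<forall>t\<in>{0<..<\<delta>1}. \<phi> t > 0) \<and> mono_on {0<..<\<delta>1} \<phi>) \<and>
     (\<phi> \<longlongrightarrow> 0) (at_right 0) \<and> \<phi> 0 = 0}"

text \<open>At \<open>t = 0\<close> the following function is 0, because \<open>0 powr _ = 0\<close>.\<close>

definition phi2 :: "real \<Rightarrow> (real \<Rightarrow> real) \<Rightarrow> real \<Rightarrow> real" where
  "phi2 a R t = t powr (ln a) * gen_inverse R (ln (max (exp 1) \<bar>ln t\<bar>))"

text \<open>\<open>R\<close> is only meaningful on the open half-line; on the event that \<open>W = 0\<close> the integrand is the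
  arbitrary finite constant \<open>exp (R 0)\<close>, which does not affect finiteness.\<close>

definition is_critical :: "'w measure \<Rightarrow> ('w \<Rightarrow> real) \<Rightarrow> (real \<Rightarrow> real) \<Rightarrow> real \<Rightarrow> bool" where
  "is_critical M W R \<xi> \<longleftrightarrow>
     (\<forall>\<delta>. 0 < \<delta> \<and> \<delta> < \<xi> \<longrightarrow> (\<integral>\<^sup>+\<omega>. ennreal (exp (R (\<delta> * W \<omega>))) \<partial>M) < \<infinity>) \<and>
     (\<forall>\<delta>. \<delta> > \<xi> \<longrightarrow> (\<integral>\<^sup>+\<omega>. ennreal (exp (R (\<delta> * W \<omega>))) \<partial>M) = \<infinity>)"

end

theory Submission
  imports Defs "HOL-Library.Sublist" "HOL-Library.Nat_Bijection" "HOL-Real_Asymp.Real_Asymp"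
begin

text \<open>Write \<open>W_u\<close> for the limit of the subtree rooted at \<open>u\<close>, and \<open>\<rho> n\<close> for \<open>R\<^sup>-\<^sup>1 (log n)\<close>, so that a cylinder of
  level \<open>n\<close> costs \<open>\<rho> n / a^n\<close>, while it carries the branching mass \<open>W_u / a^n\<close>.

  Lower bound. If \<open>1 / q < \<xi>\<close>, the expected mass of the level-\<open>n\<close> vertices with \<open>W_u > q * \<rho> n\<close>, which is
  \<open>E (W; W > q * \<rho> n)\<close>, is summable in \<open>n\<close>. So in fine covers all cylinders but a negligible mass
  satisfy \<open>W_u \<le> q * \<rho> n\<close>, and their total cost is at least \<open>W / q\<close>.

  Upper bound. If \<open>\<delta> > \<xi>\<close>, then \<open>P (W > x) \<ge> exp (- R (\<delta>' * x))\<close> with \<open>\<delta>' < \<delta>\<close> for arbitrarily large \<open>x\<close>. Up to a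
  level \<open>n\<close> with \<open>log n\<close> slightly larger than \<open>R (\<delta>' * x)\<close>, search along each ray, in steps of order \<open>log n\<close>,
  for the first vertex whose normalised population one step later exceeds \<open>x - 1\<close>. These vertices
  cost at most \<open>\<delta>\<close> times their mass up to a small \<open>L^1\<close> error, and the vertices of level \<open>n\<close> at which the search
  fails cost little, because the searches in disjoint blocks fail independently.\<close>

section \<open>Convergence of nonnegative martingales\<close>

text \<open>The obstacle is dependence. The limit \<open>W\<close> of a vertex involves its whole
  subtree, so tests \<open>W > x\<close> at successive vertices of a ray are not independent. The
  search therefore tests \<open>Mn m\<close>, which sees \<open>m\<close> generations only, and pays
  for the difference. The price is affordable because \<open>W - Mn m\<close> has variance of order
  \<open>a^(-m)\<close>: with \<open>m\<close> a large multiple of \<open>log n\<close>, its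
  \<open>L^1\<close> norm falls below any prescribed power of \<open>1 / n\<close>, while there are
  at most about \<open>n\<close> blocks. The second moment behind this comes from the tail of
  \<open>W\<close>, as do the identity \<open>E W = 1\<close> and the existence of \<xi>. The slack
  comes from regular variation: for \<open>d < d'\<close> the ratio
  \<open>R (d' * x) / R (d * x)\<close> eventually stays above some \<open>q > 1\<close>, so
  \<open>exp (R (d' * x))\<close> exceeds a power larger than 1 of \<open>exp (R (d * x))\<close>.
  This leaves room for polynomial factors, for the block length, and for so many blocks that tests
  with success probability about \<open>exp (- s)\<close> all fail only on a tiny mass.\<close>

fun holding :: "real \<Rightarrow> real \<Rightarrow> (nat \<Rightarrow> real) \<Rightarrow> nat \<Rightarrow> bool" where
  "holding \<alpha> \<beta> x 0 \<longleftrightarrow> x 0 \<le> \<alpha>"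
| "holding \<alpha> \<beta> x (Suc n) \<longleftrightarrow> (if holding \<alpha> \<beta> x n then x (Suc n) < \<beta> else x (Suc n) \<le> \<alpha>)"

text \<open>Doob's buy-low, sell-high strategy: \<open>holding\<close> means that a unit bought at a
  value at most \<alpha> has not yet been sold at a value at least \<beta>, and
  \<open>upcrossings\<close> counts the sales. Both look only at values up to time \<open>n\<close>,
  so the strategy is predictable.\<close>

fun upcrossings :: "real \<Rightarrow> real \<Rightarrow> (nat \<Rightarrow> real) \<Rightarrow> nat \<Rightarrow> nat" where
  "upcrossings \<alpha> \<beta> x 0 = 0"
| "upcrossings \<alpha> \<beta> x (Suc n) =
     upcrossings \<alpha> \<beta> x n + (if holding \<alpha> \<beta> x n \<and> \<beta> \<le> x (Suc n) then 1 else 0)"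

lemma holding_cong: "(\<And>k. k \<le> n \<Longrightarrow> x k = y k) \<Longrightarrow> holding \<alpha> \<beta> x n = holding \<alpha> \<beta> y n"
  by (induction n) auto

lemma upcrossings_mono: "m \<le> n \<Longrightarrow> upcrossings \<alpha> \<beta> x m \<le> upcrossings \<alpha> \<beta> x n"
  by (rule lift_Suc_mono_le[where f = "upcrossings \<alpha> \<beta> x"]) auto

text \<open>Each sale earns at least \<beta> - \<alpha>, and a unit still held was bought at a value
  at most \<alpha>; including its unrealised gain makes the claim inductive.\<close>

lemma gain_ge_upcrossings:
  assumes "\<alpha> < \<beta>"
  shows "(\<beta> - \<alpha>) * upcrossings \<alpha> \<beta> x n + (if holding \<alpha> \<beta> x n then x n - \<alpha> else 0)
    \<le> (\<Sum>k<n. if holding \<alpha> \<beta> x k then x (Suc k) - x k else 0)"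
proof (induction n)
  case (Suc n)
  then show ?case
    by (auto simp: algebra_simps split: if_splits)
qed auto

text \<open>Values at most \<alpha> recur, so a unit is always bought again; values at least \<beta>
  recur, so it is always sold again.\<close>

lemma upcrossings_unbounded:
  assumes le: "\<exists>\<^sub>F n in sequentially. x n \<le> \<alpha>" and ge: "\<exists>\<^sub>F n in sequentially. \<beta> \<le> x n"
  shows "\<exists>n. k \<le> upcrossings \<alpha> \<beta> x n"
proof -
  have hold_after: "\<exists>m\<ge>n. holding \<alpha> \<beta> x m" for n
  proof (rule ccontr)
    assume no: "\<not> ?thesis"
    from le obtain m where m: "m > n" "x m \<le> \<alpha>"
      by (metis frequently_sequentially Suc_le_eq)
    then obtain m' where m': "m = Suc m'" "n \<le> m'"
      by (cases m) auto
    have "\<not> holding \<alpha> \<beta> x m'" "\<not> holding \<alpha> \<beta> x m"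
      using no m' m(1) less_imp_le by blast+
    with m m' show False
      by simp
  qed
  have up_after: "\<exists>m\<ge>n. upcrossings \<alpha> \<beta> x n < upcrossings \<alpha> \<beta> x m" if "holding \<alpha> \<beta> x n" for n
  proof -
    \<comment> \<open>The unit held at time \<open>n\<close> stays in hand until the next sale is
      counted.\<close>
    have *: "upcrossings \<alpha> \<beta> x n < upcrossings \<alpha> \<beta> x m \<or> holding \<alpha> \<beta> x m" if "n \<le> m" for m
      using that by (induction m rule: dec_induct)
        (use \<open>holding \<alpha> \<beta> x n\<close> in \<open>auto intro: le_less_trans less_SucI\<close>, meson le_imp_less_Suc upcrossings_mono)
    from ge obtain m where m: "m > n" "\<beta> \<le> x m"
      by (metis frequently_sequentially Suc_le_eq)
    then obtain m' where m': "m = Suc m'" "n \<le> m'"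
      by (cases m) auto
    have "upcrossings \<alpha> \<beta> x n < upcrossings \<alpha> \<beta> x m"
      using *[OF m'(2)] m m' upcrossings_mono[OF m'(2), of \<alpha> \<beta> x] by auto
    with m show ?thesis by (intro exI[of _ m]) auto
  qed
  show ?thesis
  proof (induction k)
    case (Suc k)
    then obtain n where n: "k \<le> upcrossings \<alpha> \<beta> x n" by auto
    obtain m where m: "m \<ge> n" "holding \<alpha> \<beta> x m" using hold_after by blast
    obtain m' where "upcrossings \<alpha> \<beta> x m < upcrossings \<alpha> \<beta> x m'" using up_after[OF m(2)] by blast
    with n upcrossings_mono[OF m(1), of \<alpha> \<beta> x] show ?case
      by (intro exI[of _ m']) auto
  qed auto
qed

text \<open>Rational levels make the hypothesis a countable family of conditions, which can hold
  almost surely at once. Finiteness of the lower limit excludes divergence to infinity.\<close>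

lemma convergent_if_few_upcrossings:
  fixes x :: "nat \<Rightarrow> real"
  assumes nonneg: "\<And>n. 0 \<le> x n"
    and fin: "liminf (\<lambda>n. ereal (x n)) < \<infinity>"
    and few: "\<And>p q. 0 < real_of_rat p \<Longrightarrow> p < q \<Longrightarrow> \<exists>k. \<forall>n. upcrossings (real_of_rat p) (real_of_rat q) x n < k"
  shows "convergent x"
proof -
  have "\<not> liminf (\<lambda>n. ereal (x n)) < limsup (\<lambda>n. ereal (x n))"
  proof
    assume lt: "liminf (\<lambda>n. ereal (x n)) < limsup (\<lambda>n. ereal (x n))"
    have nn: "0 \<le> liminf (\<lambda>n. ereal (x n))"
      by (rule Liminf_bounded) (simp add: nonneg)
    obtain \<alpha>' \<beta>' where ab: "liminf (\<lambda>n. ereal (x n)) < ereal \<alpha>'" "ereal \<alpha>' < ereal \<beta>'"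
       "ereal \<beta>' < limsup (\<lambda>n. ereal (x n))"
      using lt by (meson ereal_dense2)
    then have "\<alpha>' < \<beta>'" by simp
    then obtain p where p: "\<alpha>' < real_of_rat p" "real_of_rat p < \<beta>'"
      using of_rat_dense by blast
    then obtain q where q: "real_of_rat p < real_of_rat q" "real_of_rat q < \<beta>'"
      using of_rat_dense by blast
    have "0 < \<alpha>'" using nn ab(1) by (metis ereal_less(2) le_less_trans)
    from this p(1) have p0: "0 < real_of_rat p" by (rule order.strict_trans)
    have "\<exists>\<^sub>F n in sequentially. x n \<le> real_of_rat p"
    proof (rule ccontr)
      assume "\<not> ?thesis"
      then have "\<forall>\<^sub>F n in sequentially. ereal \<alpha>' \<le> ereal (x n)"
        unfolding not_frequently by (rule eventually_mono) (use p in auto)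
      then have "ereal \<alpha>' \<le> liminf (\<lambda>n. ereal (x n))"
        by (rule Liminf_bounded)
      with ab show False by simp
    qed
    moreover have "\<exists>\<^sub>F n in sequentially. real_of_rat q \<le> x n"
    proof (rule ccontr)
      assume "\<not> ?thesis"
      then have "\<forall>\<^sub>F n in sequentially. ereal (x n) \<le> ereal \<beta>'"
        unfolding not_frequently by (rule eventually_mono) (use q in auto)
      then have "limsup (\<lambda>n. ereal (x n)) \<le> ereal \<beta>'"
        by (rule Limsup_bounded)
      with ab show False by simp
    qed
    ultimately have "\<exists>n. k \<le> upcrossings (real_of_rat p) (real_of_rat q) x n" for k
      by (rule upcrossings_unbounded)
    moreover have "p < q" using q by (simp add: of_rat_less)
    ultimately show False using few[OF p0] by (meson not_le)
  qed
  then have eq: "liminf (\<lambda>n. ereal (x n)) = limsup (\<lambda>n. ereal (x n))"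
    using Liminf_le_Limsup[of sequentially "\<lambda>n. ereal (x n)"] by (simp add: order_less_le)
  have nn: "0 \<le> liminf (\<lambda>n. ereal (x n))"
    by (rule Liminf_bounded) (simp add: nonneg)
  then obtain r where r: "liminf (\<lambda>n. ereal (x n)) = ereal r"
    using fin by (cases "liminf (\<lambda>n. ereal (x n))") auto
  have "(\<lambda>n. ereal (x n)) \<longlonglongrightarrow> ereal r"
    by (rule Liminf_eq_Limsup[OF trivial_limit_sequentially r]) (use eq r in metis)
  then show ?thesis
    by (auto simp: convergent_def)
qed

text \<open>The martingale property is expressed without conditional expectations: \<open>A\<close>
  ranges over the measurable sets that are saturated with respect to the path up to time
  \<open>n\<close>. Fatou's lemma makes the lower limit finite, and the upcrossing inequality limits
  the oscillations between two levels.\<close>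

lemma (in prob_space) nonneg_martingale_convergent:
  fixes X :: "nat \<Rightarrow> 'a \<Rightarrow> real"
  assumes int: "\<And>n. integrable M (X n)"
    and nonneg: "\<And>n \<omega>. 0 \<le> X n \<omega>"
    and mart: "\<And>n A. A \<in> sets M \<Longrightarrow>
      (\<And>\<omega> \<omega>'. \<omega> \<in> space M \<Longrightarrow> \<omega>' \<in> space M \<Longrightarrow> (\<And>k. k \<le> n \<Longrightarrow> X k \<omega> = X k \<omega>') \<Longrightarrow> \<omega> \<in> A \<Longrightarrow> \<omega>' \<in> A) \<Longrightarrow>
      (\<integral>\<omega>. indicator A \<omega> * X (Suc n) \<omega> \<partial>M) = (\<integral>\<omega>. indicator A \<omega> * X n \<omega> \<partial>M)"
  shows "AE \<omega> in M. convergent (\<lambda>n. X n \<omega>)"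
proof -
  have [measurable]: "X n \<in> borel_measurable M" for n
    using int by auto
  have const: "(\<integral>\<omega>. X n \<omega> \<partial>M) = (\<integral>\<omega>. X 0 \<omega> \<partial>M)" for n
  proof (induction n)
    case (Suc n)
    have "(\<integral>\<omega>. indicator (space M) \<omega> * X (Suc n) \<omega> \<partial>M) = (\<integral>\<omega>. indicator (space M) \<omega> * X n \<omega> \<partial>M)"
      by (rule mart) auto
    then show ?case
      using Suc by (simp cong: Bochner_Integration.integral_cong)
  qed auto
  have nnconst: "(\<integral>\<^sup>+\<omega>. ennreal (X n \<omega>) \<partial>M) = ennreal (\<integral>\<omega>. X 0 \<omega> \<partial>M)" for n
  proof -
    have "(\<integral>\<^sup>+\<omega>. ennreal (X n \<omega>) \<partial>M) = ennreal (\<integral>\<omega>. X n \<omega> \<partial>M)"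
      by (rule nn_integral_eq_integral[OF int]) (simp add: nonneg)
    then show ?thesis by (simp only: const[of n])
  qed
  have "(\<integral>\<^sup>+\<omega>. liminf (\<lambda>n. ennreal (X n \<omega>)) \<partial>M) \<le> liminf (\<lambda>n. \<integral>\<^sup>+\<omega>. ennreal (X n \<omega>) \<partial>M)"
    by (rule nn_integral_liminf) auto
  also have "\<dots> = liminf (\<lambda>n. ennreal (\<integral>\<omega>. X 0 \<omega> \<partial>M))"
    by (simp only: nnconst)
  also have "\<dots> = ennreal (\<integral>\<omega>. X 0 \<omega> \<partial>M)"
    by (simp add: Liminf_const)
  also have "\<dots> < \<infinity>" by simp
  finally have "AE \<omega> in M. liminf (\<lambda>n. ennreal (X n \<omega>)) \<noteq> \<infinity>"
    by (intro nn_integral_PInf_AE) (simp_all add: less_top[symmetric])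
  then have fin: "AE \<omega> in M. liminf (\<lambda>n. ereal (X n \<omega>)) < \<infinity>"
  proof (rule AE_mp, intro AE_I2 impI)
    fix \<omega> assume h: "liminf (\<lambda>n. ennreal (X n \<omega>)) \<noteq> \<infinity>"
    obtain k where k: "liminf (\<lambda>n. ennreal (X n \<omega>)) < of_nat k"
      using h by (metis ennreal_Ex_less_of_nat infinity_ennreal_def top.not_eq_extremum)
    show "liminf (\<lambda>n. ereal (X n \<omega>)) < \<infinity>"
    proof (rule ccontr)
      assume "\<not> ?thesis"
      then have "ereal (real k) < liminf (\<lambda>n. ereal (X n \<omega>))"
        by simp
      then have "\<forall>\<^sub>F n in sequentially. ereal (real k) < ereal (X n \<omega>)"
        by (rule less_LiminfD)
      then have "\<forall>\<^sub>F n in sequentially. of_nat k \<le> ennreal (X n \<omega>)"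
        by (rule eventually_mono) (simp add: ennreal_of_nat_eq_real_of_nat ennreal_leI)
      then have "of_nat k \<le> liminf (\<lambda>n. ennreal (X n \<omega>))"
        by (rule Liminf_bounded)
      with k show False by simp
    qed
  qed
  have meas_hold[measurable]: "Measurable.pred M (\<lambda>\<omega>. holding \<alpha> \<beta> (\<lambda>n. X n \<omega>) n)" for \<alpha> \<beta> n
  proof (induction n)
    case (Suc n)
    note [measurable] = this
    show ?case by simp
  qed simp
  have meas_up[measurable]: "(\<lambda>\<omega>. upcrossings \<alpha> \<beta> (\<lambda>n. X n \<omega>) n) \<in> measurable M (count_space UNIV)" for \<alpha> \<beta> n
  proof (induction n)
    case (Suc n)
    note [measurable] = this
    show ?case by simp
  qed simp
  have few: "AE \<omega> in M. \<exists>k. \<forall>n. upcrossings \<alpha> \<beta> (\<lambda>n. X n \<omega>) n < k" if ab: "0 < \<alpha>" "\<alpha> < \<beta>" for \<alpha> \<beta>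
  proof -
    let ?u = "\<lambda>n \<omega>. upcrossings \<alpha> \<beta> (\<lambda>n. X n \<omega>) n"
    let ?A = "\<lambda>k. {\<omega>\<in>space M. holding \<alpha> \<beta> (\<lambda>n. X n \<omega>) k}"
    have int_A: "integrable M (\<lambda>\<omega>. indicator (?A k) \<omega> * X j \<omega>)" for j k
      using integrable_real_mult_indicator[of "?A k" M "X j"] int by (simp add: mult.commute)
    have step: "(\<integral>\<omega>. indicator (?A k) \<omega> * X (Suc k) \<omega> - indicator (?A k) \<omega> * X k \<omega> \<partial>M) = 0" for k
    proof -
      have "(\<integral>\<omega>. indicator (?A k) \<omega> * X (Suc k) \<omega> \<partial>M) = (\<integral>\<omega>. indicator (?A k) \<omega> * X k \<omega> \<partial>M)"
      proof (rule mart)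
        fix \<omega> \<omega>' assume *: "\<omega> \<in> space M" "\<omega>' \<in> space M" "\<And>i. i \<le> k \<Longrightarrow> X i \<omega> = X i \<omega>'" "\<omega> \<in> ?A k"
        then show "\<omega>' \<in> ?A k"
          using holding_cong[of k "\<lambda>n. X n \<omega>" "\<lambda>n. X n \<omega>'" \<alpha> \<beta>] by auto
      qed measurable
      then show ?thesis
        by (subst Bochner_Integration.integral_diff) (simp_all add: int_A)
    qed
    \<comment> \<open>The trading gain has mean zero by \<open>step\<close>, and since
      \<open>X\<close> is nonnegative an open position loses at most \<alpha>.\<close>
    have bound: "(\<integral>\<^sup>+\<omega>. ennreal (real (?u n \<omega>)) \<partial>M) \<le> ennreal (\<alpha> / (\<beta> - \<alpha>))" for n
    proof -
      let ?g = "\<lambda>\<omega>. \<Sum>k<n. indicator (?A k) \<omega> * X (Suc k) \<omega> - indicator (?A k) \<omega> * X k \<omega>"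
      have ig: "integrable M ?g"
        by (intro Bochner_Integration.integrable_sum Bochner_Integration.integrable_diff int_A)
      have "(\<integral>\<omega>. ?g \<omega> \<partial>M) = (\<Sum>k<n. 0)"
        by (subst Bochner_Integration.integral_sum) (auto simp only: step intro!: Bochner_Integration.integrable_diff int_A)
      then have g0: "(\<integral>\<omega>. ?g \<omega> \<partial>M) = 0" by simp
      have le: "(\<beta> - \<alpha>) * real (?u n \<omega>) \<le> ?g \<omega> + \<alpha>" if "\<omega> \<in> space M" for \<omega>
      proof -
        have "?g \<omega> = (\<Sum>k<n. if holding \<alpha> \<beta> (\<lambda>n. X n \<omega>) k then X (Suc k) \<omega> - X k \<omega> else 0)"
          using that by (intro sum.cong) auto
        moreover have "- \<alpha> \<le> (if holding \<alpha> \<beta> (\<lambda>n. X n \<omega>) n then X n \<omega> - \<alpha> else 0)"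
          using nonneg[of n \<omega>] ab by auto
        ultimately show ?thesis
          using gain_ge_upcrossings[OF ab(2), of "\<lambda>n. X n \<omega>" n] by linarith
      qed
      have "(\<integral>\<^sup>+\<omega>. ennreal (real (?u n \<omega>)) \<partial>M) \<le> (\<integral>\<^sup>+\<omega>. ennreal ((?g \<omega> + \<alpha>) / (\<beta> - \<alpha>)) \<partial>M)"
        by (rule nn_integral_mono, rule ennreal_leI) (use le ab in \<open>auto simp: field_simps\<close>)
      also have "\<dots> = ennreal (\<integral>\<omega>. (?g \<omega> + \<alpha>) / (\<beta> - \<alpha>) \<partial>M)"
      proof (rule nn_integral_eq_integral)
        show "integrable M (\<lambda>\<omega>. (?g \<omega> + \<alpha>) / (\<beta> - \<alpha>))"
          using ig by simp
        show "AE \<omega> in M. 0 \<le> (?g \<omega> + \<alpha>) / (\<beta> - \<alpha>)"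
        proof (rule AE_I2)
          fix \<omega> assume "\<omega> \<in> space M"
          from le[OF this] ab show "0 \<le> (?g \<omega> + \<alpha>) / (\<beta> - \<alpha>)"
            by (meson divide_nonneg_pos diff_gt_0_iff_gt less_imp_le mult_nonneg_nonneg of_nat_0_le_iff order_trans)
        qed
      qed
      also have "(\<integral>\<omega>. (?g \<omega> + \<alpha>) / (\<beta> - \<alpha>) \<partial>M) = \<alpha> / (\<beta> - \<alpha>)"
        using ig by (simp add: g0 prob_space)
      finally show ?thesis .
    qed
    have "(\<integral>\<^sup>+\<omega>. (SUP n. ennreal (real (?u n \<omega>))) \<partial>M) = (SUP n. \<integral>\<^sup>+\<omega>. ennreal (real (?u n \<omega>)) \<partial>M)"
      by (rule nn_integral_monotone_convergence_SUP) (auto simp: incseq_def le_fun_def upcrossings_mono)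
    also have "\<dots> \<le> ennreal (\<alpha> / (\<beta> - \<alpha>))"
      by (rule SUP_least) (rule bound)
    finally have "(\<integral>\<^sup>+\<omega>. (SUP n. ennreal (real (?u n \<omega>))) \<partial>M) \<noteq> \<infinity>"
      using ennreal_less_top[of "\<alpha> / (\<beta> - \<alpha>)"] by (metis infinity_ennreal_def leD)
    then have "AE \<omega> in M. (SUP n. ennreal (real (?u n \<omega>))) \<noteq> \<infinity>"
      by (intro nn_integral_PInf_AE) auto
    then show ?thesis
    proof (rule AE_mp, intro AE_I2 impI)
      fix \<omega> assume h: "(SUP n. ennreal (real (?u n \<omega>))) \<noteq> \<infinity>"
      then obtain k where k: "(SUP n. ennreal (real (?u n \<omega>))) < of_nat k"
        by (metis ennreal_Ex_less_of_nat infinity_ennreal_def top.not_eq_extremum)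
      have "?u n \<omega> < k" for n
      proof -
        have "ennreal (real (?u n \<omega>)) < of_nat k"
          using k by (meson SUP_upper UNIV_I le_less_trans)
        then show ?thesis
          by (simp add: ennreal_of_nat_eq_real_of_nat ennreal_less_iff)
      qed
      then show "\<exists>k. \<forall>n. ?u n \<omega> < k" by blast
    qed
  qed
  have "AE \<omega> in M. \<forall>p q. 0 < real_of_rat p \<longrightarrow> p < q \<longrightarrow>
      (\<exists>k. \<forall>n. upcrossings (real_of_rat p) (real_of_rat q) (\<lambda>n. X n \<omega>) n < k)"
    unfolding AE_all_countable by (auto intro!: few simp: of_rat_less)
  with fin show ?thesis
  proof eventually_elim
    case (elim \<omega>)
    then show ?case
      by (intro convergent_if_few_upcrossings nonneg) auto
  qed
qed

section \<open>Regularly varying functions\<close>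

locale regular_varying =
  fixes R l :: "real \<Rightarrow> real" and b :: real
  assumes b_pos: "0 < b"
    and slowly: "slowly_varying l"
    and R_eq: "\<And>x. x > 0 \<Longrightarrow> R x = x powr b * l x"
    and R_pos: "\<And>x. x > 0 \<Longrightarrow> R x > 0"
    and R_mono: "mono_on {0<..} R"
begin

lemma R_le: "0 < x \<Longrightarrow> x \<le> y \<Longrightarrow> R x \<le> R y"
  using R_mono by (auto simp: mono_on_def)

lemma ratio_tendsto:
  assumes c: "c > 0"
  shows "((\<lambda>x. R (c * x) / R x) \<longlongrightarrow> c powr b) at_top"
proof -
  have "((\<lambda>x. l (c * x) / l x) \<longlongrightarrow> 1) at_top"
    using slowly c by (auto simp: slowly_varying_def)
  then have "((\<lambda>x. c powr b * (l (c * x) / l x)) \<longlongrightarrow> c powr b * 1) at_top"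
    by (intro tendsto_intros)
  moreover have "\<forall>\<^sub>F x in at_top. c powr b * (l (c * x) / l x) = R (c * x) / R x"
    using eventually_gt_at_top[of 0]
    by eventually_elim (use c in \<open>simp add: R_eq powr_mult\<close>)
  ultimately show ?thesis
    by (simp add: filterlim_cong[OF refl refl])
qed

lemma eventually_ratio_ge:
  assumes "c > 0" "q < c powr b"
  shows "\<forall>\<^sub>F x in at_top. q * R x \<le> R (c * x)"
proof -
  have "\<forall>\<^sub>F x in at_top. q < R (c * x) / R x"
    using order_tendstoD(1)[OF ratio_tendsto[OF assms(1)] assms(2)] .
  then show ?thesis
    using eventually_gt_at_top[of 0]
  proof eventually_elim
    case (elim x)
    then show ?case using R_pos[of x] by (simp add: field_simps)
  qed
qed

text \<open>The positive index turns a factor between arguments into a factor between values;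
  \<open>q\<close> is the slack spent later on polynomial factors and on the depth of the
  search.\<close>

lemma eventually_ratio_gap:
  assumes "0 < d" "d < d'"
  obtains q where "1 < q" "\<forall>\<^sub>F x in at_top. q * R (d * x) \<le> R (d' * x)"
proof -
  have "1 < (d' / d) powr b"
    using assms b_pos by (simp add: gr_one_powr)
  then obtain q where q: "1 < q" "q < (d' / d) powr b"
    using dense by blast
  from eventually_ratio_ge[OF _ q(2)] assms
  have "\<forall>\<^sub>F x in at_top. q * R x \<le> R (d' / d * x)"
    by simp
  moreover have "filterlim (\<lambda>x. d * x) at_top at_top"
    using assms by (intro filterlim_tendsto_pos_mult_at_top[OF tendsto_const] filterlim_ident) auto
  ultimately have "\<forall>\<^sub>F x in at_top. q * R (d * x) \<le> R (d' / d * (d * x))"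
    unfolding filterlim_iff by blast
  then show ?thesis
    using assms q by (intro that[of q]) auto
qed

text \<open>Since \<open>2 powr (b / 2) < 2 powr b\<close>, doubling the argument eventually
  multiplies \<open>R\<close> by at least \<open>2 powr (b / 2)\<close>. Iterate along the points
  \<open>2 ^ k * x1\<close> and fill the gaps by monotonicity.\<close>

lemma R_ge_power:
  obtains C e where "0 < C" "0 < e" "\<forall>\<^sub>F x in at_top. C * x powr e \<le> R x"
proof -
  define e where "e = b / 2"
  have e: "0 < e" "e < b" using b_pos by (auto simp: e_def)
  have "\<forall>\<^sub>F x in at_top. 2 powr e * R x \<le> R (2 * x)"
    using e by (intro eventually_ratio_ge) auto
  then obtain x0 where x0: "\<And>x. x \<ge> x0 \<Longrightarrow> 2 powr e * R x \<le> R (2 * x)"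
    by (auto simp: eventually_at_top_linorder)
  define x1 where "x1 = max x0 1"
  have x1: "x1 \<ge> x0" "x1 > 0" by (auto simp: x1_def)
  have pow: "(2 ^ k) powr e * R x1 \<le> R (2 ^ k * x1)" for k :: nat
  proof (induction k)
    case (Suc k)
    have "(2 ^ Suc k) powr e * R x1 = 2 powr e * ((2 ^ k) powr e * R x1)"
      by (simp add: powr_mult)
    also have "\<dots> \<le> 2 powr e * R (2 ^ k * x1)"
      using Suc by (intro mult_left_mono) auto
    also have "\<dots> \<le> R (2 * (2 ^ k * x1))"
    proof (rule x0)
      have "1 * x1 \<le> 2 ^ k * x1" using x1 by (intro mult_right_mono) auto
      with x1 show "x0 \<le> 2 ^ k * x1" by linarith
    qed
    finally show ?case by (simp add: mult.assoc)
  qed auto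
  define C where "C = R x1 / (2 * x1) powr e"
  have "C > 0" using R_pos[of x1] x1 by (auto simp: C_def)
  moreover have "\<forall>\<^sub>F x in at_top. C * x powr e \<le> R x"
    using eventually_ge_at_top[of x1]
  proof eventually_elim
    case (elim x)
    obtain k :: nat where k: "2 ^ k \<le> x / x1" "x / x1 < 2 ^ Suc k"
    proof -
      define n where "n = (LEAST n. x / x1 < 2 ^ n)"
      have n: "x / x1 < 2 ^ n"
        unfolding n_def using real_arch_pow[of 2 "x / x1"] by (auto intro: LeastI_ex)
      moreover have "x / x1 \<ge> 1" using elim x1 by simp
      ultimately have "n \<noteq> 0" by (intro notI) auto
      then obtain k where k: "n = Suc k" by (cases n) auto
      then have "\<not> x / x1 < 2 ^ k"
        unfolding n_def by (intro not_less_Least) auto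
      with n k show ?thesis by (intro that[of k]) auto
    qed
    have "x powr e \<le> (2 ^ Suc k * x1) powr e"
      using k(2) x1 elim e by (intro powr_mono2) (auto simp: field_simps)
    also have "\<dots> = (2 ^ k) powr e * (2 * x1) powr e"
      using x1 by (simp add: powr_mult)
    finally have "C * x powr e \<le> C * ((2 ^ k) powr e * (2 * x1) powr e)"
      using \<open>C > 0\<close> by (intro mult_left_mono) auto
    also have "\<dots> = (2 ^ k) powr e * R x1"
      using x1 by (simp add: C_def)
    also have "\<dots> \<le> R (2 ^ k * x1)" by (rule pow)
    also have "\<dots> \<le> R x"
      using k(1) x1 by (intro R_le) (auto simp: field_simps)
    finally show ?case .
  qed
  ultimately show ?thesis by (rule that[OF _ e(1)])
qed

text \<open>Polynomial factors are thus negligible against \<open>exp (c * R x)\<close>.\<close>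

lemma eventually_R_ge_ln:
  assumes "0 < c"
  shows "\<forall>\<^sub>F x in at_top. K * ln x + L \<le> c * R x"
proof -
  obtain C e where C: "0 < C" "0 < e" and ev: "\<forall>\<^sub>F x in at_top. C * x powr e \<le> R x"
    by (rule R_ge_power)
  have "\<forall>\<^sub>F x in at_top. K * ln x + L \<le> c * (C * x powr e)"
  proof -
    have "((\<lambda>x. ln x / x powr e) \<longlongrightarrow> 0) at_top" "((\<lambda>x. 1 / x powr e) \<longlongrightarrow> 0) at_top"
      using C by real_asymp+
    then have "((\<lambda>x. K * (ln x / x powr e) + L * (1 / x powr e)) \<longlongrightarrow> K * 0 + L * 0) at_top"
      by (intro tendsto_intros)
    then have "\<forall>\<^sub>F x in at_top. K * (ln x / x powr e) + L * (1 / x powr e) < c * C"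
      using C assms by (intro order_tendstoD(2)) auto
    then show ?thesis
      using eventually_gt_at_top[of 0] by eventually_elim (simp add: field_simps)
  qed
  with ev show ?thesis
  proof eventually_elim
    case (elim x)
    then have "c * (C * x powr e) \<le> c * R x" using assms by (intro mult_left_mono) auto
    with elim show ?case by simp
  qed
qed

lemma R_at_top: "filterlim R at_top at_top"
proof -
  have "\<forall>\<^sub>F x in at_top. 1 * ln x + 0 \<le> 1 * R x"
    by (rule eventually_R_ge_ln) simp
  then have "\<forall>\<^sub>F x in at_top. ln x \<le> R x" by simp
  with ln_at_top show ?thesis
    by (rule filterlim_at_top_mono)
qed

lemma eventually_R_gap_ln:
  assumes "0 < d" "d < d'"
  shows "\<forall>\<^sub>F x in at_top. R (d * x) + K * ln x + L \<le> R (d' * x)"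
proof -
  obtain q where q: "1 < q" and ev: "\<forall>\<^sub>F x in at_top. q * R (d * x) \<le> R (d' * x)"
    using eventually_ratio_gap[OF assms] .
  have "filterlim (\<lambda>x. d * x) at_top at_top"
    using assms by (intro filterlim_tendsto_pos_mult_at_top[OF tendsto_const] filterlim_ident) auto
  moreover have "\<forall>\<^sub>F x in at_top. K * ln x + (L - K * ln d) \<le> (q - 1) * R x"
    using q by (intro eventually_R_ge_ln) simp
  ultimately have "\<forall>\<^sub>F x in at_top. K * ln (d * x) + (L - K * ln d) \<le> (q - 1) * R (d * x)"
    unfolding filterlim_iff by blast
  with ev eventually_gt_at_top[of 0] show ?thesis
  proof eventually_elim
    case (elim x)
    have "K * ln (d * x) = K * ln d + K * ln x"
      using assms elim by (simp add: ln_mult algebra_simps)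
    with elim show ?case by (simp add: algebra_simps)
  qed
qed

section \<open>Generalised inverse of a regularly varying function\<close>

lemma gen_inverse_bdd: "bdd_above {y. 0 < y \<and> R y < x}"
proof -
  obtain y0 where y0: "\<And>y. y \<ge> y0 \<Longrightarrow> x \<le> R y"
    using filterlim_at_top[THEN iffD1, OF R_at_top] by (auto simp: eventually_at_top_linorder)
  have "y \<le> y0" if "R y < x" for y
    using y0[of y] that by force
  then show ?thesis by (intro bdd_aboveI[of _ y0]) blast
qed

lemma gen_inverse_nonneg: "0 \<le> gen_inverse R x"
proof (cases "{y. 0 < y \<and> R y < x} = {}")
  case False
  then obtain y where y: "y \<in> {y. 0 < y \<and> R y < x}" by blast
  then have "y \<le> Sup {y. 0 < y \<and> R y < x}"
    by (rule cSup_upper) (rule gen_inverse_bdd)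
  with y False show ?thesis by (simp add: gen_inverse_def)
qed (simp add: gen_inverse_def)

lemma gen_inverse_mono:
  assumes "x \<le> y"
  shows "gen_inverse R x \<le> gen_inverse R y"
proof (cases "{z. 0 < z \<and> R z < x} = {}")
  case True
  then show ?thesis using gen_inverse_nonneg[of y] by (simp add: gen_inverse_def)
next
  case False
  moreover have "{z. 0 < z \<and> R z < x} \<subseteq> {z. 0 < z \<and> R z < y}" using assms by auto
  ultimately show ?thesis
    unfolding gen_inverse_def by (auto intro!: cSup_subset_mono gen_inverse_bdd)
qed

text \<open>With \<open>gen_inverse_le\<close> this replaces the inverse relation; the strict
  inequalities are what survives flat stretches and jumps of \<open>R\<close>.\<close>

lemma R_ge_of_gen_inverse_less:
  assumes "gen_inverse R y < x"
  shows "y \<le> R x"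
proof (rule ccontr)
  assume "\<not> ?thesis"
  moreover have "0 < x" using assms gen_inverse_nonneg[of y] by linarith
  ultimately have "x \<in> {z. 0 < z \<and> R z < y}" by simp
  then have "x \<le> Sup {z. 0 < z \<and> R z < y}" "{z. 0 < z \<and> R z < y} \<noteq> {}"
    using cSup_upper[OF _ gen_inverse_bdd] by blast+
  then have "x \<le> gen_inverse R y"
    unfolding gen_inverse_def by (simp only: if_False)
  with assms show False by simp
qed

lemma gen_inverse_le:
  assumes "0 \<le> x" "\<And>z. 0 < z \<Longrightarrow> x < z \<Longrightarrow> y \<le> R z"
  shows "gen_inverse R y \<le> x"
proof -
  have "z \<le> x" if "0 < z" "R z < y" for z
    using assms(2)[of z] that by force
  then show ?thesis
    unfolding gen_inverse_def using assms(1) by (auto intro!: cSup_least)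
qed

end

section \<open>Hausdorff measure on infinite words\<close>

definition cylinder :: "'a list \<Rightarrow> 'a stream set" where
  "cylinder u = {x. stake (length u) x = u}"

lemma dist_stream_le_iff:
  "dist x y \<le> exp (- real n) \<longleftrightarrow> stake n x = stake n (y :: 'a stream)"
proof (cases "x = y")
  case False
  then show ?thesis
    by (simp add: dist_stream_def stake_eq_iff_le_common_prefix_length)
qed (simp add: dist_stream_def)

lemma dist_stream_cases: "dist x y = 0 \<or> (\<exists>n. dist x (y :: 'a stream) = exp (- real n))"
  by (auto simp: dist_stream_def)

lemma dist_stream_le_1: "dist x (y :: 'a stream) \<le> 1"
  using dist_stream_le_iff[of x y 0] by simp

lemma bounded_stream [simp]: "bounded (A :: 'a stream set)"
  unfolding bounded_def using dist_stream_le_1 by blast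

lemma open_cylinder: "open (cylinder u)"
  unfolding open_dist
proof
  fix x assume x: "x \<in> cylinder u"
  show "\<exists>e>0. \<forall>y. dist y x < e \<longrightarrow> y \<in> cylinder u"
  proof (intro exI[of _ "exp (- real (length u))"] conjI allI impI)
    fix y assume "dist y x < exp (- real (length u))"
    then have "stake (length u) y = stake (length u) x"
      using dist_stream_le_iff[of y x "length u"] by simp
    with x show "y \<in> cylinder u" by (simp add: cylinder_def)
  qed simp
qed

lemma cylinder_borel [measurable]: "cylinder u \<in> sets borel"
  by (simp add: open_cylinder)

lemma diameter_stream_le:
  fixes A :: "'a stream set"
  assumes "0 \<le> d" "\<And>x y. x \<in> A \<Longrightarrow> y \<in> A \<Longrightarrow> dist x y \<le> d"
  shows "diameter A \<le> d"
  unfolding diameter_def using assms by (auto intro!: cSUP_least)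

lemma diameter_cylinder: "diameter (cylinder u) = exp (- real (length (u :: nat list)))"
proof (rule antisym)
  show "diameter (cylinder u) \<le> exp (- real (length u))"
  proof (rule diameter_stream_le)
    fix x y assume "x \<in> cylinder u" "y \<in> cylinder u"
    then have "stake (length u) x = stake (length u) y"
      by (simp add: cylinder_def)
    then show "dist x y \<le> exp (- real (length u))"
      by (simp add: dist_stream_le_iff)
  qed simp
  \<comment> \<open>Two words that branch right after \<open>u\<close>: the alphabet has at least
    two letters, so the diameter is attained.\<close>
  let ?x = "u @- sconst 0" and ?y = "u @- sconst 1"
  have "stake (Suc (length u)) ?x \<noteq> stake (Suc (length u)) ?y"
    by (simp add: stake_Suc del: stake.simps)
  then have ne: "?x \<noteq> ?y" by metis
  have "\<not> dist ?x ?y < exp (- real (length u))"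
  proof
    assume lt: "dist ?x ?y < exp (- real (length u))"
    obtain n where n: "dist ?x ?y = exp (- real n)"
      using dist_stream_cases[of ?x ?y] ne by auto
    with lt have "Suc (length u) \<le> n" by simp
    with n have "dist ?x ?y \<le> exp (- real (Suc (length u)))" by simp
    with \<open>stake (Suc (length u)) ?x \<noteq> stake (Suc (length u)) ?y\<close> show False
      by (simp only: dist_stream_le_iff)
  qed
  moreover have "dist ?x ?y \<le> diameter (cylinder u)"
    by (rule diameter_bounded_bound) (auto simp: cylinder_def stake_shift)
  ultimately show "exp (- real (length u)) \<le> diameter (cylinder u)" by simp
qed

text \<open>Nonzero distances are exponentials of negative integers, so the largest one is attained,
  at the least exponent; hence the set lies in the cylinder of that length around any of its
  points.\<close>

lemma diameter_stream_cases:
  fixes A :: "'a stream set"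
  obtains "diameter A = 0" "\<And>x y. x \<in> A \<Longrightarrow> y \<in> A \<Longrightarrow> x = y"
  | u where "diameter A = exp (- real (length u))" "A \<subseteq> cylinder u"
proof (cases "\<forall>x\<in>A. \<forall>y\<in>A. x = y")
  case True
  then have "A = {} \<or> (\<exists>x. A = {x})" by blast
  then have "diameter A = 0" by auto
  with True show ?thesis using that(1) by blast
next
  case False
  then obtain x y where xy: "x \<in> A" "y \<in> A" "x \<noteq> y" by blast
  define n where "n = (LEAST n. \<exists>x\<in>A. \<exists>y\<in>A. dist x y = exp (- real n))"
  have ex: "\<exists>n. \<exists>x\<in>A. \<exists>y\<in>A. dist x y = exp (- real n)"
    using xy dist_stream_cases[of x y] by auto
  then have "\<exists>x\<in>A. \<exists>y\<in>A. dist x y = exp (- real n)"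
    unfolding n_def by (rule LeastI_ex)
  then obtain x' y' where x'y': "x' \<in> A" "y' \<in> A" "dist x' y' = exp (- real n)" by blast
  have le: "dist x y \<le> exp (- real n)" if "x \<in> A" "y \<in> A" for x y
    using dist_stream_cases[of x y]
  proof
    assume "\<exists>m. dist x y = exp (- real m)"
    then obtain m where m: "dist x y = exp (- real m)" by blast
    then have "n \<le> m" unfolding n_def using that by (intro Least_le) blast
    with m show ?thesis by simp
  qed simp
  have "diameter A = exp (- real n)"
  proof (rule antisym)
    show "diameter A \<le> exp (- real n)"
      by (rule diameter_stream_le) (use le in auto)
    show "exp (- real n) \<le> diameter A"
      using diameter_bounded_bound[of A x' y'] x'y' by simp
  qed
  moreover have "A \<subseteq> cylinder (stake n x)"
  proof
    fix y assume "y \<in> A"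
    then have "dist y x \<le> exp (- real n)" by (rule le) (rule xy(1))
    then have "stake n y = stake n x" by (simp only: dist_stream_le_iff)
    then show "y \<in> cylinder (stake n x)" by (simp add: cylinder_def)
  qed
  ultimately show ?thesis
    using that(2)[of "stake n x"] unfolding length_stake by blast
qed

lemma hausdorff_pre_finite_cylinders:
  assumes fin: "finite C" and cov: "E \<subseteq> (\<Union>u\<in>C. cylinder u)"
    and len: "\<And>u. u \<in> C \<Longrightarrow> exp (- real (length u)) \<le> \<delta>"
    and \<phi>0: "\<phi> 0 = 0" and \<delta>: "0 \<le> \<delta>"
  shows "hausdorff_pre \<phi> \<delta> E \<le> (\<Sum>u\<in>C. ennreal (\<phi> (exp (- real (length u)))))"
proof -
  obtain us where us: "set us = C" "distinct us"
    using finite_distinct_list[OF fin] by blast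
  \<comment> \<open>Padding with empty sets is free: their diameter is 0 and
    \<open>\<phi> 0 = 0\<close>.\<close>
  define D where "D n = (if n < length us then cylinder (us ! n) else {})" for n
  have "E \<subseteq> (\<Union>n. D n)"
  proof
    fix x assume "x \<in> E"
    then obtain u where "u \<in> C" "x \<in> cylinder u" using cov by blast
    then show "x \<in> (\<Union>n. D n)"
      unfolding D_def us(1)[symmetric] in_set_conv_nth by auto
  qed
  moreover have "D n \<in> sets borel" "diameter (D n) \<le> \<delta>" for n
    using len[of "us ! n"] us(1) \<delta> by (auto simp: D_def diameter_cylinder)
  ultimately have "hausdorff_pre \<phi> \<delta> E \<le> (\<Sum>n. ennreal (\<phi> (diameter (D n))))"
    unfolding hausdorff_pre_def by (intro INF_lower) auto
  also have "\<dots> = (\<Sum>n<length us. ennreal (\<phi> (diameter (D n))))"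
    by (rule suminf_finite) (auto simp: D_def \<phi>0)
  also have "\<dots> = (\<Sum>n<length us. ennreal (\<phi> (exp (- real (length (us ! n))))))"
    by (intro sum.cong) (auto simp: D_def diameter_cylinder)
  also have "\<dots> = (\<Sum>u\<leftarrow>us. ennreal (\<phi> (exp (- real (length u)))))"
    by (simp add: sum_list_sum_nth atLeast0LessThan)
  also have "\<dots> = (\<Sum>u\<in>C. ennreal (\<phi> (exp (- real (length u)))))"
    using us by (simp add: sum_list_distinct_conv_sum_set)
  finally show ?thesis .
qed

text \<open>Sets with at most one point have cost 0, but a sufficiently small cylinder around them costs
  as little as desired; so covers by cylinders suffice.\<close>

lemma cylinder_cover:
  assumes cov: "E \<subseteq> (\<Union>n. D n)" and diam: "\<And>n. diameter (D n :: nat stream set) \<le> exp (- real L)"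
    and \<phi>: "(\<lambda>k. \<phi> (exp (- real k))) \<longlonglongrightarrow> 0" and e: "e > 0"
  obtains u where "E \<subseteq> (\<Union>n. cylinder (u n))" "\<And>n. L \<le> length (u n)"
    "(\<Sum>n. ennreal (\<phi> (exp (- real (length (u n)))))) \<le> (\<Sum>n. ennreal (\<phi> (diameter (D n)))) + ennreal e"
proof -
  have "\<exists>u. D n \<subseteq> cylinder u \<and> L \<le> length u \<and>
     ennreal (\<phi> (exp (- real (length u)))) \<le> ennreal (\<phi> (diameter (D n))) + ennreal (e * (1 / 2) ^ Suc n)" for n
  proof (cases rule: diameter_stream_cases[of "D n"])
    case 1
    have "\<forall>\<^sub>F k in sequentially. \<phi> (exp (- real k)) < e * (1 / 2) ^ Suc n"
      using e by (intro order_tendstoD(2)[OF \<phi>]) auto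
    then obtain k0 where k0: "\<And>k. k \<ge> k0 \<Longrightarrow> \<phi> (exp (- real k)) < e * (1 / 2) ^ Suc n"
      by (auto simp: eventually_sequentially)
    define k where "k = max k0 L"
    define x where "x = (if D n = {} then sconst 0 else (SOME x. x \<in> D n))"
    have "D n \<subseteq> {x}"
    proof
      fix y assume y: "y \<in> D n"
      then have "y = (SOME x. x \<in> D n)" using someI[of "\<lambda>x. x \<in> D n", OF y] by (rule 1(2))
      with y show "y \<in> {x}" by (auto simp: x_def)
    qed
    then have "D n \<subseteq> cylinder (stake k x)" by (auto simp: cylinder_def)
    moreover have "ennreal (\<phi> (exp (- real k))) \<le> ennreal (e * (1 / 2) ^ Suc n)"
      using k0[of k] by (intro ennreal_leI) (auto simp: k_def)
    then have "ennreal (\<phi> (exp (- real k))) \<le> ennreal (\<phi> (diameter (D n))) + ennreal (e * (1 / 2) ^ Suc n)"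
      by (rule add_increasing[OF zero_le])
    moreover have "L \<le> k" by (simp add: k_def)
    ultimately show ?thesis by (intro exI[of _ "stake k x"]) simp
  next
    case (2 u)
    with diam[of n] show ?thesis by (intro exI[of _ u]) auto
  qed
  then obtain u where u: "\<And>n. D n \<subseteq> cylinder (u n)" "\<And>n. L \<le> length (u n)"
    "\<And>n. ennreal (\<phi> (exp (- real (length (u n))))) \<le> ennreal (\<phi> (diameter (D n))) + ennreal (e * (1 / 2) ^ Suc n)"
    by metis
  show thesis
  proof (rule that)
    show "E \<subseteq> (\<Union>n. cylinder (u n))" using cov u(1) by blast
    show "L \<le> length (u n)" for n by (rule u)
    have "(\<Sum>n. ennreal (\<phi> (exp (- real (length (u n)))))) \<le>
      (\<Sum>n. ennreal (\<phi> (diameter (D n))) + ennreal (e * (1 / 2) ^ Suc n))"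
      by (intro suminf_le u) auto
    also have "\<dots> = (\<Sum>n. ennreal (\<phi> (diameter (D n)))) + (\<Sum>n. ennreal (e * (1 / 2) ^ Suc n))"
      by (rule suminf_add[symmetric]) auto
    also have "(\<Sum>n. ennreal (e * (1 / 2) ^ Suc n)) = ennreal e"
    proof (rule suminf_ennreal_eq)
      show "(\<lambda>n. e * (1 / 2) ^ Suc n) sums e"
        using sums_mult[OF power_half_series, of e] by simp
    qed (use e in auto)
    finally show "(\<Sum>n. ennreal (\<phi> (exp (- real (length (u n)))))) \<le> (\<Sum>n. ennreal (\<phi> (diameter (D n)))) + ennreal e" .
  qed
qed

section \<open>Trees and flows\<close>

text \<open>The shift acts on labellings of all words, whether or not \<open>u\<close> belongs to
  the tree; this makes it a map of the canonical probability space into itself.\<close>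

definition subtree :: "nat list \<Rightarrow> (nat list \<Rightarrow> 'b) \<Rightarrow> nat list \<Rightarrow> 'b" where
  "subtree u c = (\<lambda>v. c (u @ v))"

lemma subtree_Nil [simp]: "subtree [] c = c"
  by (simp add: subtree_def)

lemma subtree_subtree: "subtree v (subtree u c) = subtree (u @ v) c"
  by (simp add: subtree_def)

lemma subtree_apply: "subtree u c v = c (u @ v)"
  by (simp add: subtree_def)

definition level :: "(nat list \<Rightarrow> nat) \<Rightarrow> nat \<Rightarrow> nat list set" where
  "level c n = {u \<in> gw_tree c. length u = n}"

lemma level_0 [simp]: "level c 0 = {[]}"
  by (auto simp: level_def gw_tree.root)

lemma length_level: "u \<in> level c n \<Longrightarrow> length u = n"
  by (simp add: level_def)

lemma gw_tree_append_iff: "u @ v \<in> gw_tree c \<longleftrightarrow> u \<in> gw_tree c \<and> v \<in> gw_tree (subtree u c)"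
proof (induction v rule: rev_induct)
  case Nil
  then show ?case by (simp add: gw_tree.root)
next
  case (snoc k v)
  have "u @ v @ [k] \<in> gw_tree c \<longleftrightarrow> u @ v \<in> gw_tree c \<and> k < c (u @ v)"
    using gw_tree_snoc_iff[of "u @ v" k c] by simp
  with snoc show ?case by (auto simp: gw_tree_snoc_iff subtree_def)
qed

lemma gw_tree_Cons_iff: "k # v \<in> gw_tree c \<longleftrightarrow> k < c [] \<and> v \<in> gw_tree (subtree [k] c)"
  using gw_tree_append_iff[of "[k]" v c] gw_tree_snoc_iff[of "[]" k c] by (auto simp: gw_tree.root)

lemma level_add: "level c (m + n) = (\<Union>u\<in>level c m. (@) u ` level (subtree u c) n)"
proof (intro equalityI subsetI)
  fix w assume w: "w \<in> level c (m + n)"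
  then have "take m w \<in> level c m" "drop m w \<in> level (subtree (take m w) c) n"
    using gw_tree_append_iff[of "take m w" "drop m w" c] by (auto simp: level_def)
  moreover have "w = take m w @ drop m w" by simp
  ultimately show "w \<in> (\<Union>u\<in>level c m. (@) u ` level (subtree u c) n)" by blast
qed (auto simp: level_def gw_tree_append_iff)

lemma level_Suc: "level c (Suc n) = (\<Union>k<c []. (#) k ` level (subtree [k] c) n)"
proof (intro equalityI subsetI)
  fix w assume "w \<in> level c (Suc n)"
  then show "w \<in> (\<Union>k<c []. (#) k ` level (subtree [k] c) n)"
    by (cases w) (auto simp: level_def gw_tree_Cons_iff)
qed (auto simp: level_def gw_tree_Cons_iff)

lemma finite_level [simp]: "finite (level c n)"
  by (induction n arbitrary: c) (simp_all add: level_Suc)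

text \<open>Common form of population sizes, branching mass and error terms;
  \<open>level_sum_add\<close> expresses the branching property once for all of them.\<close>

definition level_sum :: "nat \<Rightarrow> ((nat list \<Rightarrow> nat) \<Rightarrow> 'b) \<Rightarrow> (nat list \<Rightarrow> nat) \<Rightarrow> 'b :: comm_monoid_add" where
  "level_sum n F c = (\<Sum>u\<in>level c n. F (subtree u c))"

lemma level_sum_0 [simp]: "level_sum 0 F c = F c"
  by (simp add: level_sum_def)

lemma level_sum_add: "level_sum (m + n) F c = level_sum m (level_sum n F) c"
proof -
  have "level_sum (m + n) F c = (\<Sum>u\<in>level c m. \<Sum>w\<in>(@) u ` level (subtree u c) n. F (subtree w c))"
    unfolding level_sum_def level_add
    by (rule sum.UNION_disjoint) (auto dest!: length_level)
  also have "\<dots> = (\<Sum>u\<in>level c m. level_sum n F (subtree u c))"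
    by (intro sum.cong refl) (simp add: sum.reindex level_sum_def subtree_subtree inj_on_def)
  finally show ?thesis by (simp add: level_sum_def[of m])
qed

lemma level_sum_Suc: "level_sum (Suc n) F c = (\<Sum>k<c []. level_sum n F (subtree [k] c))"
proof -
  have "level_sum (Suc n) F c = (\<Sum>k<c []. \<Sum>w\<in>(#) k ` level (subtree [k] c) n. F (subtree w c))"
    unfolding level_sum_def level_Suc
    by (rule sum.UNION_disjoint) auto
  also have "\<dots> = (\<Sum>k<c []. level_sum n F (subtree [k] c))"
    by (intro sum.cong refl) (simp add: sum.reindex level_sum_def subtree_subtree inj_on_def)
  finally show ?thesis .
qed

lemma gw_level_eq_card: "gw_level c n = card (level c n)"
  by (simp add: gw_level_def level_def)

lemma gw_level_0 [simp]: "gw_level c 0 = 1"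
  by (simp add: gw_level_eq_card)

lemma of_nat_gw_level: "of_nat (gw_level c n) = level_sum n (\<lambda>_. 1) c"
  by (simp add: gw_level_eq_card level_sum_def)

lemma of_nat_gw_level_add: "of_nat (gw_level c (m + n)) = level_sum m (\<lambda>c. of_nat (gw_level c n)) c"
  by (simp add: of_nat_gw_level level_sum_add)

text \<open>Source of the independence between the first \<open>n\<close> generations and the
  subtrees rooted at level \<open>n\<close>.\<close>

lemma level_cong: "(\<And>u. length u < n \<Longrightarrow> c u = c' u) \<Longrightarrow> level c n = level c' n"
proof (induction n arbitrary: c c')
  case (Suc n)
  have "c [] = c' []" by (rule Suc.prems) simp
  moreover have "level (subtree [k] c) n = level (subtree [k] c') n" for k
    by (rule Suc.IH) (auto simp: subtree_def intro!: Suc.prems)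
  ultimately show ?case by (simp add: level_Suc)
qed simp

lemma stake_mem_level: "x \<in> gw_boundary c \<Longrightarrow> stake n x \<in> level c n"
  by (simp add: gw_boundary_def level_def)

lemma gw_boundary_subtree:
  assumes "x \<in> gw_boundary c"
  shows "sdrop n x \<in> gw_boundary (subtree (stake n x) c)"
  unfolding gw_boundary_def
proof safe
  fix m
  have "stake n x @ stake m (sdrop n x) \<in> gw_tree c"
    using assms unfolding stake_add by (simp add: gw_boundary_def)
  then show "stake m (sdrop n x) \<in> gw_tree (subtree (stake n x) c)"
    unfolding gw_tree_append_iff by blast
qed

text \<open>A flow \<open>\<mu>\<close> through the tree is dominated by its total over any set of words that every ray
  crosses: otherwise, descend along vertices whose flow exceeds the total over the crossing words
  below them; the resulting ray crosses none.\<close>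

lemma flow_le_cut:
  fixes \<mu> f :: "nat list \<Rightarrow> ennreal"
  assumes flow: "\<And>v. v \<in> gw_tree c \<Longrightarrow> \<mu> v = (\<Sum>k<c v. \<mu> (v @ [k]))"
    and cut: "gw_boundary c \<subseteq> (\<Union>u\<in>U. cylinder u)"
    and f: "\<And>u. u \<in> U \<Longrightarrow> u \<in> gw_tree c \<Longrightarrow> \<mu> u \<le> f u"
  shows "\<mu> [] \<le> (\<integral>\<^sup>+u. f u \<partial>count_space U)"
proof (rule ccontr)
  assume neg: "\<not> ?thesis"
  define S where "S v = (\<integral>\<^sup>+u. f u * indicator {u. prefix v u} u \<partial>count_space U)" for v
  have S0: "S [] < \<mu> []" using neg by (simp add: S_def not_le)
  have notU: "v \<notin> U" if "v \<in> gw_tree c" "S v < \<mu> v" for v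
  proof
    assume "v \<in> U"
    have "f v = (\<integral>\<^sup>+u. f u * indicator {v} u \<partial>count_space U)"
      using \<open>v \<in> U\<close> by (subst nn_integral_indicator_singleton) auto
    also have "\<dots> \<le> S v"
      unfolding S_def by (intro nn_integral_mono mult_left_mono) (auto split: split_indicator)
    finally show False using f[OF \<open>v \<in> U\<close> that(1)] that(2) by (simp add: not_less[symmetric])
  qed
  have step: "\<exists>k<c v. S (v @ [k]) < \<mu> (v @ [k])" if v: "v \<in> gw_tree c" "S v < \<mu> v" for v
  proof (rule ccontr)
    assume no: "\<not> ?thesis"
    have "\<mu> v = (\<Sum>k<c v. \<mu> (v @ [k]))" using flow v by blast
    also have "\<dots> \<le> (\<Sum>k<c v. S (v @ [k]))"
      using no by (intro sum_mono) (meson lessThan_iff not_less)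
    \<comment> \<open>No word extends two different children of \<open>v\<close>, so the totals
      below the children add up to at most the total below \<open>v\<close>.\<close>
    also have "\<dots> = (\<integral>\<^sup>+u. (\<Sum>k<c v. f u * indicator {u. prefix (v @ [k]) u} u) \<partial>count_space U)"
      unfolding S_def by (rule nn_integral_sum[symmetric]) auto
    also have "\<dots> \<le> S v"
      unfolding S_def
    proof (rule nn_integral_mono)
      fix u
      show "(\<Sum>k<c v. f u * indicator {u. prefix (v @ [k]) u} u) \<le> f u * indicator {u. prefix v u} u"
      proof (cases "\<exists>k<c v. prefix (v @ [k]) u")
        case True
        then obtain k where k: "k < c v" "prefix (v @ [k]) u" by blast
        then have "prefix (v @ [j]) u \<longleftrightarrow> j = k" for j by (auto simp: prefix_def)
        then have "(\<Sum>j<c v. f u * indicator {u. prefix (v @ [j]) u} u) = (\<Sum>j<c v. if j = k then f u else 0)"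
          by (intro sum.cong) (auto simp: indicator_def)
        also have "\<dots> = f u" using k by simp
        also have "\<dots> = f u * indicator {u. prefix v u} u" using k by (auto simp: prefix_def)
        finally show ?thesis by simp
      next
        case False
        then show ?thesis by (auto intro!: sum.neutral simp: indicator_def)
      qed
    qed
    finally show False using v by simp
  qed
  define next_v where "next_v v = v @ [SOME k. k < c v \<and> S (v @ [k]) < \<mu> (v @ [k])]" for v
  have next_v: "next_v v \<in> gw_tree c \<and> S (next_v v) < \<mu> (next_v v)" if v: "v \<in> gw_tree c \<and> S v < \<mu> v" for v
  proof -
    obtain k where "k < c v \<and> S (v @ [k]) < \<mu> (v @ [k])"
      using step[of v] v by blast
    then have "(SOME k. k < c v \<and> S (v @ [k]) < \<mu> (v @ [k])) < c v \<and> S (next_v v) < \<mu> (next_v v)"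
      unfolding next_v_def by (rule someI)
    with v show ?thesis by (auto simp: next_v_def gw_tree_snoc_iff)
  qed
  define p where "p n = (next_v ^^ n) []" for n
  have p_Suc: "p (Suc n) = next_v (p n)" for n by (simp add: p_def)
  have p: "p n \<in> gw_tree c \<and> S (p n) < \<mu> (p n)" for n
    by (induction n) (use S0 next_v in \<open>auto simp: p_def gw_tree.root\<close>)
  have len: "length (p n) = n" for n
    by (induction n) (auto simp: p_def next_v_def)
  \<comment> \<open>The chosen vertices are nested, hence they are the prefixes of one infinite
    word.\<close>
  define x where "x = smap (\<lambda>n. last (p (Suc n))) nats"
  have x: "stake n x = p n" for n
  proof (induction n)
    case 0
    then show ?case by (simp add: p_def)
  next
    case (Suc n)
    have "stake (Suc n) x = stake n x @ [last (p (Suc n))]"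
      by (simp add: stake_Suc x_def del: stake.simps)
    also have "\<dots> = p (Suc n)" unfolding Suc by (simp add: p_Suc next_v_def)
    finally show ?case .
  qed
  then have "x \<in> gw_boundary c" using p by (simp add: gw_boundary_def)
  then obtain u where "u \<in> U" "x \<in> cylinder u" using cut by blast
  then have "p (length u) \<in> U" using x by (auto simp: cylinder_def)
  then show False using notU p by blast
qed

text \<open>Covers are sequences, whereas \<open>flow_le_cut\<close> sums over a set; repetitions in
  the sequence only enlarge the right side.\<close>

lemma nn_integral_count_space_range_le:
  fixes f :: "'a \<Rightarrow> ennreal" and u :: "nat \<Rightarrow> 'a"
  shows "(\<integral>\<^sup>+x. f x \<partial>count_space (range u)) \<le> (\<Sum>n. f (u n))"
proof -
  obtain I where I: "inj_on u I" "u ` I = range u"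
    using subset_image_inj[of "range u" u UNIV] by auto
  have "(\<integral>\<^sup>+x. f x \<partial>count_space (range u)) = (\<integral>\<^sup>+n. f (u n) \<partial>count_space I)"
    by (rule nn_integral_bij_count_space[symmetric]) (use I in \<open>simp add: bij_betw_def\<close>)
  also have "\<dots> = (\<integral>\<^sup>+n. f (u n) * indicator I n \<partial>count_space UNIV)"
    by (simp add: nn_integral_count_space_indicator)
  also have "\<dots> \<le> (\<integral>\<^sup>+n. f (u n) \<partial>count_space UNIV)"
    by (intro nn_integral_mono) (auto split: split_indicator)
  finally show ?thesis by (simp add: nn_integral_count_space_nat)
qed

section \<open>The branching martingale\<close>

text \<open>The tree is modelled on the canonical space of all labellings of the words by offspring numbers,
  where passing to a subtree is a measure-preserving map.\<close>

locale gw_space =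
  fixes D :: "nat measure" and a :: real
  assumes D_prob: "prob_space D" and D_sets: "sets D = UNIV"
    and D_int: "integrable D real" and a_eq: "a = (\<integral>k. real k \<partial>D)" and a_gt_1: "1 < a"
begin

definition P :: "(nat list \<Rightarrow> nat) measure" where "P = PiM UNIV (\<lambda>_. D)"

sublocale P: prob_space P
  unfolding P_def by (intro prob_space_PiM D_prob)

sublocale PP: product_prob_space "\<lambda>_ :: nat list. D" UNIV
  by (intro product_prob_spaceI D_prob)

lemma space_D [simp]: "space D = UNIV"
  using D_sets sets_eq_imp_space_eq[of D "count_space UNIV"] by simp

lemma space_P [simp]: "space P = UNIV"
  by (simp add: P_def space_PiM)

lemma emeasure_P_UNIV [simp]: "emeasure P UNIV = 1"
  using P.emeasure_space_1 by simp

lemma measurable_D_iff: "measurable M D = measurable M (count_space UNIV)"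
  by (rule measurable_cong_sets) (simp_all add: D_sets)

lemma measurable_from_D: "f \<in> measurable D N \<longleftrightarrow> f \<in> UNIV \<rightarrow> space N"
  using measurable_cong_sets[of D "count_space UNIV" N N] by (simp add: D_sets)

lemma coord_measurable [measurable]: "(\<lambda>c. c u) \<in> measurable P (count_space UNIV)"
  unfolding P_def measurable_D_iff[symmetric] by (rule measurable_component_singleton) simp

lemma distr_coord: "distr P D (\<lambda>c. c u) = D"
  unfolding P_def by (rule PP.PiM_component) simp

lemma subtree_measurable [measurable]: "subtree u \<in> measurable P P"
proof -
  have "(\<lambda>c v. c (u @ v)) \<in> measurable P (PiM UNIV (\<lambda>_ :: nat list. D))"
    by (rule measurable_PiM_single') (auto simp: measurable_D_iff)
  then show ?thesis unfolding P_def[symmetric] by (simp add: subtree_def[abs_def])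
qed

text \<open>Prepending \<open>u\<close> is injective, so the shifted labels are again independent
  with law \<open>D\<close>.\<close>

lemma distr_subtree: "distr P P (subtree u) = P"
proof -
  have "distr (PiM UNIV (\<lambda>_. D)) (PiM UNIV (\<lambda>_. D)) (\<lambda>c. \<lambda>v\<in>UNIV. c (u @ v)) = PiM UNIV (\<lambda>_. D)"
    by (rule distr_PiM_reindex[where f = "(@) u" and M = "\<lambda>_. D"]) (auto simp: D_prob inj_on_def)
  then show ?thesis by (simp add: P_def subtree_def[abs_def] restrict_def)
qed

lemma nn_integral_subtree:
  "F \<in> borel_measurable P \<Longrightarrow> (\<integral>\<^sup>+c. F (subtree u c) \<partial>P) = (\<integral>\<^sup>+c. F c \<partial>P)"
  by (subst (2) distr_subtree[of u, symmetric]) (simp add: nn_integral_distr)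

lemma integral_subtree:
  "(F :: _ \<Rightarrow> real) \<in> borel_measurable P \<Longrightarrow> (\<integral>c. F (subtree u c) \<partial>P) = (\<integral>c. F c \<partial>P)"
  by (subst (2) distr_subtree[of u, symmetric]) (simp add: integral_distr)

lemma integrable_subtree:
  "integrable P (F :: _ \<Rightarrow> real) \<Longrightarrow> integrable P (\<lambda>c. F (subtree u c))"
  by (rule integrable_distr[OF subtree_measurable]) (simp add: distr_subtree)

lemma AE_subtree: "AE c in P. Q c \<Longrightarrow> AE c in P. Q (subtree u c)"
  by (rule AE_distrD[OF subtree_measurable]) (simp only: distr_subtree)

lemma AE_all_subtrees: "AE c in P. Q c \<Longrightarrow> AE c in P. \<forall>u. Q (subtree u c)"
  unfolding AE_all_countable by (blast intro: AE_subtree)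

text \<open>A pointwise substitute for measurability with respect to the labels in \<open>A\<close>,
  which avoids handling sub-\<sigma>-algebras.\<close>

definition depends_on :: "nat list set \<Rightarrow> ((nat list \<Rightarrow> nat) \<Rightarrow> 'b) \<Rightarrow> bool" where
  "depends_on A f \<longleftrightarrow> (\<forall>c c'. (\<forall>u\<in>A. c u = c' u) \<longrightarrow> f c = f c')"

lemma depends_on_subtree: "depends_on (range ((@) u)) (\<lambda>c. F (subtree u c))"
proof -
  have "subtree u c = subtree u c'" if "\<forall>w\<in>range ((@) u). c w = c' w" for c c' :: "nat list \<Rightarrow> nat"
    using that by (auto simp: subtree_def)
  then show ?thesis unfolding depends_on_def by metis
qed

lemma depends_on_mult:
  "depends_on A f \<Longrightarrow> depends_on B g \<Longrightarrow> depends_on (A \<union> B) (\<lambda>c. f c * g c)"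
  unfolding depends_on_def by (metis UnCI)

lemma depends_on_level: "depends_on {u. length u < n} (\<lambda>c. f (level c n))"
  unfolding depends_on_def using level_cong by (metis mem_Collect_eq)

lemma indep_vars_coord: "P.indep_vars (\<lambda>_. D) (\<lambda>u c. c u) UNIV"
proof -
  have "P.indep_vars (\<lambda>_. D) (\<lambda>u c. c u) UNIV \<longleftrightarrow>
    distr P (PiM UNIV (\<lambda>_. D)) (\<lambda>c. \<lambda>u\<in>UNIV. c u) = PiM UNIV (\<lambda>u. distr P D (\<lambda>c. c u))"
    by (rule P.indep_vars_iff_distr_eq_PiM) (auto simp: measurable_D_iff)
  then show ?thesis
    by (simp add: distr_coord P_def[symmetric] restrict_def)
qed

text \<open>Filling the missing labels with 0 (\<open>ext\<close>) exhibits \<open>f\<close> as a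
  measurable function of the labels in \<open>A\<close> alone, and \<open>g\<close> likewise for
  \<open>B\<close>; disjoint blocks of independent labels are independent.\<close>

lemma indep_var_depends_on:
  assumes "depends_on A f" "depends_on B g" "A \<inter> B = {}"
    and f [measurable]: "f \<in> measurable P S" and g [measurable]: "g \<in> measurable P T"
  shows "P.indep_var S f T g"
proof -
  define ext where "ext A x = (\<lambda>u. if u \<in> A then x u else (0 :: nat))" for A :: "nat list set" and x
  have ext: "ext A \<in> measurable (PiM A (\<lambda>_. D)) P" for A
    unfolding P_def ext_def
  proof (rule measurable_PiM_single')
    show "(\<lambda>x. if u \<in> A then x u else 0) \<in> measurable (PiM A (\<lambda>_. D)) D" for u
      using measurable_component_singleton[of u A "\<lambda>_. D"] by (cases "u \<in> A") simp_all
  qed auto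
  have "P.indep_var (PiM A (\<lambda>_. D)) (\<lambda>c. restrict c A) (PiM B (\<lambda>_. D)) (\<lambda>c. restrict c B)"
    using P.indep_var_restrict[OF indep_vars_coord assms(3)] by (simp add: restrict_def)
  then have "P.indep_var S ((f \<circ> ext A) \<circ> (\<lambda>c. restrict c A)) T ((g \<circ> ext B) \<circ> (\<lambda>c. restrict c B))"
    by (rule P.indep_var_compose) (auto intro!: measurable_comp[OF ext])
  moreover have "(f \<circ> ext A) \<circ> (\<lambda>c. restrict c A) = f"
    using assms(1) by (auto simp: fun_eq_iff depends_on_def ext_def)
  moreover have "(g \<circ> ext B) \<circ> (\<lambda>c. restrict c B) = g"
    using assms(2) by (auto simp: fun_eq_iff depends_on_def ext_def)
  ultimately show ?thesis by simp
qed

lemma nn_integral_mult_depends_on: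
  fixes f g :: "_ \<Rightarrow> ennreal"
  assumes "depends_on A f" "depends_on B g" "A \<inter> B = {}"
    "f \<in> borel_measurable P" "g \<in> borel_measurable P"
  shows "(\<integral>\<^sup>+c. f c * g c \<partial>P) = (\<integral>\<^sup>+c. f c \<partial>P) * (\<integral>\<^sup>+c. g c \<partial>P)"
proof -
  have "case_bool borel borel = (\<lambda>_. borel :: ennreal measure)"
    by (auto simp: fun_eq_iff split: bool.split)
  then have "P.indep_vars (\<lambda>_. borel) (case_bool f g) UNIV"
    using indep_var_depends_on[OF assms] by (simp add: P.indep_var_def)
  then have "(\<integral>\<^sup>+c. (\<Prod>i\<in>UNIV. case_bool f g i c) \<partial>P) = (\<Prod>i\<in>UNIV. \<integral>\<^sup>+c. case_bool f g i c \<partial>P)"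
    by (intro P.indep_vars_nn_integral) auto
  then show ?thesis by (simp add: UNIV_bool mult.commute)
qed

lemma integral_mult_depends_on:
  fixes f g :: "_ \<Rightarrow> real"
  assumes "depends_on A f" "depends_on B g" "A \<inter> B = {}" "integrable P f" "integrable P g"
  shows "integrable P (\<lambda>c. f c * g c)" "(\<integral>c. f c * g c \<partial>P) = (\<integral>c. f c \<partial>P) * (\<integral>c. g c \<partial>P)"
proof -
  have "P.indep_var borel f borel g"
    by (rule indep_var_depends_on[OF assms(1-3)]) (use assms in auto)
  then show "integrable P (\<lambda>c. f c * g c)" "(\<integral>c. f c * g c \<partial>P) = (\<integral>c. f c \<partial>P) * (\<integral>c. g c \<partial>P)"
    using assms by (auto intro: P.indep_var_integrable P.indep_var_lebesgue_integral)
qed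

section \<open>Measurability and expectation of sums over a generation\<close>

lemma measurable_tree [measurable]: "Measurable.pred P (\<lambda>c. u \<in> gw_tree c)"
proof (induction u rule: rev_induct)
  case Nil
  then show ?case by (simp add: gw_tree.root)
next
  case (snoc k u)
  moreover have "Measurable.pred P (\<lambda>c. k < c u)"
    by (rule measurable_compose[OF coord_measurable]) simp
  ultimately show ?case unfolding gw_tree_snoc_iff by (rule pred_intros_logic)
qed

lemma measurable_level [measurable]: "Measurable.pred P (\<lambda>c. u \<in> level c n)"
  unfolding level_def by simp

lemma borel_measurable_children_sum [measurable (raw)]:
  fixes f :: "nat \<Rightarrow> _ \<Rightarrow> 'b :: {second_countable_topology, topological_comm_monoid_add}"
  assumes [measurable]: "\<And>k. f k \<in> borel_measurable P"
  shows "(\<lambda>c. \<Sum>k<c u. f k c) \<in> borel_measurable P"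
  by (rule measurable_compose_countable[of "\<lambda>n c. \<Sum>k<n. f k c" P borel "\<lambda>c. c u"]) measurable

lemma borel_measurable_level_sum [measurable (raw)]:
  fixes F :: "_ \<Rightarrow> 'b :: {second_countable_topology, topological_comm_monoid_add}"
  assumes [measurable]: "F \<in> borel_measurable P"
  shows "level_sum n F \<in> borel_measurable P"
proof (induction n)
  case 0
  have "level_sum 0 F = F" by (simp add: fun_eq_iff)
  then show ?case by simp
next
  case (Suc n)
  note [measurable] = this
  have "level_sum (Suc n) F = (\<lambda>c. \<Sum>k<c []. level_sum n F (subtree [k] c))"
    by (simp add: fun_eq_iff level_sum_Suc)
  then show ?case by simp
qed

lemma measurable_gw_level [measurable]: "(\<lambda>c. gw_level c n) \<in> measurable P (count_space UNIV)"
proof -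
  have "(\<lambda>c. real (gw_level c n)) \<in> borel_measurable P"
    unfolding of_nat_gw_level by measurable
  then have "(\<lambda>c. nat \<lfloor>real (gw_level c n)\<rfloor>) \<in> measurable P (count_space UNIV)"
    by measurable
  then show ?thesis by simp
qed

lemma depends_on_gw_level: "depends_on {u. length u < n} (\<lambda>c. f (gw_level c n))"
  unfolding gw_level_eq_card by (rule depends_on_level)

text \<open>The level is a random set; a series over all words, enumerated by
  \<open>list_decode\<close>, has fixed indices and can be exchanged with the integral.\<close>

lemma sum_level_eq_suminf:
  fixes G :: "nat list \<Rightarrow> ennreal"
  shows "(\<Sum>u\<in>level c n. G u) = (\<Sum>i. indicator (level c n) (list_decode i) * G (list_decode i))"
proof -
  have "(\<Sum>i. indicator (level c n) (list_decode i) * G (list_decode i))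
      = (\<Sum>i\<in>list_encode ` level c n. indicator (level c n) (list_decode i) * G (list_decode i))"
  proof (rule suminf_finite)
    fix i assume "i \<notin> list_encode ` level c n"
    then have "list_decode i \<notin> level c n"
      by (metis imageI list_decode_inverse)
    then show "indicator (level c n) (list_decode i) * G (list_decode i) = 0" by simp
  qed simp
  also have "\<dots> = (\<Sum>u\<in>level c n. G u)"
    by (subst sum.reindex) (auto simp: inj_list_encode)
  finally show ?thesis by simp
qed

text \<open>The subtrees rooted at level \<open>m\<close> are independent of the first \<open>m\<close> generations.\<close>

lemma nn_integral_level_sum:
  fixes h F :: "_ \<Rightarrow> ennreal"
  assumes h: "depends_on {u. length u < m} h"
    and [measurable]: "h \<in> borel_measurable P" "F \<in> borel_measurable P"
  shows "(\<integral>\<^sup>+c. h c * level_sum m F c \<partial>P) = (\<integral>\<^sup>+c. h c * of_nat (gw_level c m) \<partial>P) * (\<integral>\<^sup>+c. F c \<partial>P)"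
proof -
  have gen: "(\<integral>\<^sup>+c. h c * level_sum m F c \<partial>P) =
    (\<Sum>i. \<integral>\<^sup>+c. h c * indicator (level c m) (list_decode i) \<partial>P) * (\<integral>\<^sup>+c. F c \<partial>P)"
    if [measurable]: "F \<in> borel_measurable P" for F
  proof -
    have "(\<integral>\<^sup>+c. h c * level_sum m F c \<partial>P)
        = (\<integral>\<^sup>+c. (\<Sum>i. h c * indicator (level c m) (list_decode i) * F (subtree (list_decode i) c)) \<partial>P)"
      by (simp add: level_sum_def sum_level_eq_suminf mult.assoc)
    also have "\<dots> = (\<Sum>i. \<integral>\<^sup>+c. h c * indicator (level c m) (list_decode i) * F (subtree (list_decode i) c) \<partial>P)"
      by (rule nn_integral_suminf) measurable
    also have "\<dots> = (\<Sum>i. (\<integral>\<^sup>+c. h c * indicator (level c m) (list_decode i) \<partial>P) * (\<integral>\<^sup>+c. F c \<partial>P))"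
    proof (rule suminf_cong)
      fix i
      let ?u = "list_decode i"
      show "(\<integral>\<^sup>+c. h c * indicator (level c m) ?u * F (subtree ?u c) \<partial>P)
        = (\<integral>\<^sup>+c. h c * indicator (level c m) ?u \<partial>P) * (\<integral>\<^sup>+c. F c \<partial>P)"
      proof (cases "length ?u = m")
        case True
        have "depends_on ({u. length u < m} \<union> {u. length u < m}) (\<lambda>c. h c * indicator (level c m) ?u)"
          by (rule depends_on_mult[OF h depends_on_level])
        then have "(\<integral>\<^sup>+c. h c * indicator (level c m) ?u * F (subtree ?u c) \<partial>P)
            = (\<integral>\<^sup>+c. h c * indicator (level c m) ?u \<partial>P) * (\<integral>\<^sup>+c. F (subtree ?u c) \<partial>P)"
          by (intro nn_integral_mult_depends_on[OF _ depends_on_subtree]) (use True in auto)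
        then show ?thesis by (simp add: nn_integral_subtree)
      next
        case False
        then have "?u \<notin> level c m" for c by (auto dest: length_level)
        then show ?thesis by simp
      qed
    qed
    finally show ?thesis by (simp add: ennreal_suminf_multc)
  qed
  \<comment> \<open>The case \<open>F = 1\<close> identifies the series as the mean of
    \<open>h\<close> times the population.\<close>
  have "(\<integral>\<^sup>+c. h c * of_nat (gw_level c m) \<partial>P) = (\<Sum>i. \<integral>\<^sup>+c. h c * indicator (level c m) (list_decode i) \<partial>P)"
    using gen[of "\<lambda>_. 1"] by (simp add: of_nat_gw_level P.emeasure_space_1)
  with gen[of F] show ?thesis by simp
qed

section \<open>Population sizes and the normalised martingale\<close>

lemma nn_integral_root: "(\<integral>\<^sup>+c. of_nat (c []) \<partial>P) = ennreal a"
proof -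
  have "(\<integral>\<^sup>+c. of_nat (c []) \<partial>P) = (\<integral>\<^sup>+k. of_nat k \<partial>distr P D (\<lambda>c. c []))"
    by (subst nn_integral_distr) (auto simp: measurable_D_iff measurable_from_D)
  also have "\<dots> = (\<integral>\<^sup>+k. ennreal (real k) \<partial>D)"
    by (simp add: distr_coord ennreal_of_nat_eq_real_of_nat)
  also have "\<dots> = ennreal a"
    by (subst nn_integral_eq_integral[OF D_int]) (auto simp: a_eq)
  finally show ?thesis .
qed

lemma gw_level_Suc: "gw_level c (Suc n) = level_sum n (\<lambda>c. c []) c"
proof -
  have "gw_level c (n + 1) = level_sum n (\<lambda>c. gw_level c 1) c"
    using of_nat_gw_level_add[of c n 1, where 'a = nat] by simp
  moreover have "gw_level c 1 = c []" for c
    using of_nat_gw_level[of c "Suc 0", where 'a = nat] by (simp add: level_sum_Suc)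
  ultimately show ?thesis by simp
qed

text \<open>The martingale property before normalisation, tested against weights \<open>h\<close>
  determined by the first \<open>n\<close> generations.\<close>

lemma nn_integral_gw_level_Suc:
  assumes h: "depends_on {u. length u < n} h" and [measurable]: "h \<in> borel_measurable P"
  shows "(\<integral>\<^sup>+c. h c * of_nat (gw_level c (Suc n)) \<partial>P) = (\<integral>\<^sup>+c. h c * of_nat (gw_level c n) \<partial>P) * ennreal a"
proof -
  have "of_nat (gw_level c (Suc n)) = level_sum n (\<lambda>c. of_nat (c []) :: ennreal) c" for c
    by (simp add: gw_level_Suc level_sum_def)
  then show ?thesis
    using nn_integral_level_sum[OF h, of "\<lambda>c. of_nat (c [])"] by (simp add: nn_integral_root)
qed

lemma nn_integral_gw_level: "(\<integral>\<^sup>+c. of_nat (gw_level c n) \<partial>P) = ennreal (a ^ n)"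
proof (induction n)
  case (Suc n)
  have "(\<integral>\<^sup>+c. 1 * of_nat (gw_level c (Suc n)) \<partial>P) = (\<integral>\<^sup>+c. 1 * of_nat (gw_level c n) \<partial>P) * ennreal a"
    by (rule nn_integral_gw_level_Suc) (auto simp: depends_on_def)
  then show ?case using Suc a_gt_1 by (simp add: ennreal_mult'[symmetric] mult.commute)
qed (simp add: P.emeasure_space_1)

lemma nn_integral_level_sum':
  assumes "F \<in> borel_measurable P"
  shows "(\<integral>\<^sup>+c. level_sum m F c \<partial>P) = ennreal (a ^ m) * (\<integral>\<^sup>+c. F c \<partial>P)"
  using nn_integral_level_sum[of m "\<lambda>_. 1" F] assms
  by (simp add: nn_integral_gw_level depends_on_def)

definition Mn :: "nat \<Rightarrow> (nat list \<Rightarrow> nat) \<Rightarrow> real" where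
  "Mn n c = gw_level c n / a ^ n"

definition W :: "(nat list \<Rightarrow> nat) \<Rightarrow> real" where
  "W c = lim (\<lambda>n. Mn n c)"

lemma Mn_measurable [measurable]: "Mn n \<in> borel_measurable P"
  unfolding Mn_def[abs_def] by measurable

lemma W_measurable [measurable]: "W \<in> borel_measurable P"
  unfolding W_def[abs_def] by measurable

lemma Mn_nonneg: "0 \<le> Mn n c"
  using a_gt_1 by (simp add: Mn_def)

lemma Mn_0 [simp]: "Mn 0 c = 1"
  by (simp add: Mn_def)

lemma ennreal_Mn: "ennreal (Mn n c) = of_nat (gw_level c n) * ennreal (1 / a ^ n)"
  using a_gt_1 by (simp add: Mn_def ennreal_of_nat_eq_real_of_nat ennreal_mult'[symmetric])

lemma nn_integral_Mn: "(\<integral>\<^sup>+c. ennreal (Mn n c) \<partial>P) = 1"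
  using a_gt_1 by (simp add: ennreal_Mn nn_integral_multc nn_integral_gw_level ennreal_mult'[symmetric])

lemma integrable_Mn: "integrable P (Mn n)"
  by (rule integrableI_nonneg) (auto simp: Mn_nonneg nn_integral_Mn)

lemma integral_Mn: "(\<integral>c. Mn n c \<partial>P) = 1"
  by (subst integral_eq_nn_integral) (auto simp: Mn_nonneg nn_integral_Mn)

lemma AE_convergent_Mn: "AE c in P. convergent (\<lambda>n. Mn n c)"
proof (rule P.nonneg_martingale_convergent[OF integrable_Mn Mn_nonneg])
  fix n A
  assume A [measurable]: "A \<in> sets P"
    and dep: "\<And>c c'. c \<in> space P \<Longrightarrow> c' \<in> space P \<Longrightarrow> (\<And>k. k \<le> n \<Longrightarrow> Mn k c = Mn k c') \<Longrightarrow> c \<in> A \<Longrightarrow> c' \<in> A"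
  \<comment> \<open>The labels of words shorter than \<open>n\<close> determine the populations up
    to level \<open>n\<close>, hence membership in the saturated set \<open>A\<close>.\<close>
  have "depends_on {u. length u < n} (indicator A :: _ \<Rightarrow> ennreal)"
    unfolding depends_on_def
  proof safe
    fix c c' :: "nat list \<Rightarrow> nat" assume *: "\<forall>u\<in>{u. length u < n}. c u = c' u"
    have "gw_level c k = gw_level c' k" if "k \<le> n" for k
      unfolding gw_level_eq_card using * that by (subst level_cong[of k c c']) auto
    then have "Mn k c = Mn k c'" if "k \<le> n" for k
      using that by (simp add: Mn_def)
    then have "c \<in> A \<longleftrightarrow> c' \<in> A" using dep[of c c'] dep[of c' c] by auto
    then show "indicator A c = (indicator A c' :: ennreal)" by (simp add: indicator_def)
  qed
  then have *: "(\<integral>\<^sup>+c. indicator A c * of_nat (gw_level c (Suc n)) \<partial>P)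
      = (\<integral>\<^sup>+c. indicator A c * of_nat (gw_level c n) \<partial>P) * ennreal a"
    by (rule nn_integral_gw_level_Suc) measurable
  have eq: "(\<integral>\<^sup>+c. ennreal (indicator A c * Mn k c) \<partial>P)
      = (\<integral>\<^sup>+c. indicator A c * of_nat (gw_level c k) \<partial>P) * ennreal (1 / a ^ k)" for k
    by (subst nn_integral_multc[symmetric])
      (auto simp: ennreal_mult' ennreal_indicator ennreal_Mn mult.assoc Mn_nonneg)
  have "(\<integral>\<^sup>+c. ennreal (indicator A c * Mn (Suc n) c) \<partial>P) = (\<integral>\<^sup>+c. ennreal (indicator A c * Mn n c) \<partial>P)"
    unfolding eq * using a_gt_1 by (simp add: mult.assoc ennreal_mult'[symmetric])
  then show "(\<integral>c. indicator A c * Mn (Suc n) c \<partial>P) = (\<integral>c. indicator A c * Mn n c \<partial>P)"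
    by (simp add: integral_eq_nn_integral Mn_nonneg)
qed

text \<open>There are countably many words, so convergence in all subtrees at once is almost sure;
  being inherited by subtrees, it allows recursive estimates for a fixed labelling.\<close>

definition good :: "(nat list \<Rightarrow> nat) \<Rightarrow> bool" where
  "good c \<longleftrightarrow> (\<forall>u. convergent (\<lambda>n. Mn n (subtree u c)))"

lemma AE_good: "AE c in P. good c"
  unfolding good_def by (rule AE_all_subtrees[OF AE_convergent_Mn])

lemma good_subtree: "good c \<Longrightarrow> good (subtree u c)"
  by (simp add: good_def subtree_subtree)

lemma good_LIMSEQ: "good c \<Longrightarrow> (\<lambda>n. Mn n c) \<longlonglongrightarrow> W c"
  unfolding good_def W_def by (metis convergent_LIMSEQ_iff subtree_Nil)

lemma good_W_nonneg: "good c \<Longrightarrow> 0 \<le> W c"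
  by (rule LIMSEQ_le_const[OF good_LIMSEQ]) (auto simp: Mn_nonneg)

lemma Mn_add: "Mn (m + n) c = level_sum m (Mn n) c / a ^ m"
  unfolding Mn_def of_nat_gw_level_add level_sum_def
  by (simp add: sum_divide_distrib power_add mult.commute)

text \<open>The branching identity for \<open>Mn\<close> passes to the limit because the sum over
  level \<open>m\<close> is finite.\<close>

lemma good_W_eq:
  assumes "good c"
  shows "W c = level_sum m W c / a ^ m"
proof -
  have "(\<lambda>n. level_sum m (Mn n) c / a ^ m) \<longlonglongrightarrow> level_sum m W c / a ^ m"
    unfolding level_sum_def using a_gt_1
    by (intro tendsto_intros good_LIMSEQ good_subtree assms) auto
  then have "(\<lambda>n. Mn (n + m) c) \<longlonglongrightarrow> level_sum m W c / a ^ m"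
    by (simp add: Mn_add add.commute[of _ m])
  then have "(\<lambda>n. Mn n c) \<longlonglongrightarrow> level_sum m W c / a ^ m"
    by (rule LIMSEQ_offset)
  with good_LIMSEQ[OF assms] show ?thesis
    by (rule LIMSEQ_unique)
qed

text \<open>Splitting by the number of children of the root makes the number of summands
  deterministic, so that independence can be applied to finite sums.\<close>

lemma nn_integral_split_root:
  fixes g :: "nat \<Rightarrow> _ \<Rightarrow> ennreal"
  assumes [measurable]: "\<And>n. g n \<in> borel_measurable P"
  shows "(\<integral>\<^sup>+c. g (c []) c \<partial>P) = (\<Sum>n. \<integral>\<^sup>+c. indicator {c. c [] = n} c * g n c \<partial>P)"
proof -
  have [measurable]: "{c. c [] = n} \<in> sets P" for n
  proof -
    have "{c \<in> space P. c [] = n} \<in> sets P" by measurable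
    then show ?thesis by simp
  qed
  have "g (c []) c = (\<Sum>n. indicator {c. c [] = n} c * g n c)" for c
    by (subst suminf_finite[where N = "{c []}"]) auto
  then have "(\<integral>\<^sup>+c. g (c []) c \<partial>P) = (\<integral>\<^sup>+c. (\<Sum>n. indicator {c. c [] = n} c * g n c) \<partial>P)"
    by simp
  also have "\<dots> = (\<Sum>n. \<integral>\<^sup>+c. indicator {c. c [] = n} c * g n c \<partial>P)"
    by (rule nn_integral_suminf) measurable
  finally show ?thesis .
qed

text \<open>Wald's second identity: the cross terms have mean zero.\<close>

lemma nn_integral_children_sum_sq:
  assumes Y: "integrable P Y" and sq: "integrable P (\<lambda>c. (Y c)\<^sup>2)" and zero: "(\<integral>c. Y c \<partial>P) = 0"
  shows "(\<integral>\<^sup>+c. ennreal ((\<Sum>k<c []. Y (subtree [k] c))\<^sup>2) \<partial>P) = ennreal a * (\<integral>\<^sup>+c. ennreal ((Y c)\<^sup>2) \<partial>P)"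
proof -
  have [measurable]: "Y \<in> borel_measurable P" using Y by auto
  have [measurable]: "{c. c [] = n} \<in> sets P" for n
  proof -
    have "{c \<in> space P. c [] = n} \<in> sets P" by measurable
    then show ?thesis by simp
  qed
  let ?I = "\<lambda>n c. indicator {c. c [] = n} c :: real"
  have intI: "integrable P (?I n)" for n
    by (rule integrable_real_indicator) (auto simp: P.emeasure_eq_measure)
  have depI: "depends_on {[]} (?I n)" for n
    by (auto simp: depends_on_def indicator_def)
  \<comment> \<open>The indicator depends on the root label alone and, for different
    \<open>i\<close> and \<open>j\<close>, the other two factors depend on disjoint subtrees; the
    expectation factorises and the zero mean annihilates it.\<close>
  have pair: "integrable P (\<lambda>c. ?I n c * (Y (subtree [i] c) * Y (subtree [j] c))) \<and>
      (\<integral>c. ?I n c * (Y (subtree [i] c) * Y (subtree [j] c)) \<partial>P)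
        = (if i = j then (\<integral>c. ?I n c \<partial>P) * (\<integral>c. (Y c)\<^sup>2 \<partial>P) else 0)" for i j n
  proof (cases "i = j")
    case True
    have dep: "depends_on (range ((@) [i])) (\<lambda>c. (Y (subtree [i] c))\<^sup>2)"
      by (rule depends_on_subtree[where F = "\<lambda>c. (Y c)\<^sup>2"])
    have int: "integrable P (\<lambda>c. (Y (subtree [i] c))\<^sup>2)"
      by (rule integrable_subtree[OF sq])
    have "{[]} \<inter> range ((@) [i]) = {}" by auto
    from integral_mult_depends_on[OF depI dep this intI int] True
    show ?thesis using integral_subtree[of "\<lambda>c. (Y c)\<^sup>2" "[i]"] by (simp add: power2_eq_square)
  next
    case False
    have disj: "{[]} \<inter> range ((@) [i]) = {}" by auto
    note f = integral_mult_depends_on[OF depI depends_on_subtree disj intI integrable_subtree[OF Y]]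
    have disj2: "({[]} \<union> range ((@) [i])) \<inter> range ((@) [j]) = {}" using False by auto
    note fg = integral_mult_depends_on[OF depends_on_mult[OF depI depends_on_subtree] depends_on_subtree disj2
        f(1) integrable_subtree[OF Y]]
    from fg[of n] False show ?thesis
      using integral_subtree[of Y "[j]"] by (simp add: zero mult.assoc)
  qed
  have expand: "?I n c * (\<Sum>k<n. Y (subtree [k] c))\<^sup>2
      = (\<Sum>i<n. \<Sum>j<n. ?I n c * (Y (subtree [i] c) * Y (subtree [j] c)))" for n c
    by (simp only: power2_eq_square sum_product, simp only: sum_distrib_left)
  have int_n: "integrable P (\<lambda>c. ?I n c * (\<Sum>k<n. Y (subtree [k] c))\<^sup>2)" for n
    unfolding expand using pair by (intro Bochner_Integration.integrable_sum) blast
  have E_n: "(\<integral>c. ?I n c * (\<Sum>k<n. Y (subtree [k] c))\<^sup>2 \<partial>P) = real n * (\<integral>c. ?I n c \<partial>P) * (\<integral>c. (Y c)\<^sup>2 \<partial>P)" for n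
  proof -
    have "(\<integral>c. ?I n c * (\<Sum>k<n. Y (subtree [k] c))\<^sup>2 \<partial>P)
      = (\<Sum>i<n. \<Sum>j<n. \<integral>c. ?I n c * (Y (subtree [i] c) * Y (subtree [j] c)) \<partial>P)"
    proof -
      have "integrable P (\<lambda>c. \<Sum>j<n. ?I n c * (Y (subtree [i] c) * Y (subtree [j] c)))" for i
        using pair by (intro Bochner_Integration.integrable_sum) blast
      moreover have "(\<integral>c. (\<Sum>j<n. ?I n c * (Y (subtree [i] c) * Y (subtree [j] c))) \<partial>P)
          = (\<Sum>j<n. \<integral>c. ?I n c * (Y (subtree [i] c) * Y (subtree [j] c)) \<partial>P)" for i
        using pair by (intro Bochner_Integration.integral_sum) blast
      ultimately show ?thesis
        unfolding expand by (subst Bochner_Integration.integral_sum) auto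
    qed
    also have "\<dots> = (\<Sum>i<n. \<Sum>j<n. if i = j then (\<integral>c. ?I n c \<partial>P) * (\<integral>c. (Y c)\<^sup>2 \<partial>P) else 0)"
      using pair by (intro sum.cong refl) blast
    finally show ?thesis by simp
  qed
  have nn_n: "(\<integral>\<^sup>+c. indicator {c. c [] = n} c * ennreal ((\<Sum>k<n. Y (subtree [k] c))\<^sup>2) \<partial>P)
      = (\<integral>\<^sup>+c. indicator {c. c [] = n} c * of_nat n \<partial>P) * (\<integral>\<^sup>+c. ennreal ((Y c)\<^sup>2) \<partial>P)" for n
  proof -
    have "(\<integral>\<^sup>+c. indicator {c. c [] = n} c * ennreal ((\<Sum>k<n. Y (subtree [k] c))\<^sup>2) \<partial>P)
       = (\<integral>\<^sup>+c. ennreal (?I n c * (\<Sum>k<n. Y (subtree [k] c))\<^sup>2) \<partial>P)"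
      by (simp add: ennreal_mult' ennreal_indicator)
    also have "\<dots> = ennreal (real n * (\<integral>c. ?I n c \<partial>P) * (\<integral>c. (Y c)\<^sup>2 \<partial>P))"
      by (subst nn_integral_eq_integral[OF int_n]) (simp_all add: E_n)
    also have "\<dots> = ennreal (\<integral>c. ?I n c * real n \<partial>P) * ennreal (\<integral>c. (Y c)\<^sup>2 \<partial>P)"
      by (simp add: ennreal_mult' mult.commute)
    also have "ennreal (\<integral>c. ?I n c * real n \<partial>P) = (\<integral>\<^sup>+c. ennreal (?I n c * real n) \<partial>P)"
      by (rule nn_integral_eq_integral[symmetric]) (use intI in auto)
    also have "\<dots> = (\<integral>\<^sup>+c. indicator {c. c [] = n} c * of_nat n \<partial>P)"
      by (simp add: ennreal_mult' ennreal_indicator ennreal_of_nat_eq_real_of_nat)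
    also have "ennreal (\<integral>c. (Y c)\<^sup>2 \<partial>P) = (\<integral>\<^sup>+c. ennreal ((Y c)\<^sup>2) \<partial>P)"
      by (rule nn_integral_eq_integral[symmetric]) (use sq in auto)
    finally show ?thesis .
  qed
  have "(\<integral>\<^sup>+c. ennreal ((\<Sum>k<c []. Y (subtree [k] c))\<^sup>2) \<partial>P)
      = (\<Sum>n. (\<integral>\<^sup>+c. indicator {c. c [] = n} c * of_nat n \<partial>P) * (\<integral>\<^sup>+c. ennreal ((Y c)\<^sup>2) \<partial>P))"
    using nn_integral_split_root[of "\<lambda>n c. ennreal ((\<Sum>k<n. Y (subtree [k] c))\<^sup>2)"] by (simp add: nn_n)
  also have "\<dots> = (\<integral>\<^sup>+c. of_nat (c []) \<partial>P) * (\<integral>\<^sup>+c. ennreal ((Y c)\<^sup>2) \<partial>P)"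
    using nn_integral_split_root[of "\<lambda>n c. of_nat n"] by simp
  finally show ?thesis by (simp add: nn_integral_root)
qed

lemma Mn_Suc: "Mn (Suc n) c = (\<Sum>k<c []. Mn n (subtree [k] c)) / a"
  using Mn_add[of "Suc 0" n c] by (simp add: level_sum_Suc)

lemma good_W_children: "good c \<Longrightarrow> W c = (\<Sum>k<c []. W (subtree [k] c)) / a"
  using good_W_eq[of c "Suc 0"] by (simp add: level_sum_Suc)

end

text \<open>The second moment is required of the limit itself because that is what the tail of
  \<open>W\<close> delivers directly. Positivity of the mean selects \<open>w = 1\<close> from
  \<open>w = w * w\<close>.\<close>

locale gw_space_L2 = gw_space +
  assumes W_sq: "integrable P (\<lambda>c. (W c)\<^sup>2)" and W_mean_pos: "0 < (\<integral>c. W c \<partial>P)"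
begin

lemma integrable_W: "integrable P W"
  by (rule P.square_integrable_imp_integrable[OF W_measurable W_sq])

text \<open>The deviation at \<open>m + 1\<close> is the sum over the children of their deviations
  at \<open>m\<close>, divided by \<open>a\<close>; Wald's identity turns this into a factor
  \<open>a / a^2\<close> per generation. The mean \<open>w\<close> stays general since its value is
  not yet known.\<close>

lemma W_Mn_L2:
  defines "w \<equiv> \<integral>c. W c \<partial>P"
  shows "(\<integral>\<^sup>+c. ennreal ((W c - w * Mn m c)\<^sup>2) \<partial>P) = ennreal ((\<integral>c. (W c - w)\<^sup>2 \<partial>P) / a ^ m)"
proof (induction m)
  case 0
  have "integrable P (\<lambda>c. (W c - w)\<^sup>2)"
    using integrable_W W_sq by (simp add: power2_diff)
  then show ?case
    by (simp add: nn_integral_eq_integral)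
next
  case (Suc m)
  let ?Y = "\<lambda>c. W c - w * Mn m c"
  have Y: "integrable P ?Y" using integrable_W integrable_Mn by auto
  have zero: "(\<integral>c. ?Y c \<partial>P) = 0"
    using integrable_W integrable_Mn[of m] by (simp add: integral_Mn w_def)
  have sq: "integrable P (\<lambda>c. (?Y c)\<^sup>2)"
    by (rule integrableI_nonneg) (auto simp: Suc)
  have "(\<integral>\<^sup>+c. ennreal ((W c - w * Mn (Suc m) c)\<^sup>2) \<partial>P)
      = (\<integral>\<^sup>+c. ennreal (1 / a\<^sup>2) * ennreal ((\<Sum>k<c []. ?Y (subtree [k] c))\<^sup>2) \<partial>P)"
  proof (rule nn_integral_cong_AE)
    show "AE c in P. ennreal ((W c - w * Mn (Suc m) c)\<^sup>2)
        = ennreal (1 / a\<^sup>2) * ennreal ((\<Sum>k<c []. ?Y (subtree [k] c))\<^sup>2)"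
      using AE_good
    proof eventually_elim
      case (elim c)
      have "W c - w * Mn (Suc m) c = (\<Sum>k<c []. ?Y (subtree [k] c)) / a"
        by (simp add: good_W_children[OF elim] Mn_Suc sum_subtractf sum_distrib_left diff_divide_distrib)
      then show ?case by (simp add: ennreal_mult'[symmetric] power_divide)
    qed
  qed
  also have "\<dots> = ennreal (1 / a\<^sup>2) * (ennreal a * (\<integral>\<^sup>+c. ennreal ((?Y c)\<^sup>2) \<partial>P))"
    by (subst nn_integral_cmult) (auto simp only: nn_integral_children_sum_sq[OF Y sq zero], measurable)
  also have "\<dots> = ennreal ((\<integral>c. (W c - w)\<^sup>2 \<partial>P) / a ^ Suc m)"
    unfolding Suc using a_gt_1
    by (simp add: ennreal_mult'[symmetric] power2_eq_square field_simps)
  finally show ?case .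
qed

lemma W_Mn_L1:
  defines "w \<equiv> \<integral>c. W c \<partial>P"
  shows "(\<integral>\<^sup>+c. ennreal \<bar>W c - w * Mn m c\<bar> \<partial>P) \<le> ennreal ((1 + (\<integral>c. (W c - w)\<^sup>2 \<partial>P)) / 2 * (1 / sqrt a) ^ m)"
proof -
  \<comment> \<open>With \<open>t = a^(-m/2)\<close> both terms on the right of
    \<open>2 * t * \<bar>y\<bar> \<le> t * t + y^2\<close>, divided by \<open>2 * t\<close>,
    contribute order \<open>a^(-m/2)\<close>.\<close>
  define t where "t = (1 / sqrt a) ^ m"
  have t: "0 < t" using a_gt_1 by (simp add: t_def)
  have t2: "t * t = 1 / a ^ m"
    using a_gt_1 by (simp add: t_def power_mult_distrib[symmetric] power_one_over)
  let ?V = "\<integral>c. (W c - w)\<^sup>2 \<partial>P"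
  have le: "\<bar>y\<bar> \<le> t / 2 + 1 / (2 * t) * y\<^sup>2" for y :: real
  proof -
    have "0 \<le> (\<bar>y\<bar> - t)\<^sup>2" by simp
    then have "2 * t * \<bar>y\<bar> \<le> t * t + y\<^sup>2"
      by (simp add: power2_diff power2_eq_square[of t] algebra_simps)
    then have "2 * t * \<bar>y\<bar> / (2 * t) \<le> (t * t + y\<^sup>2) / (2 * t)"
      using t by (intro divide_right_mono) auto
    then show ?thesis using t by (simp add: add_divide_distrib)
  qed
  have "(\<integral>\<^sup>+c. ennreal \<bar>W c - w * Mn m c\<bar> \<partial>P)
      \<le> (\<integral>\<^sup>+c. ennreal (t / 2) + ennreal (1 / (2 * t)) * ennreal ((W c - w * Mn m c)\<^sup>2) \<partial>P)"
    using le t by (intro nn_integral_mono) (simp add: ennreal_mult'[symmetric] ennreal_plus[symmetric] ennreal_leI del: ennreal_plus)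
  also have "\<dots> = ennreal (t / 2) + ennreal (1 / (2 * t)) * ennreal (?V / a ^ m)"
    by (subst nn_integral_add) (auto simp: nn_integral_cmult W_Mn_L2[folded w_def])
  also have "\<dots> = ennreal (t / 2 + 1 / (2 * t) * (?V * (t * t)))"
    using t a_gt_1 unfolding t2 by (simp add: ennreal_mult'[symmetric] ennreal_plus[symmetric] del: ennreal_plus)
  also have "t / 2 + 1 / (2 * t) * (?V * (t * t)) = (1 + ?V) / 2 * t"
    using t by (simp add: field_simps)
  finally show ?thesis by (simp add: t_def)
qed

text \<open>\<open>Mn m\<close> tends to \<open>W\<close> almost surely and
  \<open>W - w * Mn m\<close> tends to 0 in mean, so Fatou's lemma gives \<open>W = w * W\<close>
  almost surely; integrate to get \<open>w = w * w\<close>.\<close>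

lemma W_mean: "(\<integral>c. W c \<partial>P) = 1"
proof -
  define w where "w = (\<integral>c. W c \<partial>P)"
  let ?C = "(1 + (\<integral>c. (W c - w)\<^sup>2 \<partial>P)) / 2"
  have "(\<integral>\<^sup>+c. liminf (\<lambda>m. ennreal \<bar>W c - w * Mn m c\<bar>) \<partial>P) \<le> liminf (\<lambda>m. \<integral>\<^sup>+c. ennreal \<bar>W c - w * Mn m c\<bar> \<partial>P)"
    by (rule nn_integral_liminf) auto
  also have "\<dots> \<le> liminf (\<lambda>m. ennreal (?C * (1 / sqrt a) ^ m))"
    by (intro Liminf_mono always_eventually allI W_Mn_L1[folded w_def])
  also have "\<dots> = ennreal (?C * 0)"
    using a_gt_1 by (intro lim_imp_Liminf tendsto_ennrealI tendsto_mult tendsto_const LIMSEQ_power_zero) auto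
  finally have "(\<integral>\<^sup>+c. liminf (\<lambda>m. ennreal \<bar>W c - w * Mn m c\<bar>) \<partial>P) = 0" by simp
  moreover have "(\<integral>\<^sup>+c. liminf (\<lambda>m. ennreal \<bar>W c - w * Mn m c\<bar>) \<partial>P) = (\<integral>\<^sup>+c. ennreal \<bar>W c - w * W c\<bar> \<partial>P)"
  proof (rule nn_integral_cong_AE)
    show "AE c in P. liminf (\<lambda>m. ennreal \<bar>W c - w * Mn m c\<bar>) = ennreal \<bar>W c - w * W c\<bar>"
      using AE_good
    proof eventually_elim
      case (elim c)
      show ?case
        by (intro lim_imp_Liminf tendsto_ennrealI tendsto_intros good_LIMSEQ elim) simp
    qed
  qed
  ultimately have "(\<integral>\<^sup>+c. ennreal \<bar>W c - w * W c\<bar> \<partial>P) = 0"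
    by simp
  then have "AE c in P. ennreal \<bar>W c - w * W c\<bar> = 0"
    by (subst (asm) nn_integral_0_iff_AE) auto
  then have "(\<integral>c. W c - w * W c \<partial>P) = (\<integral>c. 0 \<partial>P)"
    by (intro integral_cong_AE) auto
  then have "w - w * w = 0"
    using integrable_W by (simp add: w_def)
  then show ?thesis using W_mean_pos by (auto simp: w_def[symmetric] algebra_simps)
qed

lemma W_Mn_dist:
  obtains C where "0 \<le> C" "\<And>m. (\<integral>\<^sup>+c. ennreal \<bar>W c - Mn m c\<bar> \<partial>P) \<le> ennreal (C * (1 / sqrt a) ^ m)"
proof
  show "0 \<le> (1 + (\<integral>c. (W c - 1)\<^sup>2 \<partial>P)) / 2" by (simp add: add_nonneg_nonneg)
  show "(\<integral>\<^sup>+c. ennreal \<bar>W c - Mn m c\<bar> \<partial>P) \<le> ennreal ((1 + (\<integral>c. (W c - 1)\<^sup>2 \<partial>P)) / 2 * (1 / sqrt a) ^ m)" for m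
    using W_Mn_L1[of m] by (simp add: W_mean)
qed

end

section \<open>Exponential moments\<close>

lemma term_le_suminf_ennreal: "f n \<le> (\<Sum>k. f k :: ennreal)"
  using sum_le_suminf[of f "{n}"] by simp

context regular_varying
begin

text \<open>For large \<open>x\<close> the gap between \<open>d\<close> and \<open>d'\<close>
  absorbs the power; for small \<open>x\<close> monotonicity of the left side provides the constant
  \<open>B\<close>.\<close>

lemma power_exp_R_bound:
  assumes "0 < d" "d < d'"
  obtains B where "0 \<le> B" "\<And>x. 0 < x \<Longrightarrow> x ^ p * exp (R (d * x)) \<le> B + exp (R (d' * x))"
proof -
  have "\<forall>\<^sub>F x in at_top. R (d * x) + real p * ln x + 0 \<le> R (d' * x)"
    using assms by (rule eventually_R_gap_ln)
  then obtain x0 where x0: "\<And>x. x \<ge> x0 \<Longrightarrow> R (d * x) + real p * ln x \<le> R (d' * x)"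
    by (auto simp: eventually_at_top_linorder)
  define x1 where "x1 = max x0 1"
  show thesis
  proof (rule that[of "x1 ^ p * exp (R (d * x1))"])
    fix x :: real assume x: "0 < x"
    show "x ^ p * exp (R (d * x)) \<le> x1 ^ p * exp (R (d * x1)) + exp (R (d' * x))"
    proof (cases "x1 \<le> x")
      case True
      then have "exp (R (d * x) + real p * ln x) \<le> exp (R (d' * x))"
        using x0[of x] by (simp add: x1_def)
      moreover have "exp (R (d * x) + real p * ln x) = x ^ p * exp (R (d * x))"
        using x by (simp add: exp_add exp_of_nat_mult)
      moreover have "0 \<le> x1 ^ p * exp (R (d * x1))" by (simp add: x1_def)
      ultimately show ?thesis by simp
    next
      case False
      have "x ^ p * exp (R (d * x)) \<le> x1 ^ p * exp (R (d * x1))"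
        using False x assms by (intro mult_mono power_mono) (auto intro: R_le)
      then show ?thesis by (simp add: add_increasing2)
    qed
  qed (simp add: x1_def)
qed

text \<open>\<open>R\<close> is monotone on the open half-line only; the value 0 elsewhere makes the
  function monotone on the whole line.\<close>

lemma exp_R_measurable [measurable]: "(\<lambda>x. if 0 < x then exp (R x) else 0) \<in> borel_measurable borel"
proof -
  have "mono (\<lambda>x. if 0 < x then exp (R x) else 0)"
    by (rule monoI) (auto intro: R_le)
  then show ?thesis by (rule borel_measurable_mono)
qed

text \<open>Sum over unit intervals. Evaluating at the right end \<open>x + 1\<close> costs an
  increase from \<open>d\<close> to \<open>d1\<close>, and the gap between \<open>d1\<close> and
  \<open>d'\<close> leaves a summable factor \<open>1 / x^2\<close>.\<close>

lemma exp_moment_finite: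
  assumes M: "prob_space M" and X [measurable]: "X \<in> borel_measurable M" and nonneg: "AE \<omega> in M. 0 \<le> X \<omega>"
    and d: "0 < d" "d < d'"
    and tail: "\<forall>\<^sub>F x in at_top. measure M {\<omega> \<in> space M. X \<omega> > x} \<le> exp (- R (d' * x))"
  shows "(\<integral>\<^sup>+\<omega>. ennreal (exp (R (d * X \<omega>))) \<partial>M) < \<infinity>"
proof -
  interpret prob_space M by fact
  obtain d1 where d1: "d < d1" "d1 < d'" using dense[OF d(2)] by blast
  have "\<forall>\<^sub>F x in at_top. d * (x + 1) \<le> d1 * x"
    using eventually_ge_at_top[of "d / (d1 - d)"]
  proof eventually_elim
    case (elim x)
    then have "d \<le> (d1 - d) * x" using d1 by (simp add: field_simps)
    then show ?case by (simp add: algebra_simps)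
  qed
  moreover have "\<forall>\<^sub>F x in at_top. R (d1 * x) + 2 * ln x + 0 \<le> R (d' * x)"
    using d d1 by (intro eventually_R_gap_ln) auto
  ultimately have "\<forall>\<^sub>F x in at_top. d * (x + 1) \<le> d1 * x \<and> R (d1 * x) + 2 * ln x \<le> R (d' * x)
      \<and> measure M {\<omega> \<in> space M. X \<omega> > x} \<le> exp (- R (d' * x))"
    using tail by eventually_elim auto
  then obtain x0 where x0: "\<And>x. x \<ge> x0 \<Longrightarrow> d * (x + 1) \<le> d1 * x \<and> R (d1 * x) + 2 * ln x \<le> R (d' * x)
      \<and> measure M {\<omega> \<in> space M. X \<omega> > x} \<le> exp (- R (d' * x))"
    unfolding eventually_at_top_linorder by blast
  define m where "m = nat \<lceil>max x0 1\<rceil>"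
  have m: "x0 \<le> real m" "1 \<le> m" unfolding m_def by linarith+
  define A where "A n = {\<omega> \<in> space M. X \<omega> > real (n + m)}" for n
  have [measurable]: "A n \<in> sets M" for n unfolding A_def by measurable
  \<comment> \<open>\<open>exp (R 0)\<close> covers the event \<open>X = 0\<close>, where the value
    \<open>R 0\<close> is arbitrary.\<close>
  define C where "C = max (exp (R 0)) (exp (R (d * (real m + 1))))"
  define q where "q n = exp (R (d * (real (n + m) + 1)))" for n
  have bound: "q n * measure M (A n) \<le> 1 / (real (Suc n))\<^sup>2" for n
  proof -
    let ?x = "real (n + m)"
    have x: "x0 \<le> ?x" "0 < ?x" "real (Suc n) \<le> ?x" using m by auto
    have "q n \<le> exp (R (d1 * ?x))"
      unfolding q_def using x0[OF x(1)] d x by (auto intro!: R_le)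
    then have "q n * measure M (A n) \<le> exp (R (d1 * ?x)) * exp (- R (d' * ?x))"
      unfolding A_def using x0[OF x(1)] by (intro mult_mono) auto
    also have "\<dots> \<le> exp (- (2 * ln ?x))"
      unfolding exp_add[symmetric] using x0[OF x(1)] by simp
    also have "\<dots> = 1 / ?x\<^sup>2"
      using x(2) exp_of_nat_mult[of 2 "ln ?x"] by (simp add: exp_minus divide_inverse)
    also have "\<dots> \<le> 1 / (real (Suc n))\<^sup>2"
      using x by (intro divide_left_mono power_mono) auto
    finally show ?thesis .
  qed
  have "(\<integral>\<^sup>+\<omega>. ennreal (exp (R (d * X \<omega>))) \<partial>M)
      \<le> (\<integral>\<^sup>+\<omega>. ennreal C + (\<Sum>n. ennreal (q n) * indicator (A n) \<omega>) \<partial>M)"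
  proof (rule nn_integral_mono_AE)
    show "AE \<omega> in M. ennreal (exp (R (d * X \<omega>))) \<le> ennreal C + (\<Sum>n. ennreal (q n) * indicator (A n) \<omega>)"
      using nonneg AE_space
    proof eventually_elim
      case (elim \<omega>)
      show ?case
      proof (cases "X \<omega> \<le> real m + 1")
        case True
        have "exp (R (d * X \<omega>)) \<le> C"
        proof (cases "X \<omega> = 0")
          case False
          then have "R (d * X \<omega>) \<le> R (d * (real m + 1))"
            using True elim d by (intro R_le) auto
          then show ?thesis by (simp add: C_def le_max_iff_disj)
        qed (simp add: C_def)
        then have "ennreal (exp (R (d * X \<omega>))) \<le> ennreal C" by (rule ennreal_leI)
        then show ?thesis by (simp add: add_increasing2)
      next
        case False
        define n where "n = nat (\<lceil>X \<omega>\<rceil> - 1) - m"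
        have n: "real (n + m) < X \<omega>" "X \<omega> \<le> real (n + m) + 1"
          using False unfolding n_def by linarith+
        have "R (d * X \<omega>) \<le> R (d * (real (n + m) + 1))"
          using n False d by (intro R_le) auto
        then have "ennreal (exp (R (d * X \<omega>))) \<le> ennreal (q n)"
          by (intro ennreal_leI) (simp add: q_def)
        also have "\<dots> = ennreal (q n) * indicator (A n) \<omega>"
          using n elim by (simp add: A_def)
        also have "\<dots> \<le> (\<Sum>n. ennreal (q n) * indicator (A n) \<omega>)"
          by (rule term_le_suminf_ennreal)
        finally show ?thesis by (simp add: add_increasing)
      qed
    qed
  qed
  also have "\<dots> = ennreal C + (\<Sum>n. ennreal (q n) * emeasure M (A n))"
    by (subst nn_integral_add) (auto simp: nn_integral_suminf nn_integral_cmult emeasure_space_1)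
  also have "\<dots> \<le> ennreal C + (\<Sum>n. ennreal (1 / (real (Suc n))\<^sup>2))"
  proof (intro add_left_mono suminf_le)
    fix n
    have "ennreal (q n) * emeasure M (A n) = ennreal (q n * measure M (A n))"
      by (simp add: emeasure_eq_measure ennreal_mult' q_def)
    also have "\<dots> \<le> ennreal (1 / (real (Suc n))\<^sup>2)"
      by (rule ennreal_leI) (rule bound)
    finally show "ennreal (q n) * emeasure M (A n) \<le> ennreal (1 / (real (Suc n))\<^sup>2)" .
  qed auto
  also have "(\<Sum>n. ennreal (1 / (real (Suc n))\<^sup>2)) < \<infinity>"
  proof -
    have "summable (\<lambda>n. 1 / (real (Suc n))\<^sup>2)"
      using inverse_power_summable[of 2, where 'a = real] by (subst summable_Suc_iff) (simp add: divide_inverse)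
    then show ?thesis by (simp add: suminf_ennreal2 less_top[symmetric])
  qed
  finally show ?thesis by (simp add: less_top[symmetric] ennreal_add_eq_top)
qed

end

section \<open>Lower bound\<close>

locale gw_gauge = gw_space D a + regular_varying R l b
  for D :: "nat measure" and a :: real and R l :: "real \<Rightarrow> real" and b :: real +
  assumes gauge_tendsto_0: "(\<lambda>k. phi2 a R (exp (- real k))) \<longlonglongrightarrow> 0"
begin

definition rho :: "nat \<Rightarrow> real" where
  "rho n = gen_inverse R (ln (max (exp 1) (real n)))"

lemma rho_mono: "m \<le> n \<Longrightarrow> rho m \<le> rho n"
  unfolding rho_def by (intro gen_inverse_mono) (auto simp: less_max_iff_disj)

lemma phi2_exp: "phi2 a R (exp (- real n)) = rho n / a ^ n"
proof -
  have "exp (- real n) powr ln a = exp (- (real n * ln a))"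
    by (simp add: powr_def)
  also have "\<dots> = 1 / a ^ n"
    using a_gt_1 by (simp add: exp_minus exp_of_nat_mult divide_inverse)
  finally show ?thesis by (simp add: phi2_def rho_def)
qed

lemma phi2_0: "phi2 a R 0 = 0"
  by (simp add: phi2_def)

text \<open>Branching mass of the level-\<open>k\<close> vertices that are too heavy to be paid for
  by \<open>q\<close> times their cost.\<close>

definition heavy_mass :: "real \<Rightarrow> nat \<Rightarrow> (nat list \<Rightarrow> nat) \<Rightarrow> ennreal" where
  "heavy_mass q k c = ennreal (1 / a ^ k) *
     level_sum k (\<lambda>c'. ennreal (W c') * indicator {c'. q * rho k < W c'} c') c"

lemma heavy_measurable [measurable]: "{c. q < W c} \<in> sets P"
proof -
  have "{c \<in> space P. q < W c} \<in> sets P" by measurable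
  then show ?thesis by simp
qed

lemma nn_integral_heavy_mass:
  "(\<integral>\<^sup>+c. heavy_mass q k c \<partial>P) = (\<integral>\<^sup>+c. ennreal (W c) * indicator {c'. q * rho k < W c'} c \<partial>P)"
proof -
  have "(\<integral>\<^sup>+c. heavy_mass q k c \<partial>P)
     = ennreal (1 / a ^ k) * (ennreal (a ^ k) * (\<integral>\<^sup>+c. ennreal (W c) * indicator {c'. q * rho k < W c'} c \<partial>P))"
    unfolding heavy_mass_def by (subst nn_integral_cmult) (auto simp: nn_integral_level_sum')
  also have "ennreal (1 / a ^ k) * (ennreal (a ^ k) * z) = z" for z
    using a_gt_1 by (simp add: mult.assoc[symmetric] ennreal_mult'[symmetric])
  finally show ?thesis .
qed

text \<open>A mass distribution argument for a fixed labelling: \<open>W_u / a^n\<close> is a flow,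
  every cover by cylinders is a cut, and each tree vertex of the cut has mass at most
  \<open>q\<close> times its cost or contributes to \<open>heavy_mass\<close> at a level at least
  \<open>L\<close>.\<close>

lemma W_le_hausdorff_pre:
  assumes c: "good c" and q: "0 < q"
  shows "ennreal (W c) \<le> ennreal q * hausdorff_pre (phi2 a R) (exp (- real L)) (gw_boundary c)
    + (\<Sum>k. heavy_mass q (k + L) c)"
proof -
  let ?\<phi> = "phi2 a R" and ?T = "\<Sum>k. heavy_mass q (k + L) c"
  define \<mu> where "\<mu> v = ennreal (W (subtree v c) / a ^ length v)" for v
  define heavy where "heavy v = \<mu> v * indicator {v. q * rho (length v) < W (subtree v c)} v" for v
  have heavy_level: "(\<Sum>v\<in>level c k. heavy v) = heavy_mass q k c" for k
  proof -
    have "(\<Sum>v\<in>level c k. heavy v) = (\<Sum>v\<in>level c k. ennreal (1 / a ^ k) *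
        (ennreal (W (subtree v c)) * indicator {c'. q * rho k < W c'} (subtree v c)))"
      using a_gt_1
      by (intro sum.cong) (auto simp: heavy_def \<mu>_def length_level ennreal_mult'[symmetric] good_W_nonneg[OF good_subtree[OF c]]
          mult.assoc[symmetric] split: split_indicator)
    then show ?thesis by (simp only: heavy_mass_def level_sum_def sum_distrib_left)
  qed
  have cover: "ennreal (W c) \<le> ennreal q * ((\<Sum>n. ennreal (?\<phi> (diameter (D n)))) + ennreal e) + ?T"
    if D: "gw_boundary c \<subseteq> (\<Union>n. D n)" "\<And>n. diameter (D n) \<le> exp (- real L)" and e: "e > 0" for D :: "nat \<Rightarrow> nat stream set" and e
  proof -
    obtain u where u: "gw_boundary c \<subseteq> (\<Union>n. cylinder (u n))" "\<And>n. L \<le> length (u n)"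
      "(\<Sum>n. ennreal (?\<phi> (exp (- real (length (u n)))))) \<le> (\<Sum>n. ennreal (?\<phi> (diameter (D n)))) + ennreal e"
      by (rule cylinder_cover[of "gw_boundary c" D L ?\<phi> e]) (use D e gauge_tendsto_0 in auto)
    \<comment> \<open>For one vertex at most one term is nonzero; the series form permits the
      exchange with the sum over all words that produces \<open>?T\<close>.\<close>
    let ?S = "\<lambda>v. \<Sum>k. indicator (level c (k + L)) v * heavy v"
    define f where "f v = ennreal q * ennreal (?\<phi> (exp (- real (length v)))) + ?S v" for v
    have "\<mu> [] \<le> (\<integral>\<^sup>+v. f v \<partial>count_space (range u))"
    proof (rule flow_le_cut[where c = c])
      show "\<mu> v = (\<Sum>k<c v. \<mu> (v @ [k]))" for v
      proof -
        have "W (subtree v c) / a ^ length v = (\<Sum>k<c v. W (subtree (v @ [k]) c) / a ^ Suc (length v))"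
          using good_W_children[OF good_subtree[OF c, of v]] a_gt_1
          by (simp add: subtree_subtree subtree_apply sum_divide_distrib mult.commute)
        then show ?thesis
          unfolding \<mu>_def using good_W_nonneg[OF good_subtree[OF c]] a_gt_1 by (subst sum_ennreal) auto
      qed
      show "gw_boundary c \<subseteq> (\<Union>v\<in>range u. cylinder v)" using u by simp
      fix v assume v: "v \<in> range u" "v \<in> gw_tree c"
      show "\<mu> v \<le> f v"
      proof (cases "q * rho (length v) < W (subtree v c)")
        case True
        have "v \<in> level c (length v - L + L)" using v u(2) by (auto simp: level_def)
        then have "\<mu> v = indicator (level c (length v - L + L)) v * heavy v"
          using True by (simp add: heavy_def)
        also have "\<dots> \<le> ?S v"
          by (rule term_le_suminf_ennreal)
        finally show ?thesis unfolding f_def by (rule add_increasing[OF zero_le])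
      next
        case False
        then have "\<mu> v \<le> ennreal (q * (rho (length v) / a ^ length v))"
          unfolding \<mu>_def using a_gt_1 by (intro ennreal_leI) (simp add: divide_right_mono)
        also have "\<dots> = ennreal q * ennreal (?\<phi> (exp (- real (length v))))"
          using q by (simp add: phi2_exp ennreal_mult'[symmetric])
        finally show ?thesis unfolding f_def by (rule add_increasing2[OF zero_le])
      qed
    qed
    also have "\<dots> = ennreal q * (\<integral>\<^sup>+v. ennreal (?\<phi> (exp (- real (length v)))) \<partial>count_space (range u))
        + (\<integral>\<^sup>+v. ?S v \<partial>count_space (range u))"
      unfolding f_def by (simp add: nn_integral_add nn_integral_cmult)
    also have "(\<integral>\<^sup>+v. ennreal (?\<phi> (exp (- real (length v)))) \<partial>count_space (range u))
        \<le> (\<Sum>n. ennreal (?\<phi> (diameter (D n)))) + ennreal e"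
      using nn_integral_count_space_range_le u(3) by (rule order_trans)
    also have "(\<integral>\<^sup>+v. ?S v \<partial>count_space (range u)) \<le> (\<integral>\<^sup>+v. ?S v \<partial>count_space UNIV)"
      by (subst nn_integral_count_space_indicator) (auto intro!: nn_integral_mono split: split_indicator)
    also have "(\<integral>\<^sup>+v. ?S v \<partial>count_space UNIV) = (\<Sum>k. \<integral>\<^sup>+v. indicator (level c (k + L)) v * heavy v \<partial>count_space UNIV)"
      by (rule nn_integral_suminf) simp
    also have "\<dots> = ?T"
    proof (rule suminf_cong)
      fix k
      show "(\<integral>\<^sup>+v. indicator (level c (k + L)) v * heavy v \<partial>count_space UNIV) = heavy_mass q (k + L) c"
        unfolding heavy_level[symmetric]
        by (subst mult.commute, subst nn_integral_indicator_finite) auto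
    qed
    finally show ?thesis
      by (simp add: \<mu>_def add_mono mult_left_mono)
  qed
  let ?H = "hausdorff_pre ?\<phi> (exp (- real L)) (gw_boundary c)"
  show ?thesis
  proof (rule ennreal_le_epsilon)
    fix e :: real assume "0 < e" and fin: "ennreal q * ?H + ?T < top"
    \<comment> \<open>The slack is lost twice, for near-optimality of \<open>D\<close> and for
      replacing its sets by cylinders, and is multiplied by \<open>q\<close> each time.\<close>
    define e' where "e' = e / (2 * q)"
    have e': "e' > 0" using \<open>0 < e\<close> q by (simp add: e'_def)
    have "?H \<noteq> top" using fin q by (auto simp: ennreal_mult_top)
    then obtain h where "0 \<le> h" "?H = ennreal h" by (cases ?H) auto
    then have "?H < ?H + ennreal e'"
      using e' by (simp add: ennreal_plus[symmetric] ennreal_less_iff del: ennreal_plus)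
    then obtain D where D: "gw_boundary c \<subseteq> (\<Union>n. D n)" "\<And>n. diameter (D n) \<le> exp (- real L)"
      "(\<Sum>n. ennreal (?\<phi> (diameter (D n)))) < ?H + ennreal e'"
      unfolding hausdorff_pre_def[of _ _ "gw_boundary c"] INF_less_iff by auto
    have "ennreal (W c) \<le> ennreal q * ((\<Sum>n. ennreal (?\<phi> (diameter (D n)))) + ennreal e') + ?T"
      by (rule cover[OF D(1,2) e'])
    also have "\<dots> \<le> ennreal q * (?H + ennreal e' + ennreal e') + ?T"
      using D(3) by (intro add_mono mult_left_mono) auto
    also have "?H + ennreal e' + ennreal e' = ?H + ennreal (e' + e')"
      using e' by (simp only: add.assoc ennreal_plus less_imp_le)
    also have "ennreal q * (?H + ennreal (e' + e')) = ennreal q * ?H + ennreal (q * (e' + e'))"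
      using q by (simp only: distrib_left[of _ ?H] ennreal_mult' less_imp_le)
    also have "\<dots> + ?T = ennreal q * ?H + ?T + ennreal (q * (e' + e'))"
      by (simp only: add_ac)
    also have "q * (e' + e') = e" using q by (simp add: e'_def)
    finally show "ennreal (W c) \<le> ennreal q * ?H + ?T + ennreal e" .
  qed
qed

text \<open>A nonnegative series with finite mean converges almost surely, so its tail, the error in
  \<open>W_le_hausdorff_pre\<close>, vanishes as \<open>L\<close> grows.\<close>

lemma hausdorff_measure_ge:
  assumes q: "0 < q"
    and fin: "(\<Sum>k. \<integral>\<^sup>+c. ennreal (W c) * indicator {c'. q * rho k < W c'} c \<partial>P) < \<infinity>"
  shows "AE c in P. ennreal (W c) \<le> ennreal q * hausdorff_measure (phi2 a R) (gw_boundary c)"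
proof -
  have [measurable]: "heavy_mass q k \<in> borel_measurable P" for k
    unfolding heavy_mass_def by measurable
  have "(\<integral>\<^sup>+c. (\<Sum>k. heavy_mass q k c) \<partial>P) < \<infinity>"
    using fin by (subst nn_integral_suminf) (auto simp: nn_integral_heavy_mass)
  then have "AE c in P. (\<Sum>k. heavy_mass q k c) \<noteq> \<infinity>"
    by (intro nn_integral_PInf_AE) (auto simp: less_top)
  then show ?thesis using AE_good
  proof eventually_elim
    case (elim c)
    let ?S = "\<Sum>k. heavy_mass q k c"
    let ?H = "hausdorff_measure (phi2 a R) (gw_boundary c)"
    have split: "?S = (\<Sum>k. heavy_mass q (k + L) c) + (\<Sum>k<L. heavy_mass q k c)" for L
      by (rule suminf_offset) simp
    have part: "(\<Sum>k<L. heavy_mass q k c) \<noteq> top" for L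
      using elim(1) split[of L] by (auto simp: top_unique)
    have tail: "(\<Sum>k. heavy_mass q (k + L) c) = ?S - (\<Sum>k<L. heavy_mass q k c)" for L
      unfolding split[of L] using part[of L] by simp
    have "(\<lambda>L. \<Sum>k<L. heavy_mass q k c) \<longlonglongrightarrow> ?S"
      by (intro summable_LIMSEQ) simp
    then have "(\<lambda>L. ?S - (\<Sum>k<L. heavy_mass q k c)) \<longlonglongrightarrow> ?S - ?S"
      using elim(1) by (intro tendsto_diff_ennreal tendsto_const) auto
    then have "(\<lambda>L. \<Sum>k. heavy_mass q (k + L) c) \<longlonglongrightarrow> 0"
      using elim(1) unfolding tail by simp
    then have "(\<lambda>L. ennreal q * ?H + (\<Sum>k. heavy_mass q (k + L) c)) \<longlonglongrightarrow> ennreal q * ?H + 0"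
      by (intro tendsto_add tendsto_const)
    moreover have "ennreal (W c) \<le> ennreal q * ?H + (\<Sum>k. heavy_mass q (k + L) c)" for L
    proof -
      have "hausdorff_pre (phi2 a R) (exp (- real L)) (gw_boundary c) \<le> ?H"
        unfolding hausdorff_measure_eq_SUP by (rule SUP_upper) simp
      then show ?thesis
        using W_le_hausdorff_pre[OF elim(2) q, of L]
        by (elim order_trans) (intro add_mono mult_left_mono, auto)
    qed
    ultimately have "ennreal (W c) \<le> ennreal q * ?H + 0"
      by (intro LIMSEQ_le_const) auto
    then show ?case by simp
  qed
qed

text \<open>Exchange sum and expectation: for a fixed value \<open>x\<close> of \<open>W\<close> at
  most about \<open>exp (R (x / q))\<close> levels count, and the extra factor \<open>x\<close> is
  absorbed thanks to \<open>1 / q < d\<close>.\<close>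

lemma heavy_summable:
  assumes q: "0 < q" "1 / q < d" and fin: "(\<integral>\<^sup>+c. ennreal (exp (R (d * W c))) \<partial>P) < \<infinity>"
  shows "(\<Sum>k. \<integral>\<^sup>+c. ennreal (W c) * indicator {c'. q * rho k < W c'} c \<partial>P) < \<infinity>"
proof -
  obtain d0 where d0: "1 / q < d0" "d0 < d" using dense[OF q(2)] by blast
  obtain B where B: "0 \<le> B" "\<And>x. 0 < x \<Longrightarrow> x ^ 1 * exp (R (1 / q * x)) \<le> B + exp (R (d * x))"
    by (rule power_exp_R_bound[of "1 / q" d 1]) (use q in auto)
  \<comment> \<open>The cut-off at 0 gives a measurable majorant, as \<open>R\<close> is arbitrary
    outside the open half-line.\<close>
  define g where "g x = (if 0 < d * x then exp (R (d * x)) else 0)" for x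
  have g_meas [measurable]: "g \<in> borel_measurable borel"
    unfolding g_def by (rule measurable_compose[OF _ exp_R_measurable]) measurable
  have dpos: "0 < d" using q by (meson divide_pos_pos less_trans zero_less_one)
  have count: "(\<Sum>k. ennreal x * indicator {k. q * rho k < x} k) \<le> ennreal (2 * B) + 2 * ennreal (g x)"
    if x: "0 \<le> x" for x
  proof (cases "x = 0")
    case False
    with x have x: "0 < x" by simp
    define K where "K = nat \<lfloor>exp (R (1 / q * x))\<rfloor>"
    have Rp: "0 < R (1 / q * x)" using x q by (intro R_pos) auto
    have K: "k \<le> K" if "q * rho k < x" for k
    proof (cases "k = 0")
      case False
      have "rho k < 1 / q * x" using that q by (simp add: field_simps)
      then have "ln (max (exp 1) (real k)) \<le> R (1 / q * x)"
        unfolding rho_def by (rule R_ge_of_gen_inverse_less)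
      then have "exp (ln (max (exp 1) (real k))) \<le> exp (R (1 / q * x))" by simp
      then have "max (exp 1) (real k) \<le> exp (R (1 / q * x))"
        by (subst (asm) exp_ln) (simp_all add: less_max_iff_disj)
      then show ?thesis unfolding K_def by linarith
    qed simp
    have "(\<Sum>k. ennreal x * indicator {k. q * rho k < x} k) = (\<Sum>k\<le>K. ennreal x * indicator {k. q * rho k < x} k)"
      by (rule suminf_finite) (use K in force)+
    also have "\<dots> \<le> (\<Sum>k\<le>K. ennreal x)"
      by (intro sum_mono) (auto split: split_indicator)
    also have "\<dots> = ennreal (real (Suc K) * x)"
      using x by (simp add: ennreal_mult' ennreal_of_nat_eq_real_of_nat)
    also have "\<dots> \<le> ennreal (2 * (B + g x))"
    proof (rule ennreal_leI)
      have "1 \<le> exp (R (1 / q * x))" using Rp by simp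
      then have "real (Suc K) \<le> 2 * exp (R (1 / q * x))" unfolding K_def by linarith
      then have "real (Suc K) * x \<le> 2 * exp (R (1 / q * x)) * x"
        using x by (intro mult_right_mono) auto
      also have "\<dots> = 2 * (x ^ 1 * exp (R (1 / q * x)))" by simp
      also have "\<dots> \<le> 2 * (B + exp (R (d * x)))"
        using B(2)[OF x] by (intro mult_left_mono) auto
      finally show "real (Suc K) * x \<le> 2 * (B + g x)"
        using x dpos by (simp add: g_def)
    qed
    also have "\<dots> = ennreal (2 * B) + 2 * ennreal (g x)"
      using B(1) by (simp add: distrib_left ennreal_plus ennreal_mult' g_def)
    finally show ?thesis .
  qed simp
  have "(\<Sum>k. \<integral>\<^sup>+c. ennreal (W c) * indicator {c'. q * rho k < W c'} c \<partial>P)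
      = (\<integral>\<^sup>+c. (\<Sum>k. ennreal (W c) * indicator {c'. q * rho k < W c'} c) \<partial>P)"
    by (rule nn_integral_suminf[symmetric]) measurable
  also have "\<dots> = (\<integral>\<^sup>+c. (\<Sum>k. ennreal (W c) * indicator {k. q * rho k < W c} k) \<partial>P)"
    by (simp add: indicator_def)
  also have "\<dots> \<le> (\<integral>\<^sup>+c. ennreal (2 * B) + 2 * ennreal (g (W c)) \<partial>P)"
    by (rule nn_integral_mono_AE) (use AE_good in \<open>eventually_elim, intro count good_W_nonneg\<close>)
  also have "\<dots> = ennreal (2 * B) + 2 * (\<integral>\<^sup>+c. ennreal (g (W c)) \<partial>P)"
    by (subst nn_integral_add) (auto simp: nn_integral_cmult)
  also have "\<dots> \<le> ennreal (2 * B) + 2 * (\<integral>\<^sup>+c. ennreal (exp (R (d * W c))) \<partial>P)"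
    by (intro add_left_mono mult_left_mono nn_integral_mono) (auto simp: g_def)
  also have "\<dots> < \<infinity>"
    using fin by (simp add: ennreal_mult_less_top less_top[symmetric] ennreal_add_eq_top ennreal_mult_eq_top_iff)
  finally show ?thesis .
qed

end

section \<open>Upper bound\<close>

locale gw_gauge_L2 = gw_gauge D a R l b + gw_space_L2 D a
  for D :: "nat measure" and a :: real and R l :: "real \<Rightarrow> real" and b :: real
begin

text \<open>Cover of the boundary by the first vertices, along each ray and in steps of \<open>m\<close> levels, whose
  normalised population \<open>m\<close> levels later exceeds \<open>y\<close>; the search stops after \<open>j\<close> steps.\<close>

primrec cov :: "nat \<Rightarrow> real \<Rightarrow> nat \<Rightarrow> (nat list \<Rightarrow> nat) \<Rightarrow> nat list set" where
  "cov m y 0 c = {[]}"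
| "cov m y (Suc j) c = (if y < Mn m c then {[]} else (\<Union>u\<in>level c m. (@) u ` cov m y j (subtree u c)))"

text \<open>Total of \<open>\<bar>W_u - Mn m\<bar> / a^n\<close> over all vertices at the first
  \<open>j\<close> block levels, including those below a vertex where the search has stopped; so the
  mean is exactly \<open>j\<close> times the deviation in one block.\<close>

primrec err :: "nat \<Rightarrow> nat \<Rightarrow> (nat list \<Rightarrow> nat) \<Rightarrow> ennreal" where
  "err m 0 c = 0"
| "err m (Suc j) c = ennreal \<bar>W c - Mn m c\<bar> + ennreal (1 / a ^ m) * level_sum m (err m j) c"

text \<open>Normalised number of vertices at level \<open>j * m\<close> on whose path all
  \<open>j\<close> tests fail.\<close>

primrec rest :: "nat \<Rightarrow> real \<Rightarrow> nat \<Rightarrow> (nat list \<Rightarrow> nat) \<Rightarrow> ennreal" where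
  "rest m y 0 c = 1"
| "rest m y (Suc j) c = indicator {c. Mn m c \<le> y} c * (ennreal (1 / a ^ m) * level_sum m (rest m y j) c)"

lemma finite_cov [simp]: "finite (cov m y j c)"
  by (induction j arbitrary: c) auto

lemma length_cov: "w \<in> cov m y j c \<Longrightarrow> length w \<le> j * m"
proof (induction j arbitrary: c w)
  case (Suc j)
  show ?case
  proof (cases "y < Mn m c")
    case False
    with Suc.prems obtain u v where "u \<in> level c m" "v \<in> cov m y j (subtree u c)" "w = u @ v"
      by auto
    then show ?thesis using Suc.IH[of v "subtree u c"] by (simp add: length_level)
  qed (use Suc.prems in simp)
qed simp

lemma append_stake_cylinder: "sdrop m x \<in> cylinder w \<Longrightarrow> x \<in> cylinder (stake m x @ w)"
  unfolding cylinder_def mem_Collect_eq length_append length_stake stake_add[symmetric] by simp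

lemma cov_covers: "x \<in> gw_boundary c \<Longrightarrow> \<exists>w\<in>cov m y j c. x \<in> cylinder w"
proof (induction j arbitrary: c x)
  case (Suc j)
  show ?case
  proof (cases "y < Mn m c")
    case False
    let ?u = "stake m x"
    obtain w where w: "w \<in> cov m y j (subtree ?u c)" "sdrop m x \<in> cylinder w"
      using Suc.IH[OF gw_boundary_subtree[OF Suc.prems]] by blast
    have "?u @ w \<in> cov m y (Suc j) c"
      using False w(1) stake_mem_level[OF Suc.prems] by auto
    moreover have "x \<in> cylinder (?u @ w)"
      using w(2) by (rule append_stake_cylinder)
    ultimately show ?thesis by blast
  qed (simp add: cylinder_def)
qed (simp add: cylinder_def)

lemma sum_append_levels:
  fixes g :: "nat list \<Rightarrow> ennreal"
  assumes "\<And>u. finite (C u)"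
  shows "(\<Sum>w\<in>(\<Union>u\<in>level c m. (@) u ` C u). g w) = (\<Sum>u\<in>level c m. \<Sum>w\<in>C u. g (u @ w))"
proof -
  have "(\<Sum>w\<in>(\<Union>u\<in>level c m. (@) u ` C u). g w) = (\<Sum>u\<in>level c m. \<Sum>w\<in>(@) u ` C u. g w)"
    by (rule sum.UNION_disjoint) (use assms in \<open>auto dest!: length_level\<close>)
  also have "\<dots> = (\<Sum>u\<in>level c m. \<Sum>w\<in>C u. g (u @ w))"
    by (rule sum.cong[OF refl]) (simp add: sum.reindex inj_on_def)
  finally show ?thesis .
qed

lemma good_level_sum_W: "good c \<Longrightarrow> ennreal (1 / a ^ m) * level_sum m (\<lambda>c. ennreal (W c)) c = ennreal (W c)"
proof -
  assume c: "good c"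
  have "level_sum m (\<lambda>c. ennreal (W c)) c = ennreal (level_sum m W c)"
    unfolding level_sum_def by (rule sum_ennreal) (simp add: good_W_nonneg good_subtree c)
  then show ?thesis
    using good_W_eq[OF c, of m] a_gt_1 by (simp add: ennreal_mult'[symmetric])
qed

text \<open>At a stopping vertex \<open>y < Mn m c \<le> W c + \<bar>W c - Mn m c\<bar>\<close>, so
  its cost \<open>r\<close> is at most \<open>r / y\<close> times mass plus deviation. If the test
  fails, the estimates for the subtrees at level \<open>m\<close> are averaged; words on which all
  tests fail are charged to \<open>rest\<close>.\<close>

lemma cov_cost:
  assumes "good c" "0 < y" "0 \<le> r"
  shows "(\<Sum>w\<in>cov m y j c. ennreal (r / a ^ length w))
    \<le> ennreal (r / y) * (ennreal (W c) + err m j c) + ennreal r * rest m y j c"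
  using assms(1)
proof (induction j arbitrary: c)
  case 0
  then show ?case by (simp add: add_increasing)
next
  case (Suc j)
  note c = Suc.prems
  show ?case
  proof (cases "y < Mn m c")
    case True
    have "r * y \<le> r * (W c + \<bar>W c - Mn m c\<bar>)"
      using True assms(3) by (intro mult_left_mono) auto
    then have "r \<le> r / y * (W c + \<bar>W c - Mn m c\<bar>)"
      using assms(2) by (simp add: field_simps)
    then have "ennreal r \<le> ennreal (r / y * (W c + \<bar>W c - Mn m c\<bar>))"
      by (rule ennreal_leI)
    also have "\<dots> = ennreal (r / y) * (ennreal (W c) + ennreal \<bar>W c - Mn m c\<bar>)"
      using assms(2,3) good_W_nonneg[OF c] by (subst ennreal_mult') (auto simp: ennreal_plus)
    also have "\<dots> \<le> ennreal (r / y) * (ennreal (W c) + err m (Suc j) c)"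
      by (intro mult_left_mono add_left_mono) auto
    finally show ?thesis using True by (simp add: add_increasing2)
  next
    case False
    have "(\<Sum>w\<in>cov m y (Suc j) c. ennreal (r / a ^ length w))
        = (\<Sum>u\<in>level c m. \<Sum>w\<in>cov m y j (subtree u c). ennreal (r / a ^ length (u @ w)))"
      using False by (simp add: sum_append_levels)
    also have "\<dots> = ennreal (1 / a ^ m) * level_sum m (\<lambda>c. \<Sum>w\<in>cov m y j c. ennreal (r / a ^ length w)) c"
      unfolding level_sum_def sum_distrib_left using a_gt_1
      by (intro sum.cong refl) (simp add: length_level power_add ennreal_mult'[symmetric] mult.commute)
    also have "\<dots> \<le> ennreal (1 / a ^ m) * level_sum m (\<lambda>c. ennreal (r / y) * (ennreal (W c) + err m j c) + ennreal r * rest m y j c) c"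
      unfolding level_sum_def by (intro mult_left_mono sum_mono Suc.IH good_subtree c) auto
    also have "\<dots> = ennreal (r / y) * (ennreal (1 / a ^ m) * level_sum m (\<lambda>c. ennreal (W c)) c
        + ennreal (1 / a ^ m) * level_sum m (err m j) c) + ennreal r * (ennreal (1 / a ^ m) * level_sum m (rest m y j) c)"
      by (simp only: level_sum_def sum.distrib sum_distrib_left distrib_left mult_ac)
    also have "\<dots> \<le> ennreal (r / y) * (ennreal (W c) + err m (Suc j) c) + ennreal r * rest m y (Suc j) c"
      unfolding good_level_sum_W[OF c] using False
      by (intro add_mono mult_left_mono) (auto simp: add_increasing)
    finally show ?thesis .
  qed
qed

section \<open>Means of the error terms\<close>

lemma err_measurable [measurable]: "err m j \<in> borel_measurable P"
proof (induction j)
  case (Suc j)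
  note [measurable] = this
  have "err m (Suc j) = (\<lambda>c. ennreal \<bar>W c - Mn m c\<bar> + ennreal (1 / a ^ m) * level_sum m (err m j) c)"
    by (simp add: fun_eq_iff)
  then show ?case by simp
next
  case 0
  have "err m 0 = (\<lambda>c. 0)" by (simp add: fun_eq_iff)
  then show ?case by simp
qed

lemma few_measurable [measurable]: "{c. Mn m c \<le> y} \<in> sets P"
proof -
  have "{c \<in> space P. Mn m c \<le> y} \<in> sets P" by measurable
  then show ?thesis by simp
qed

lemma rest_measurable [measurable]: "rest m y j \<in> borel_measurable P"
proof (induction j)
  case (Suc j)
  note [measurable] = this
  have "rest m y (Suc j) = (\<lambda>c. indicator {c. Mn m c \<le> y} c * (ennreal (1 / a ^ m) * level_sum m (rest m y j) c))"
    by (simp add: fun_eq_iff)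
  then show ?case by simp
next
  case 0
  have "rest m y 0 = (\<lambda>c. 1)" by (simp add: fun_eq_iff)
  then show ?case by simp
qed

lemma nn_integral_scaled_level_sum:
  assumes "F \<in> borel_measurable P"
  shows "(\<integral>\<^sup>+c. ennreal (1 / a ^ m) * level_sum m F c \<partial>P) = (\<integral>\<^sup>+c. F c \<partial>P)"
proof -
  note [measurable] = assms
  have "(\<integral>\<^sup>+c. ennreal (1 / a ^ m) * level_sum m F c \<partial>P) = ennreal (1 / a ^ m) * (ennreal (a ^ m) * (\<integral>\<^sup>+c. F c \<partial>P))"
    by (subst nn_integral_cmult) (auto simp: nn_integral_level_sum')
  also have "ennreal (1 / a ^ m) * (ennreal (a ^ m) * z) = z" for z
    using a_gt_1 by (simp add: mult.assoc[symmetric] ennreal_mult'[symmetric])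
  finally show ?thesis .
qed

lemma nn_integral_err: "(\<integral>\<^sup>+c. err m j c \<partial>P) = of_nat j * (\<integral>\<^sup>+c. ennreal \<bar>W c - Mn m c\<bar> \<partial>P)"
proof (induction j)
  case (Suc j)
  have "(\<integral>\<^sup>+c. err m (Suc j) c \<partial>P) = (\<integral>\<^sup>+c. ennreal \<bar>W c - Mn m c\<bar> \<partial>P) + (\<integral>\<^sup>+c. err m j c \<partial>P)"
    by (simp add: nn_integral_add nn_integral_scaled_level_sum)
  then show ?case by (simp add: Suc distrib_right)
qed simp

text \<open>By independence each block contributes the factor \<open>E (Mn m; Mn m \<le> y)\<close>.
  Since \<open>Mn m\<close> has mean 1 and exceeds \<open>y \<ge> 1\<close> with probability at
  least \<open>p\<close>, this factor is at most \<open>1 - p\<close>.\<close>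

lemma nn_integral_rest:
  assumes p: "p \<le> measure P {c. y < Mn m c}" and y: "1 \<le> y" and p': "0 \<le> p" "p \<le> 1"
  shows "(\<integral>\<^sup>+c. rest m y j c \<partial>P) \<le> ennreal ((1 - p) ^ j)"
proof -
  let ?\<beta> = "\<integral>\<^sup>+c. indicator {c. Mn m c \<le> y} c * ennreal (Mn m c) \<partial>P"
  have [measurable]: "{c. y < Mn m c} \<in> sets P"
  proof -
    have "{c \<in> space P. y < Mn m c} \<in> sets P" by measurable
    then show ?thesis by simp
  qed
  have "?\<beta> + ennreal p \<le> ?\<beta> + (\<integral>\<^sup>+c. indicator {c. y < Mn m c} c \<partial>P)"
    using p by (intro add_left_mono) (simp add: P.emeasure_eq_measure ennreal_leI)
  also have "\<dots> = (\<integral>\<^sup>+c. indicator {c. Mn m c \<le> y} c * ennreal (Mn m c) + indicator {c. y < Mn m c} c \<partial>P)"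
    by (rule nn_integral_add[symmetric]) measurable
  also have "\<dots> \<le> (\<integral>\<^sup>+c. ennreal (Mn m c) \<partial>P)"
    using y by (intro nn_integral_mono) (auto split: split_indicator)
  also have "\<dots> = 1" by (rule nn_integral_Mn)
  finally have \<beta>: "?\<beta> \<le> ennreal (1 - p)"
    using p' by (metis ennreal_1 ennreal_le_minus_iff ennreal_minus add.commute ennreal_neq_top)
  have step: "(\<integral>\<^sup>+c. rest m y (Suc j) c \<partial>P) = ?\<beta> * (\<integral>\<^sup>+c. rest m y j c \<partial>P)" for j
  proof -
    let ?h = "\<lambda>c. indicator {c. Mn m c \<le> y} c * ennreal (1 / a ^ m)"
    have "depends_on {u. length u < m} ?h"
      using depends_on_gw_level[of m "\<lambda>z. indicator {z. real z / a ^ m \<le> y} z * ennreal (1 / a ^ m)"]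
      by (simp add: Mn_def indicator_def)
    then have "(\<integral>\<^sup>+c. ?h c * level_sum m (rest m y j) c \<partial>P)
        = (\<integral>\<^sup>+c. ?h c * of_nat (gw_level c m) \<partial>P) * (\<integral>\<^sup>+c. rest m y j c \<partial>P)"
      by (rule nn_integral_level_sum) measurable
    moreover have "(\<integral>\<^sup>+c. ?h c * of_nat (gw_level c m) \<partial>P) = ?\<beta>"
      by (simp add: ennreal_Mn mult_ac)
    ultimately show ?thesis by (simp add: mult_ac)
  qed
  show ?thesis
  proof (induction j)
    case (Suc j)
    have "(\<integral>\<^sup>+c. rest m y (Suc j) c \<partial>P) \<le> ennreal (1 - p) * ennreal ((1 - p) ^ j)"
      unfolding step by (intro mult_mono \<beta> Suc) auto
    also have "\<dots> = ennreal ((1 - p) ^ Suc j)"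
      using p' by (simp add: ennreal_mult'[symmetric])
    finally show ?case .
  qed simp
qed

text \<open>The search starts at every vertex of level \<open>L\<close>, which makes the cylinders
  small; all words have length at most \<open>L + J * m\<close>, so monotonicity of
  \<open>rho\<close> allows the common bound \<open>r\<close>.\<close>

lemma hausdorff_pre_le:
  assumes c: "good c" and y: "0 < y" and r: "0 \<le> r" "rho (L + J * m) \<le> r" and \<delta>: "r / y \<le> \<delta>"
  shows "hausdorff_pre (phi2 a R) (exp (- real L)) (gw_boundary c)
    \<le> ennreal \<delta> * ennreal (W c) + (ennreal \<delta> * (ennreal (1 / a ^ L) * level_sum L (err m J) c)
      + ennreal r * (ennreal (1 / a ^ L) * level_sum L (rest m y J) c))"
proof -
  let ?C = "\<Union>u\<in>level c L. (@) u ` cov m y J (subtree u c)"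
  have "hausdorff_pre (phi2 a R) (exp (- real L)) (gw_boundary c)
      \<le> (\<Sum>w\<in>?C. ennreal (phi2 a R (exp (- real (length w)))))"
  proof (rule hausdorff_pre_finite_cylinders)
    show "gw_boundary c \<subseteq> (\<Union>w\<in>?C. cylinder w)"
    proof
      fix x assume x: "x \<in> gw_boundary c"
      let ?u = "stake L x"
      obtain w where w: "w \<in> cov m y J (subtree ?u c)" "sdrop L x \<in> cylinder w"
        using cov_covers[OF gw_boundary_subtree[OF x]] by blast
      have "?u @ w \<in> ?C" using w(1) stake_mem_level[OF x] by auto
      moreover have "x \<in> cylinder (?u @ w)"
        using w(2) by (rule append_stake_cylinder)
      ultimately show "x \<in> (\<Union>w\<in>?C. cylinder w)" by blast
    qed
  qed (auto simp: phi2_0 length_level)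
  also have "\<dots> \<le> (\<Sum>w\<in>?C. ennreal (r / a ^ length w))"
  proof (rule sum_mono)
    fix w assume "w \<in> ?C"
    then have "length w \<le> L + J * m" by (auto simp: length_level dest: length_cov)
    then have "rho (length w) \<le> rho (L + J * m)" by (rule rho_mono)
    then have "rho (length w) \<le> r" using r(2) by simp
    then show "ennreal (phi2 a R (exp (- real (length w)))) \<le> ennreal (r / a ^ length w)"
      unfolding phi2_exp using a_gt_1 by (intro ennreal_leI divide_right_mono) auto
  qed
  also have "\<dots> = (\<Sum>u\<in>level c L. \<Sum>w\<in>cov m y J (subtree u c). ennreal (r / a ^ length (u @ w)))"
    by (rule sum_append_levels) simp
  also have "\<dots> = ennreal (1 / a ^ L) * level_sum L (\<lambda>c. \<Sum>w\<in>cov m y J c. ennreal (r / a ^ length w)) c"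
    unfolding level_sum_def sum_distrib_left using a_gt_1
    by (intro sum.cong refl) (simp add: length_level power_add ennreal_mult'[symmetric] mult.commute)
  also have "\<dots> \<le> ennreal (1 / a ^ L) * level_sum L (\<lambda>c. ennreal (r / y) * (ennreal (W c) + err m J c) + ennreal r * rest m y J c) c"
    unfolding level_sum_def by (intro mult_left_mono sum_mono cov_cost good_subtree c y r) auto
  also have "\<dots> = ennreal (r / y) * (ennreal (1 / a ^ L) * level_sum L (\<lambda>c. ennreal (W c)) c)
      + (ennreal (r / y) * (ennreal (1 / a ^ L) * level_sum L (err m J) c)
      + ennreal r * (ennreal (1 / a ^ L) * level_sum L (rest m y J) c))"
    by (simp only: level_sum_def sum.distrib sum_distrib_left distrib_left mult_ac add_ac)
  also have "\<dots> \<le> ennreal \<delta> * ennreal (W c) + (ennreal \<delta> * (ennreal (1 / a ^ L) * level_sum L (err m J) c)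
      + ennreal r * (ennreal (1 / a ^ L) * level_sum L (rest m y J) c))"
    unfolding good_level_sum_W[OF c] using \<delta> by (intro add_mono mult_right_mono ennreal_leI) auto
  finally show ?thesis .
qed

text \<open>For each \<open>L\<close> the excess over \<open>\<delta> * W\<close> is bounded by
  nonnegative variables of arbitrarily small mean, whose infimum therefore vanishes almost surely.
  The parameters may depend on \<open>L\<close> and \<open>e\<close>.\<close>

lemma hausdorff_measure_le_if_small_excess:
  assumes \<delta>: "0 \<le> \<delta>"
    and small: "\<And>L e. 0 < e \<Longrightarrow> \<exists>m y r J p. 1 \<le> y \<and> 0 \<le> r \<and> rho (L + J * m) \<le> r \<and> r / y \<le> \<delta> \<and>
      0 \<le> p \<and> p \<le> measure P {c. y < Mn m c} \<and>
      ennreal \<delta> * (of_nat J * (\<integral>\<^sup>+c. ennreal \<bar>W c - Mn m c\<bar> \<partial>P)) + ennreal (r * (1 - p) ^ J) \<le> ennreal e"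
  shows "AE c in P. hausdorff_measure (phi2 a R) (gw_boundary c) \<le> ennreal \<delta> * ennreal (W c)"
proof -
  let ?H = "\<lambda>L c. hausdorff_pre (phi2 a R) (exp (- real L)) (gw_boundary c)"
  have "AE c in P. ?H L c \<le> ennreal \<delta> * ennreal (W c)" for L
  proof -
    have "\<exists>X. X \<in> borel_measurable P \<and> (\<integral>\<^sup>+c. X c \<partial>P) \<le> ennreal (1 / real (Suc n)) \<and>
        (\<forall>c. good c \<longrightarrow> ?H L c \<le> ennreal \<delta> * ennreal (W c) + X c)" for n
    proof -
      obtain m y r J p where *: "1 \<le> y" "0 \<le> r" "rho (L + J * m) \<le> r" "r / y \<le> \<delta>"
        "0 \<le> p" "p \<le> measure P {c. y < Mn m c}"
        "ennreal \<delta> * (of_nat J * (\<integral>\<^sup>+c. ennreal \<bar>W c - Mn m c\<bar> \<partial>P)) + ennreal (r * (1 - p) ^ J) \<le> ennreal (1 / real (Suc n))"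
        using small[of "1 / real (Suc n)" L] by auto
      have p1: "p \<le> 1" using *(6) P.prob_le_1 order_trans by blast
      let ?X = "\<lambda>c. ennreal \<delta> * (ennreal (1 / a ^ L) * level_sum L (err m J) c)
          + ennreal r * (ennreal (1 / a ^ L) * level_sum L (rest m y J) c)"
      have "(\<integral>\<^sup>+c. ?X c \<partial>P) = ennreal \<delta> * (\<integral>\<^sup>+c. err m J c \<partial>P) + ennreal r * (\<integral>\<^sup>+c. rest m y J c \<partial>P)"
      proof -
        have "(\<integral>\<^sup>+c. q * (ennreal (1 / a ^ L) * level_sum L F c) \<partial>P) = q * (\<integral>\<^sup>+c. F c \<partial>P)"
          if [measurable]: "F \<in> borel_measurable P" for q F
          unfolding nn_integral_scaled_level_sum[OF that, of L, symmetric]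
          by (rule nn_integral_cmult) measurable
        then show ?thesis by (subst nn_integral_add) auto
      qed
      also have "\<dots> \<le> ennreal \<delta> * (of_nat J * (\<integral>\<^sup>+c. ennreal \<bar>W c - Mn m c\<bar> \<partial>P)) + ennreal r * ennreal ((1 - p) ^ J)"
        unfolding nn_integral_err using * p1 by (intro add_left_mono mult_left_mono nn_integral_rest) auto
      also have "\<dots> \<le> ennreal (1 / real (Suc n))"
        using *(7) *(2) by (simp add: ennreal_mult')
      finally show ?thesis
        using * by (intro exI[of _ ?X] conjI allI impI hausdorff_pre_le) auto
    qed
    then obtain X where X [measurable]: "\<And>n. X n \<in> borel_measurable P"
      and X_int: "\<And>n. (\<integral>\<^sup>+c. X n c \<partial>P) \<le> ennreal (1 / real (Suc n))"
      and X_le: "\<And>n c. good c \<Longrightarrow> ?H L c \<le> ennreal \<delta> * ennreal (W c) + X n c"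
      by metis
    have "(\<integral>\<^sup>+c. (INF n. X n c) \<partial>P) \<le> ennreal (1 / real (Suc n))" for n
      using X_int[of n] by (rule order_trans[rotated]) (intro nn_integral_mono INF_lower, simp)
    then have "(\<integral>\<^sup>+c. (INF n. X n c) \<partial>P) \<le> 0"
      by (intro LIMSEQ_le_const[of "\<lambda>n. ennreal (1 / real (Suc n))"])
        (auto intro!: tendsto_ennrealI LIMSEQ_Suc[OF lim_1_over_n] simp del: of_nat_Suc simp flip: ennreal_0)
    then have "AE c in P. (INF n. X n c) = 0"
      by (subst (asm) le_zero_eq, subst (asm) nn_integral_0_iff_AE) auto
    then show ?thesis using AE_good
    proof eventually_elim
      case (elim c)
      show ?case
      proof (rule ennreal_le_epsilon)
        fix e :: real assume "0 < e"
        then have "(INF n. X n c) < ennreal e" using elim(1) by simp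
        then obtain n where "X n c < ennreal e" by (auto simp: INF_less_iff)
        then show "?H L c \<le> ennreal \<delta> * ennreal (W c) + ennreal e"
          using X_le[OF elim(2), of n] by (meson add_left_mono less_imp_le order_trans)
      qed
    qed
  qed
  then have "AE c in P. \<forall>L. ?H L c \<le> ennreal \<delta> * ennreal (W c)"
    unfolding AE_all_countable by blast
  then show ?thesis
  proof eventually_elim
    case (elim c)
    show ?case
      unfolding hausdorff_measure_eq_SUP
    proof (rule SUP_least)
      fix d :: real assume "d \<in> {0<..}"
      then have d: "0 < d" by simp
      obtain L :: nat where "- ln d \<le> real L" using real_arch_simple by blast
      then have "exp (- real L) \<le> exp (ln d)" by simp
      then have "exp (- real L) \<le> d" using d by simp
      then have "hausdorff_pre (phi2 a R) d (gw_boundary c) \<le> ?H L c"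
        by (rule hausdorff_pre_antimono)
      with elim show "hausdorff_pre (phi2 a R) d (gw_boundary c) \<le> ennreal \<delta> * ennreal (W c)"
        by (meson order_trans)
    qed
  qed
qed


text \<open>If \<open>W > x\<close>, then \<open>Mn m > x - 1\<close> or
  \<open>\<bar>W - Mn m\<bar> \<ge> 1\<close>; Markov's inequality bounds the latter.\<close>

lemma prob_Mn_ge:
  "measure P {c. x < W c} \<le> measure P {c. x - 1 < Mn m c} + enn2real (\<integral>\<^sup>+c. ennreal \<bar>W c - Mn m c\<bar> \<partial>P)"
proof -
  have [measurable]: "{c. x - 1 < Mn m c} \<in> sets P" "{c. 1 \<le> \<bar>W c - Mn m c\<bar>} \<in> sets P"
  proof -
    have "{c \<in> space P. x - 1 < Mn m c} \<in> sets P" "{c \<in> space P. 1 \<le> \<bar>W c - Mn m c\<bar>} \<in> sets P" by measurable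
    then show "{c. x - 1 < Mn m c} \<in> sets P" "{c. 1 \<le> \<bar>W c - Mn m c\<bar>} \<in> sets P" by simp_all
  qed
  have "measure P {c. x < W c} \<le> measure P ({c. x - 1 < Mn m c} \<union> {c. 1 \<le> \<bar>W c - Mn m c\<bar>})"
  proof (rule P.finite_measure_mono)
    show "{c. x < W c} \<subseteq> {c. x - 1 < Mn m c} \<union> {c. 1 \<le> \<bar>W c - Mn m c\<bar>}"
      by auto
  qed measurable
  also have "\<dots> \<le> measure P {c. x - 1 < Mn m c} + measure P {c. 1 \<le> \<bar>W c - Mn m c\<bar>}"
    by (rule measure_Un_le) measurable
  also have "measure P {c. 1 \<le> \<bar>W c - Mn m c\<bar>} \<le> (\<integral>c. \<bar>W c - Mn m c\<bar> \<partial>P)"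
  proof -
    have "measure P {c. 1 \<le> \<bar>W c - Mn m c\<bar>} = (\<integral>c. indicator {c. 1 \<le> \<bar>W c - Mn m c\<bar>} c \<partial>P)"
      by simp
    also have "\<dots> \<le> (\<integral>c. \<bar>W c - Mn m c\<bar> \<partial>P)"
      using integrable_W integrable_Mn
      by (intro integral_mono integrable_real_indicator) (auto simp: P.emeasure_eq_measure indicator_def)
    finally show ?thesis .
  qed
  also have "(\<integral>c. \<bar>W c - Mn m c\<bar> \<partial>P) = enn2real (\<integral>\<^sup>+c. ennreal \<bar>W c - Mn m c\<bar> \<partial>P)"
    by (rule integral_eq_nn_integral) auto
  finally show ?thesis by simp
qed

text \<open>Here \<open>s\<close> stands for \<open>R (d1 * x)\<close>, so a test succeeds with
  probability about \<open>exp (- s)\<close>. There must be many more than \<open>exp s\<close>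
  blocks, yet the total depth may not exceed \<open>exp (q * s)\<close>, where \<open>rho\<close> is
  still under control.\<close>

lemma block_parameters:
  fixes \<delta> C q d2 e :: real and L :: nat
  assumes q: "1 < q" and \<delta>: "0 < \<delta>" "0 < d2" and C: "0 \<le> C" and e: "0 < e"
  obtains m J :: "real \<Rightarrow> nat" where
    "\<And>s. (1 / sqrt a) ^ m s \<le> exp (- 3 * s)"
    "\<forall>\<^sub>F s in at_top. max (exp 1) (real (L + J s * m s)) \<le> exp (q * s)"
    "\<forall>\<^sub>F s in at_top. C * exp (- 3 * s) \<le> exp (- s) / 2"
    "\<forall>\<^sub>F s in at_top. \<delta> * (real (J s) * (C * exp (- 3 * s))) + d2 * exp s * (1 - exp (- s) / 2) ^ J s \<le> e"
proof -
  \<comment> \<open>\<open>q2 > 1\<close> yields more blocks than the inverse success probability,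
    \<open>q2 < q\<close> leaves room for the block length in the depth, and \<open>q2 < 2\<close>
    keeps \<open>J s * exp (- 3 * s)\<close> below \<open>exp (- s)\<close>.\<close>
  obtain q2 where q2: "1 < q2" "q2 < min q 2" using dense[of 1 "min q 2"] q by auto
  \<comment> \<open>The factor 6 gives \<open>a^(-m/2) \<le> exp (- 3 * s)\<close>.\<close>
  define m where "m s = nat \<lceil>6 * s / ln a\<rceil>" for s :: real
  define J where "J s = nat \<lfloor>exp (q2 * s)\<rfloor>" for s :: real
  have lna: "0 < ln a" using a_gt_1 by simp
  have Jle: "real (J s) \<le> exp (q2 * s)" and Jge: "exp (q2 * s) - 1 \<le> real (J s)" for s
    unfolding J_def using exp_gt_zero[of "q2 * s"] by linarith+
  have mle: "real (m s) \<le> 6 * s / ln a + 1" if "0 \<le> s" for s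
  proof -
    have "0 \<le> 6 * s / ln a" using that lna by simp
    then show ?thesis unfolding m_def by linarith
  qed
  show thesis
  proof (rule that[of m J])
    fix s
    have "6 * s / ln a \<le> real (m s)" unfolding m_def by linarith
    then have "6 * s \<le> real (m s) * ln a" using lna by (simp add: field_simps)
    then have "- (real (m s) * ln a / 2) \<le> - 3 * s" by simp
    moreover have "(1 / sqrt a) ^ m s = exp (- (real (m s) * ln a / 2))"
    proof -
      have "sqrt a = exp (ln (sqrt a))" using a_gt_1 by simp
      then have "sqrt a = exp (ln a / 2)" using a_gt_1 by (simp only: ln_sqrt)
      then have "1 / sqrt a = exp (- (ln a / 2))" by (simp only: exp_minus divide_inverse mult_1_left)
      then have "(1 / sqrt a) ^ m s = exp (- (ln a / 2)) ^ m s" by (simp only:)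
      also have "\<dots> = exp (real (m s) * - (ln a / 2))" by (simp only: exp_of_nat_mult)
      finally show ?thesis by simp
    qed
    ultimately show "(1 / sqrt a) ^ m s \<le> exp (- 3 * s)" by simp
  next
    define h where "h = q - q2"
    have h: "0 < h" using q2 by (simp add: h_def)
    define A where "A = 6 / ln a"
    have A: "0 < A" using lna by (simp add: A_def)
    \<comment> \<open>The 3 absorbs \<open>exp 1\<close>, the cut-off inside
      \<open>rho\<close>.\<close>
    define K where "K = real L + 3"
    have K: "0 < K" by (simp add: K_def)
    have q2p: "0 < q2" using q2 by simp
    have qp: "0 < q" using q by simp
    have "((\<lambda>s. exp (- (q * s))) \<longlongrightarrow> 0) at_top" "((\<lambda>s. s * exp (- (h * s))) \<longlongrightarrow> 0) at_top"
      "((\<lambda>s. exp (- (h * s))) \<longlongrightarrow> 0) at_top"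
      using h qp by real_asymp+
    then have "((\<lambda>s. K * exp (- (q * s)) + (A * (s * exp (- (h * s))) + exp (- (h * s)))) \<longlongrightarrow> K * 0 + (A * 0 + 0)) at_top"
      by (intro tendsto_intros)
    then have "\<forall>\<^sub>F s in at_top. K * exp (- (q * s)) + (A * (s * exp (- (h * s))) + exp (- (h * s))) < 1"
      by (rule order_tendstoD) simp
    then show "\<forall>\<^sub>F s in at_top. max (exp 1) (real (L + J s * m s)) \<le> exp (q * s)"
      using eventually_ge_at_top[of 0]
    proof eventually_elim
      case (elim s)
      have "max (exp 1) (real (L + J s * m s)) \<le> K + real (J s) * real (m s)"
        using exp_le by (auto simp: K_def add_increasing2)
      also have "\<dots> \<le> K + exp (q2 * s) * (A * s + 1)"
        using mle[OF elim(2)] Jle[of s] by (intro add_left_mono mult_mono) (auto simp: A_def)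
      also have "\<dots> = (K * exp (- (q * s)) + (A * (s * exp (- (h * s))) + exp (- (h * s)))) * exp (q * s)"
      proof -
        have "exp (- (q * s)) * exp (q * s) = 1" "exp (- (h * s)) * exp (q * s) = exp (q2 * s)"
          unfolding exp_add[symmetric] by (simp_all add: h_def algebra_simps)
        then show ?thesis by (simp add: distrib_right mult.assoc) (simp add: algebra_simps)
      qed
      also have "\<dots> \<le> 1 * exp (q * s)"
        using elim by (intro mult_right_mono) auto
      finally show ?case by simp
    qed
  next
    have "((\<lambda>s :: real. C * exp (- 2 * s)) \<longlongrightarrow> C * 0) at_top"
      by (intro tendsto_mult tendsto_const) real_asymp
    then have "\<forall>\<^sub>F s in at_top. C * exp (- 2 * s) < 1 / 2"
      by (intro order_tendstoD) auto
    then show "\<forall>\<^sub>F s in at_top. C * exp (- 3 * s) \<le> exp (- s) / 2"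
    proof eventually_elim
      case (elim s)
      have "C * exp (- 3 * s) = C * exp (- 2 * s) * exp (- s)"
        by (simp add: exp_add[symmetric])
      also have "\<dots> \<le> 1 / 2 * exp (- s)"
        using elim by (intro mult_right_mono) auto
      finally show ?case by simp
    qed
  next
    \<comment> \<open>\<open>J s * exp (- s)\<close> is at least \<open>exp (h * s) - 1\<close>, so
      the failure term is doubly exponentially small and beats \<open>d2 * exp s\<close>.\<close>
    define h where "h = q2 - 1"
    have h: "0 < h" using q2 by (simp add: h_def)
    have "((\<lambda>s :: real. \<delta> * C * exp (- s)) \<longlongrightarrow> \<delta> * C * 0) at_top"
      by (intro tendsto_mult tendsto_const) real_asymp
    moreover have "((\<lambda>s :: real. exp (s - (exp (h * s) - 1) / 2)) \<longlongrightarrow> 0) at_top"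
      using h by real_asymp
    then have "((\<lambda>s :: real. d2 * exp (s - (exp (h * s) - 1) / 2)) \<longlongrightarrow> d2 * 0) at_top"
      by (intro tendsto_mult tendsto_const)
    ultimately have "((\<lambda>s :: real. \<delta> * C * exp (- s) + d2 * exp (s - (exp (h * s) - 1) / 2)) \<longlongrightarrow> \<delta> * C * 0 + d2 * 0) at_top"
      by (rule tendsto_add)
    then have "\<forall>\<^sub>F s in at_top. \<delta> * C * exp (- s) + d2 * exp (s - (exp (h * s) - 1) / 2) < e"
      using e by (intro order_tendstoD) auto
    then show "\<forall>\<^sub>F s in at_top. \<delta> * (real (J s) * (C * exp (- 3 * s))) + d2 * exp s * (1 - exp (- s) / 2) ^ J s \<le> e"
      using eventually_ge_at_top[of 0]
    proof eventually_elim
      case (elim s)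
      have "real (J s) * (C * exp (- 3 * s)) \<le> exp (2 * s) * (C * exp (- 3 * s))"
      proof (intro mult_right_mono order_trans[OF Jle])
        have "q2 * s \<le> 2 * s" using elim(2) q2 by (intro mult_right_mono) auto
        then show "exp (q2 * s) \<le> exp (2 * s)" by simp
      qed (use C in auto)
      also have "\<dots> = C * exp (- s)" by (simp add: exp_add[symmetric])
      finally have 1: "\<delta> * (real (J s) * (C * exp (- 3 * s))) \<le> \<delta> * C * exp (- s)"
        using \<delta> by (simp add: mult.assoc)
      have "(1 - exp (- s) / 2) ^ J s \<le> exp (- (exp (- s) / 2)) ^ J s"
        using elim(2) exp_ge_add_one_self[of "- (exp (- s) / 2)"] by (intro power_mono) (auto simp: order_trans[of _ 1])
      also have "\<dots> = exp (real (J s) * - (exp (- s) / 2))"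
        by (simp only: exp_of_nat_mult)
      also have "\<dots> \<le> exp (- (exp (h * s) - 1) / 2)"
      proof -
        have "(exp (q2 * s) - 1) * exp (- s) \<le> real (J s) * exp (- s)"
          by (intro mult_right_mono Jge) auto
        moreover have "(exp (q2 * s) - 1) * exp (- s) = exp (h * s) - exp (- s)"
          by (simp add: h_def algebra_simps exp_diff exp_minus field_simps)
        moreover have "exp (- s) \<le> 1" using elim(2) by simp
        ultimately have "exp (h * s) - 1 \<le> real (J s) * exp (- s)" by linarith
        then show ?thesis by simp
      qed
      finally have "d2 * exp s * (1 - exp (- s) / 2) ^ J s \<le> d2 * exp s * exp (- (exp (h * s) - 1) / 2)"
        using \<delta> by (intro mult_left_mono) auto
      also have "\<dots> = d2 * exp (s - (exp (h * s) - 1) / 2)"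
        by (simp add: exp_add[symmetric] mult.assoc diff_divide_distrib)
      finally show ?case using 1 elim(1) by linarith
    qed
  qed
qed

lemma hausdorff_measure_le:
  assumes d: "0 < d" "d < \<delta>" and inf: "(\<integral>\<^sup>+c. ennreal (exp (R (d * W c))) \<partial>P) = \<infinity>"
  shows "AE c in P. hausdorff_measure (phi2 a R) (gw_boundary c) \<le> ennreal \<delta> * ennreal (W c)"
proof (rule hausdorff_measure_le_if_small_excess)
  show "0 \<le> \<delta>" using d by simp
  fix L :: nat and e :: real assume e: "0 < e"
  \<comment> \<open>Three gaps are spent: from \<open>d\<close> to \<open>d1\<close> on turning the
    infinite moment into a lower tail bound, from \<open>d1\<close> to \<open>d2\<close> on the
    depth of the search, from \<open>d2\<close> to \<delta> on the quotient
    \<open>x / (x - 1)\<close>.\<close>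
  obtain d1 where d1: "d < d1" "d1 < \<delta>" using dense[OF d(2)] by blast
  obtain d2 where d2: "d1 < d2" "d2 < \<delta>" using dense[OF d1(2)] by blast
  \<comment> \<open>The infinite moment gives the tail bound only for arbitrarily large
    \<open>x\<close>; every other requirement on \<open>x\<close> must therefore hold
    eventually.\<close>
  have freq: "\<exists>\<^sub>F x in at_top. exp (- R (d1 * x)) < measure P {c. x < W c}"
  proof (rule ccontr)
    assume "\<not> ?thesis"
    then have tail: "\<forall>\<^sub>F x in at_top. measure P {c \<in> space P. x < W c} \<le> exp (- R (d1 * x))"
      by (simp add: not_frequently not_less)
    have "AE c in P. 0 \<le> W c" using AE_good by eventually_elim (rule good_W_nonneg)
    from exp_moment_finite[OF P.prob_space_axioms W_measurable this d(1) d1(1) tail] inf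
    show False by simp
  qed
  obtain q where q: "1 < q" and gap: "\<forall>\<^sub>F x in at_top. q * R (d1 * x) \<le> R (d2 * x)"
    using eventually_ratio_gap[of d1 d2] d d1 d2 by auto
  obtain C where C: "0 \<le> C" "\<And>m. (\<integral>\<^sup>+c. ennreal \<bar>W c - Mn m c\<bar> \<partial>P) \<le> ennreal (C * (1 / sqrt a) ^ m)"
    by (rule W_Mn_dist) (rule that)
  obtain m J :: "real \<Rightarrow> nat" where mJ: "\<And>s. (1 / sqrt a) ^ m s \<le> exp (- 3 * s)"
    "\<forall>\<^sub>F s in at_top. max (exp 1) (real (L + J s * m s)) \<le> exp (q * s)"
    "\<forall>\<^sub>F s in at_top. C * exp (- 3 * s) \<le> exp (- s) / 2"
    "\<forall>\<^sub>F s in at_top. \<delta> * (real (J s) * (C * exp (- 3 * s))) + d2 * exp s * (1 - exp (- s) / 2) ^ J s \<le> e"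
    using block_parameters[of q \<delta> d2 C e L] q d d1 d2 C e by auto
  have dm: "filterlim (\<lambda>x. d1 * x) at_top at_top"
    using d d1 by (intro filterlim_tendsto_pos_mult_at_top[OF tendsto_const] filterlim_ident) auto
  have Rlim: "filterlim (\<lambda>x. R (d1 * x)) at_top at_top"
    by (rule filterlim_compose[OF R_at_top dm])
  \<comment> \<open>This gives \<open>ln x \<le> R (d1 * x)\<close>, so the bound
    \<open>d2 * x\<close> on \<open>rho\<close> is at most \<open>d2 * exp s\<close>.\<close>
  have xR: "\<forall>\<^sub>F x in at_top. R (d1 / 2 * x) + 1 * ln x + 0 \<le> R (d1 * x)"
    using d d1 by (intro eventually_R_gap_ln) auto
  let ?Q = "\<lambda>x. q * R (d1 * x) \<le> R (d2 * x) \<and> x \<le> exp (R (d1 * x)) \<and> d2 * x / (x - 1) \<le> \<delta> \<and> 2 \<le> x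
      \<and> 0 \<le> R (d1 * x)
      \<and> max (exp 1) (real (L + J (R (d1 * x)) * m (R (d1 * x)))) \<le> exp (q * R (d1 * x))
      \<and> C * exp (- 3 * R (d1 * x)) \<le> exp (- R (d1 * x)) / 2
      \<and> \<delta> * (real (J (R (d1 * x))) * (C * exp (- 3 * R (d1 * x)))) + d2 * exp (R (d1 * x)) * (1 - exp (- R (d1 * x)) / 2) ^ J (R (d1 * x)) \<le> e"
  have ev: "\<forall>\<^sub>F x in at_top. ?Q x"
    using gap xR eventually_ge_at_top[of "\<delta> / (\<delta> - d2)"] eventually_ge_at_top[of 2]
      eventually_compose_filterlim[OF mJ(2) Rlim] eventually_compose_filterlim[OF mJ(3) Rlim]
      eventually_compose_filterlim[OF mJ(4) Rlim]
  proof eventually_elim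
    case (elim x)
    have "0 < R (d1 / 2 * x)" using elim(4) d d1 by (intro R_pos) auto
    then have "ln x \<le> R (d1 * x)" using elim(2) by simp
    then have "exp (ln x) \<le> exp (R (d1 * x))" by simp
    moreover have "0 < R (d1 * x)" using elim(4) d d1 by (intro R_pos) auto
    moreover have "\<delta> \<le> (\<delta> - d2) * x" using elim(3) d2 by (simp add: field_simps)
    then have "d2 * x / (x - 1) \<le> \<delta>" using elim(4) by (simp add: field_simps)
    ultimately show ?case using elim by simp
  qed
  obtain x where x: "?Q x \<and> exp (- R (d1 * x)) < measure P {c. x < W c}"
    using frequently_ex[OF frequently_eventually_conj[OF freq ev]] by blast
  define s where "s = R (d1 * x)"
  note x' = x[folded s_def]
  let ?m = "m s" and ?J = "J s" and ?p = "exp (- s) / 2"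
  have dist: "(\<integral>\<^sup>+c. ennreal \<bar>W c - Mn ?m c\<bar> \<partial>P) \<le> ennreal (C * exp (- 3 * s))"
    using C(2)[of ?m] by (rule order_trans) (intro ennreal_leI mult_left_mono mJ(1) C(1))
  show "\<exists>m y r J p. 1 \<le> y \<and> 0 \<le> r \<and> rho (L + J * m) \<le> r \<and> r / y \<le> \<delta> \<and>
      0 \<le> p \<and> p \<le> measure P {c. y < Mn m c} \<and>
      ennreal \<delta> * (of_nat J * (\<integral>\<^sup>+c. ennreal \<bar>W c - Mn m c\<bar> \<partial>P)) + ennreal (r * (1 - p) ^ J) \<le> ennreal e"
  proof (rule exI[of _ ?m], rule exI[of _ "x - 1"], rule exI[of _ "d2 * x"], rule exI[of _ ?J], rule exI[of _ ?p], intro conjI)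
    show "1 \<le> x - 1" "d2 * x / (x - 1) \<le> \<delta>" "0 \<le> ?p" using x' by auto
    show "0 \<le> d2 * x" using x' d d1 d2 by auto
    \<comment> \<open>The logarithm of the depth is at most \<open>q * s\<close>, hence at most
      \<open>R (d2 * x)\<close>.\<close>
    show "rho (L + ?J * ?m) \<le> d2 * x"
      unfolding rho_def
    proof (rule gen_inverse_le)
      show "0 \<le> d2 * x" by fact
      fix z assume z: "0 < z" "d2 * x < z"
      have "ln (max (exp 1) (real (L + ?J * ?m))) \<le> ln (exp (q * s))"
        using x' by (intro ln_mono) (auto simp: less_max_iff_disj)
      also have "\<dots> \<le> R (d2 * x)" using x' by simp
      also have "\<dots> \<le> R z" using z x' d d1 d2 by (intro R_le) auto
      finally show "ln (max (exp 1) (real (L + ?J * ?m))) \<le> R z" .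
    qed
    have "enn2real (\<integral>\<^sup>+c. ennreal \<bar>W c - Mn ?m c\<bar> \<partial>P) \<le> C * exp (- 3 * s)"
      using dist C(1) by (simp add: enn2real_leI)
    \<comment> \<open>Half of the tail \<open>exp (- s)\<close> is given up for the deviation of
      \<open>Mn\<close> from \<open>W\<close>.\<close>
    then show "?p \<le> measure P {c. x - 1 < Mn ?m c}"
      using prob_Mn_ge[of x ?m] x' by linarith
    have "ennreal \<delta> * (of_nat ?J * (\<integral>\<^sup>+c. ennreal \<bar>W c - Mn ?m c\<bar> \<partial>P)) + ennreal (d2 * x * (1 - ?p) ^ ?J)
      \<le> ennreal \<delta> * (of_nat ?J * ennreal (C * exp (- 3 * s))) + ennreal (d2 * exp s * (1 - ?p) ^ ?J)"
    proof (intro add_mono mult_left_mono dist ennreal_leI mult_right_mono)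
      have "exp (- s) \<le> 1" using x' by simp
      then show "0 \<le> (1 - ?p) ^ ?J" by (intro zero_le_power) linarith
    qed (use x' d d1 d2 in auto)
    also have "\<dots> = ennreal (\<delta> * (real ?J * (C * exp (- 3 * s))) + d2 * exp s * (1 - ?p) ^ ?J)"
    proof -
      have "exp (- s) \<le> 1" using x' by simp
      then have "0 \<le> (1 - ?p) ^ ?J" by (intro zero_le_power) linarith
      then show ?thesis
        using d d1 d2 C(1) by (subst ennreal_plus) (auto simp: ennreal_mult' ennreal_of_nat_eq_real_of_nat)
    qed
    also have "\<dots> \<le> ennreal e" using x' by (intro ennreal_leI) auto
    finally show "ennreal \<delta> * (of_nat ?J * (\<integral>\<^sup>+c. ennreal \<bar>W c - Mn ?m c\<bar> \<partial>P)) + ennreal (d2 * x * (1 - ?p) ^ ?J) \<le> ennreal e" .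
  qed
qed

lemma hausdorff_measure_eq:
  assumes \<xi>: "0 < \<xi>"
    and fin: "\<And>d. 0 < d \<Longrightarrow> d < \<xi> \<Longrightarrow> (\<integral>\<^sup>+c. ennreal (exp (R (d * W c))) \<partial>P) < \<infinity>"
    and inf: "\<And>d. \<xi> < d \<Longrightarrow> (\<integral>\<^sup>+c. ennreal (exp (R (d * W c))) \<partial>P) = \<infinity>"
  shows "AE c in P. hausdorff_measure (phi2 a R) (gw_boundary c) = ennreal (\<xi> * W c)"
proof -
  let ?H = "\<lambda>c. hausdorff_measure (phi2 a R) (gw_boundary c)"
  have low: "AE c in P. ennreal (d * W c) \<le> ?H c" if d: "0 < d" "d < \<xi>" for d
  proof -
    obtain d' where d': "d < d'" "d' < \<xi>" using dense[OF d(2)] by blast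
    have "(\<Sum>k. \<integral>\<^sup>+c. ennreal (W c) * indicator {c'. 1 / d * rho k < W c'} c \<partial>P) < \<infinity>"
      by (rule heavy_summable[of "1 / d" d']) (use d d' fin in auto)
    then have "AE c in P. ennreal (W c) \<le> ennreal (1 / d) * ?H c"
      using d by (intro hausdorff_measure_ge) auto
    then show ?thesis
    proof eventually_elim
      case (elim c)
      then have "ennreal d * ennreal (W c) \<le> ennreal d * (ennreal (1 / d) * ?H c)"
        by (intro mult_left_mono) auto
      also have "\<dots> = ?H c"
        using d by (simp add: mult.assoc[symmetric] ennreal_mult'[symmetric])
      finally show ?case using d by (simp add: ennreal_mult')
    qed
  qed
  have up: "AE c in P. ?H c \<le> ennreal d * ennreal (W c)" if d: "\<xi> < d" for d
  proof -
    obtain d' where d': "\<xi> < d'" "d' < d" using dense[OF d] by blast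
    then show ?thesis
      using \<xi> inf by (intro hausdorff_measure_le[of d']) auto
  qed
  \<comment> \<open>The double successor keeps \<open>lo n\<close> positive, as \<open>low\<close>
    requires; a single one would give \<open>lo 0 = 0\<close>.\<close>
  define lo hi where "lo n = \<xi> * (1 - 1 / real (Suc (Suc n)))" and "hi n = \<xi> * (1 + 1 / real (Suc n))" for n
  have "AE c in P. \<forall>n. ennreal (lo n * W c) \<le> ?H c"
    unfolding AE_all_countable using \<xi> by (intro allI low) (simp_all add: lo_def field_simps add_pos_nonneg)
  moreover have "AE c in P. \<forall>n. ?H c \<le> ennreal (hi n) * ennreal (W c)"
    unfolding AE_all_countable using \<xi> by (intro allI up) (simp add: hi_def field_simps)
  ultimately show ?thesis using AE_good
  proof eventually_elim
    case (elim c)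
    have W: "0 \<le> W c" using elim(3) by (rule good_W_nonneg)
    have inv: "(\<lambda>n. 1 / real (Suc n)) \<longlonglongrightarrow> 0"
      by (rule LIMSEQ_Suc[OF lim_1_over_n])
    have "lo \<longlonglongrightarrow> \<xi> * (1 - 0)"
      unfolding lo_def by (intro tendsto_intros LIMSEQ_Suc[OF inv])
    then have "(\<lambda>n. ennreal (lo n * W c)) \<longlonglongrightarrow> ennreal (\<xi> * (1 - 0) * W c)"
      by (intro tendsto_ennrealI tendsto_mult tendsto_const)
    then have "ennreal (\<xi> * (1 - 0) * W c) \<le> ?H c"
      by (rule LIMSEQ_le_const2) (use elim(1) in blast)
    moreover have "hi \<longlonglongrightarrow> \<xi> * (1 + 0)"
      unfolding hi_def by (intro tendsto_intros inv)
    then have "(\<lambda>n. ennreal (hi n * W c)) \<longlonglongrightarrow> ennreal (\<xi> * (1 + 0) * W c)"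
      by (intro tendsto_ennrealI tendsto_mult tendsto_const)
    then have "?H c \<le> ennreal (\<xi> * (1 + 0) * W c)"
    proof (rule LIMSEQ_le_const)
      have "?H c \<le> ennreal (hi n * W c)" for n
      proof -
        have "0 \<le> hi n" using \<xi> by (simp add: hi_def)
        with elim(2) show ?thesis by (simp add: ennreal_mult')
      qed
      then show "\<exists>N. \<forall>n\<ge>N. ?H c \<le> ennreal (hi n * W c)" by blast
    qed
    ultimately show ?case by (simp add: order_antisym)
  qed
qed

end

section \<open>The critical exponent\<close>

text \<open>The quotient is \<open>R / - ln p\<close>: its upper bound makes the tail thin, its
  positive lower bound makes it thick.\<close>

lemma asymp_comparable_tail:
  assumes cmp: "asymp_comparable (\<lambda>x. - ln (p x)) R" and pos: "\<forall>\<^sub>F x in at_top. 0 < R x"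
    and p: "\<And>x. 0 \<le> p x"
  obtains K K' where "0 < K" "0 < K'"
    "\<forall>\<^sub>F x in at_top. exp (- K * R x) \<le> p x \<and> p x \<le> exp (- K' * R x)"
proof -
  have "Limsup at_top (\<lambda>x. ereal (R x / - ln (p x))) < \<infinity>" "0 < Liminf at_top (\<lambda>x. ereal (R x / - ln (p x)))"
    using cmp by (auto simp: asymp_comparable_def)
  then obtain C0 k0 where C0: "Limsup at_top (\<lambda>x. ereal (R x / - ln (p x))) < ereal C0"
    and k0: "0 < ereal k0" "ereal k0 < Liminf at_top (\<lambda>x. ereal (R x / - ln (p x)))"
    using ereal_dense2[of _ "\<infinity>"] ereal_dense2[of 0] by blast
  define C where "C = max C0 1"
  have C: "0 < C" "C0 \<le> C" by (auto simp: C_def)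
  have "\<forall>\<^sub>F x in at_top. ereal (R x / - ln (p x)) < ereal C0"
    using C0 by (rule Limsup_lessD)
  moreover have "\<forall>\<^sub>F x in at_top. ereal k0 < ereal (R x / - ln (p x))"
    using k0(2) by (rule less_LiminfD)
  ultimately have "\<forall>\<^sub>F x in at_top. exp (- (1 / k0) * R x) \<le> p x \<and> p x \<le> exp (- (1 / C) * R x)"
    using pos
  proof eventually_elim
    case (elim x)
    have k: "0 < k0" using k0(1) by simp
    \<comment> \<open>As \<open>ln 0 = 0\<close> and division by 0 gives 0, positivity of the
      quotient excludes both \<open>p x = 0\<close> and \<open>p x = 1\<close>.\<close>
    have "0 < R x / - ln (p x)" using elim(2) k by (simp del: divide_minus_right)
    then have ln: "0 < - ln (p x)" using elim(3) by (simp add: zero_less_divide_iff del: divide_minus_right)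
    then have "p x \<noteq> 0" by auto
    then have px: "0 < p x" using p[of x] by simp
    have "k0 * - ln (p x) \<le> R x" using elim(2) ln by (simp add: field_simps)
    then have "- (1 / k0) * R x \<le> ln (p x)" using k by (simp add: field_simps)
    moreover have "R x / - ln (p x) \<le> C" using elim(1) C by simp
    then have "R x \<le> C * - ln (p x)" using ln by (simp add: pos_divide_le_eq del: divide_minus_right)
    then have "ln (p x) \<le> - (1 / C) * R x" using C by (simp add: field_simps)
    ultimately show ?case using px by (metis exp_le_cancel_iff exp_ln)
  qed
  then show thesis using that[of "1 / k0" "1 / C"] C k0 by simp
qed

context regular_varying
begin

text \<open>\<open>d'\<close> satisfies \<open>d' powr b = K / 2\<close>, so
  \<open>R (d' * x)\<close> is asymptotic to \<open>K / 2 * R x\<close> and eventually falls below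
  the tail exponent.\<close>

lemma exp_moment_finite_small:
  assumes M: "prob_space M" and X: "X \<in> borel_measurable M" and nonneg: "AE \<omega> in M. 0 \<le> X \<omega>"
    and K: "0 < K" and tail: "\<forall>\<^sub>F x in at_top. measure M {\<omega> \<in> space M. X \<omega> > x} \<le> exp (- K * R x)"
  obtains d where "0 < d" "(\<integral>\<^sup>+\<omega>. ennreal (exp (R (d * X \<omega>))) \<partial>M) < \<infinity>"
proof -
  define d' where "d' = (K / 2) powr (1 / b)"
  have d': "0 < d'" using K by (simp add: d'_def)
  have "d' powr b < K" using K b_pos by (simp add: d'_def powr_powr)
  then have "\<forall>\<^sub>F x in at_top. R (d' * x) / R x < K"
    by (rule order_tendstoD(2)[OF ratio_tendsto[OF d']])
  with tail eventually_gt_at_top[of 0]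
  have "\<forall>\<^sub>F x in at_top. measure M {\<omega> \<in> space M. X \<omega> > x} \<le> exp (- R (d' * x))"
  proof eventually_elim
    case (elim x)
    have "R (d' * x) \<le> K * R x" using elim(2,3) R_pos[of x] by (simp add: field_simps)
    then have "exp (- K * R x) \<le> exp (- R (d' * x))" by simp
    with elim(1) show ?case by (rule order_trans)
  qed
  with exp_moment_finite[OF M X nonneg, of "d' / 2" d'] d' that[of "d' / 2"] show thesis by simp
qed

text \<open>From \<open>d powr b = 3 * K\<close> it follows that \<open>R (d * x)\<close> is
  eventually at least twice the tail exponent \<open>K * R x\<close>; so the event
  \<open>X > x\<close> alone contributes at least \<open>exp (K * R x)\<close>, which is
  unbounded.\<close>

lemma exp_moment_infinite_large:
  assumes M: "prob_space M" and X [measurable]: "X \<in> borel_measurable M"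
    and K: "0 < K" and tail: "\<forall>\<^sub>F x in at_top. exp (- K * R x) \<le> measure M {\<omega> \<in> space M. X \<omega> > x}"
  obtains d where "0 < d" "(\<integral>\<^sup>+\<omega>. ennreal (exp (R (d * X \<omega>))) \<partial>M) = \<infinity>"
proof -
  interpret prob_space M by fact
  define d where "d = (3 * K) powr (1 / b)"
  have d: "0 < d" using K by (simp add: d_def)
  have "2 * K < d powr b" using K b_pos by (simp add: d_def powr_powr)
  then have ev: "\<forall>\<^sub>F x in at_top. 2 * K * R x \<le> R (d * x)"
    using d by (intro eventually_ratio_ge)
  have "ennreal (real n) \<le> (\<integral>\<^sup>+\<omega>. ennreal (exp (R (d * X \<omega>))) \<partial>M)" for n :: nat
  proof -
    have "\<forall>\<^sub>F x in at_top. real n / K \<le> R x"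
      using R_at_top by (simp add: filterlim_at_top)
    with ev tail eventually_gt_at_top[of 0]
    have "\<forall>\<^sub>F x in at_top. 2 * K * R x \<le> R (d * x) \<and> exp (- K * R x) \<le> measure M {\<omega> \<in> space M. X \<omega> > x}
        \<and> real n / K \<le> R x \<and> 0 < x"
      by eventually_elim auto
    then obtain x where x: "2 * K * R x \<le> R (d * x)" "exp (- K * R x) \<le> measure M {\<omega> \<in> space M. X \<omega> > x}"
        "real n / K \<le> R x" "0 < x"
      using eventually_happens[of _ "at_top :: real filter"] by auto
    let ?A = "{\<omega> \<in> space M. X \<omega> > x}"
    have "real n \<le> K * R x" using x(3) K by (simp add: field_simps)
    also have "\<dots> \<le> exp (K * R x)" using exp_ge_add_one_self[of "K * R x"] by linarith
    also have "\<dots> = exp (2 * K * R x) * exp (- K * R x)" by (simp add: exp_add[symmetric])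
    also have "\<dots> \<le> exp (R (d * x)) * measure M ?A"
      using x by (intro mult_mono) auto
    finally have "ennreal (real n) \<le> ennreal (exp (R (d * x)) * measure M ?A)" by (rule ennreal_leI)
    also have "\<dots> = (\<integral>\<^sup>+\<omega>. ennreal (exp (R (d * x))) * indicator ?A \<omega> \<partial>M)"
      by (subst nn_integral_cmult_indicator) (auto simp: emeasure_eq_measure ennreal_mult')
    also have "\<dots> \<le> (\<integral>\<^sup>+\<omega>. ennreal (exp (R (d * X \<omega>))) \<partial>M)"
      using x(4) d by (intro nn_integral_mono) (auto split: split_indicator intro!: ennreal_leI R_le)
    finally show ?thesis .
  qed
  then have "(\<integral>\<^sup>+\<omega>. ennreal (exp (R (d * X \<omega>))) \<partial>M) = \<infinity>"
    by (metis ennreal_Ex_less_of_nat ennreal_of_nat_eq_real_of_nat infinity_ennreal_def leD top.not_eq_extremum)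
  with d that show thesis by blast
qed

text \<open>Where \<open>X = 0\<close> both integrands equal \<open>exp (R 0)\<close>, so
  monotonicity on the open half-line suffices.\<close>

lemma exp_moment_mono:
  assumes nonneg: "AE \<omega> in M. 0 \<le> X \<omega>" and d: "0 < d" "d \<le> d'"
  shows "(\<integral>\<^sup>+\<omega>. ennreal (exp (R (d * X \<omega>))) \<partial>M) \<le> (\<integral>\<^sup>+\<omega>. ennreal (exp (R (d' * X \<omega>))) \<partial>M)"
proof (rule nn_integral_mono_AE)
  show "AE \<omega> in M. ennreal (exp (R (d * X \<omega>))) \<le> ennreal (exp (R (d' * X \<omega>)))"
    using nonneg
  proof eventually_elim
    case (elim \<omega>)
    then show ?case
    proof (cases "X \<omega> = 0")
      case False
      with elim d have "R (d * X \<omega>) \<le> R (d' * X \<omega>)" by (intro R_le) auto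
      then show ?thesis by (intro ennreal_leI) simp
    qed simp
  qed
qed

text \<open>The critical value is the supremum of the parameters with finite moment; two critical
  values would contradict each other at any parameter strictly between them.\<close>

lemma ex1_is_critical:
  assumes nonneg: "AE \<omega> in M. 0 \<le> X \<omega>"
    and small: "0 < d0" "(\<integral>\<^sup>+\<omega>. ennreal (exp (R (d0 * X \<omega>))) \<partial>M) < \<infinity>"
    and large: "0 < d1" "(\<integral>\<^sup>+\<omega>. ennreal (exp (R (d1 * X \<omega>))) \<partial>M) = \<infinity>"
  shows "\<exists>!\<xi>. 0 < \<xi> \<and> is_critical M X R \<xi>"
proof -
  let ?E = "\<lambda>d. \<integral>\<^sup>+\<omega>. ennreal (exp (R (d * X \<omega>))) \<partial>M"
  define S where "S = {d. 0 < d \<and> ?E d < \<infinity>}"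
  have bdd: "d \<le> d1" if "d \<in> S" for d
  proof (rule ccontr)
    assume "\<not> ?thesis"
    then have "?E d1 \<le> ?E d" using large by (intro exp_moment_mono nonneg) auto
    with that large show False by (simp add: S_def top_unique)
  qed
  have d0S: "d0 \<in> S" using small by (simp add: S_def)
  have bddS: "bdd_above S" using bdd by (rule bdd_aboveI)
  define \<xi> where "\<xi> = Sup S"
  have "d0 \<le> \<xi>" unfolding \<xi>_def by (rule cSup_upper[OF d0S bddS])
  have crit: "is_critical M X R \<xi>"
    unfolding is_critical_def
  proof (intro conjI allI impI)
    fix d assume d: "0 < d \<and> d < \<xi>"
    then obtain d' where d': "d' \<in> S" "d < d'"
      unfolding \<xi>_def using less_cSup_iff[of S d] d0S bddS by auto
    then have "?E d \<le> ?E d'" using d by (intro exp_moment_mono nonneg) auto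
    with d' show "?E d < \<infinity>" by (auto simp: S_def intro: le_less_trans)
  next
    fix d assume d: "\<xi> < d"
    then have "d \<notin> S" unfolding \<xi>_def using cSup_upper[OF _ bddS, of d] by auto
    moreover have "0 < d" using d \<open>d0 \<le> \<xi>\<close> small by simp
    ultimately show "?E d = \<infinity>" by (simp add: S_def not_less top_unique)
  qed
  have uniq: "\<not> u < v" if "0 < u" "is_critical M X R u" "is_critical M X R v" for u v
  proof
    assume "u < v"
    then obtain w where w: "u < w" "w < v" using dense by blast
    then have "0 < w" using that(1) by simp
    with w that have "?E w < \<infinity>" "?E w = \<infinity>" unfolding is_critical_def by blast+
    then show False by simp
  qed
  show ?thesis
  proof (rule ex1I[of _ \<xi>])
    show "0 < \<xi> \<and> is_critical M X R \<xi>" using crit small \<open>d0 \<le> \<xi>\<close> by simp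
    show "\<xi>' = \<xi>" if "0 < \<xi>' \<and> is_critical M X R \<xi>'" for \<xi>'
      using uniq[of \<xi> \<xi>'] uniq[of \<xi>' \<xi>] that crit small \<open>d0 \<le> \<xi>\<close> by force
  qed
qed

text \<open>Positivity of \<open>R\<close> gives \<open>exp (R (d / 2 * x)) \<ge> 1\<close>, so a
  bound for \<open>x^2 * exp (R (d / 2 * x))\<close> also controls \<open>x^2\<close>.\<close>

lemma square_integrable_if_exp_moment:
  assumes M: "prob_space M" and X [measurable]: "X \<in> borel_measurable M" and nonneg: "AE \<omega> in M. 0 \<le> X \<omega>"
    and d: "0 < d" and fin: "(\<integral>\<^sup>+\<omega>. ennreal (exp (R (d * X \<omega>))) \<partial>M) < \<infinity>"
  shows "integrable M (\<lambda>\<omega>. (X \<omega>)\<^sup>2)"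
proof (rule integrableI_nonneg)
  interpret prob_space M by fact
  define g where "g x = (if 0 < d * x then exp (R (d * x)) else 0)" for x
  have g_meas [measurable]: "g \<in> borel_measurable borel"
    unfolding g_def by (rule measurable_compose[OF _ exp_R_measurable]) measurable
  obtain B where B: "0 \<le> B" "\<And>x. 0 < x \<Longrightarrow> x ^ 2 * exp (R (d / 2 * x)) \<le> B + exp (R (d * x))"
    by (rule power_exp_R_bound[of "d / 2" d 2]) (use d in auto)
  have le: "x\<^sup>2 \<le> B + g x" if x: "0 \<le> x" for x
  proof (cases "x = 0")
    case False
    with x have x: "0 < x" by simp
    have "0 < R (d / 2 * x)" using x d by (intro R_pos) auto
    then have "x\<^sup>2 * 1 \<le> x\<^sup>2 * exp (R (d / 2 * x))" by (intro mult_left_mono) auto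
    also have "\<dots> \<le> B + exp (R (d * x))" by (rule B(2)[OF x])
    finally show ?thesis using x d by (simp add: g_def)
  qed (use B in \<open>simp add: g_def\<close>)
  have "(\<integral>\<^sup>+\<omega>. ennreal ((X \<omega>)\<^sup>2) \<partial>M) \<le> (\<integral>\<^sup>+\<omega>. ennreal B + ennreal (g (X \<omega>)) \<partial>M)"
  proof (rule nn_integral_mono_AE)
    show "AE \<omega> in M. ennreal ((X \<omega>)\<^sup>2) \<le> ennreal B + ennreal (g (X \<omega>))"
      using nonneg
    proof eventually_elim
      case (elim \<omega>)
      have "0 \<le> g (X \<omega>)" by (simp add: g_def)
      with ennreal_leI[OF le[OF elim]] B(1) show ?case by simp
    qed
  qed
  also have "\<dots> = ennreal B + (\<integral>\<^sup>+\<omega>. ennreal (g (X \<omega>)) \<partial>M)"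
    by (subst nn_integral_add) (auto simp: emeasure_space_1)
  also have "\<dots> \<le> ennreal B + (\<integral>\<^sup>+\<omega>. ennreal (exp (R (d * X \<omega>))) \<partial>M)"
    by (intro add_left_mono nn_integral_mono) (auto simp: g_def)
  also have "\<dots> < \<infinity>"
    using fin by (simp add: less_top[symmetric] ennreal_add_eq_top)
  finally show "(\<integral>\<^sup>+\<omega>. ennreal ((X \<omega>)\<^sup>2) \<partial>M) < \<infinity>" .
qed auto

lemma nn_integral_exp_R_distr:
  assumes T [measurable]: "T \<in> measurable M M'" and f [measurable]: "f \<in> borel_measurable M'"
    and nonneg: "AE x in distr M M' T. 0 \<le> f x" and d: "0 < d"
  shows "(\<integral>\<^sup>+\<omega>. ennreal (exp (R (d * f (T \<omega>)))) \<partial>M) = (\<integral>\<^sup>+x. ennreal (exp (R (d * f x))) \<partial>distr M M' T)"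
proof -
  \<comment> \<open>\<open>R\<close> is arbitrary outside the open half-line, so the integrand need
    not be measurable as it stands; \<open>g\<close> is measurable and agrees with it at nonnegative
    arguments.\<close>
  define g where "g x = (if 0 < d * x then exp (R (d * x)) else 0) + (if 0 < x then 0 else exp (R 0))" for x
  have "(\<lambda>x. if 0 < d * x then exp (R (d * x)) else 0) \<in> borel_measurable borel"
    by (rule measurable_compose[OF _ exp_R_measurable]) measurable
  then have g_meas [measurable]: "g \<in> borel_measurable borel"
    unfolding g_def by measurable
  have g: "exp (R (d * x)) = g x" if "0 \<le> x" for x
    using that d by (auto simp: g_def zero_less_mult_iff)
  have nonneg': "AE \<omega> in M. 0 \<le> f (T \<omega>)" using AE_distrD[OF T nonneg] .
  have "(\<integral>\<^sup>+\<omega>. ennreal (exp (R (d * f (T \<omega>)))) \<partial>M) = (\<integral>\<^sup>+\<omega>. ennreal (g (f (T \<omega>))) \<partial>M)"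
    by (rule nn_integral_cong_AE) (use nonneg' in \<open>eventually_elim, simp add: g\<close>)
  also have "\<dots> = (\<integral>\<^sup>+x. ennreal (g (f x)) \<partial>distr M M' T)"
    by (rule nn_integral_distr[symmetric]) measurable
  also have "\<dots> = (\<integral>\<^sup>+x. ennreal (exp (R (d * f x))) \<partial>distr M M' T)"
    by (rule nn_integral_cong_AE) (use nonneg in \<open>eventually_elim, simp add: g\<close>)
  finally show ?thesis .
qed

end

theorem theorem1p6:
  fixes M :: "'w measure" and N :: "nat list \<Rightarrow> 'w \<Rightarrow> nat"
    and R l :: "real \<Rightarrow> real" and b :: real
  defines "a \<equiv> gw_mean M N" and "W \<equiv> gw_limit M N"
  assumes "galton_watson M N"
    and "0 < b" and "b \<le> 1"
    and "slowly_varying l"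
    and "\<And>x. x > 0 \<Longrightarrow> R x = x powr b * l x"
    and "\<And>x. x > 0 \<Longrightarrow> R x > 0"
    and "mono_on {0<..} R"
    and "phi2 a R \<in> gauges a"
    and "asymp_comparable (\<lambda>x. - ln (measure M {\<omega> \<in> space M. W \<omega> > x})) R"
  shows "(\<exists>!\<xi>. 0 < \<xi> \<and> is_critical M W R \<xi>) \<and>
    (\<forall>\<xi>. 0 < \<xi> \<and> is_critical M W R \<xi> \<longrightarrow>
      (AE \<omega> in M. gw_boundary (\<lambda>u. N u \<omega>) \<noteq> {} \<longrightarrow>
        hausdorff_measure (phi2 a R) (gw_boundary (\<lambda>u. N u \<omega>)) = ennreal (\<xi> * W \<omega>)))"
proof -
  interpret gw: galton_watson M N by fact
  define D where "D = distr M (count_space UNIV) (N [])"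
  have N_meas [measurable]: "N u \<in> measurable M (count_space UNIV)" for u
    using gw.indep by (simp add: gw.indep_vars_def)
  \<comment> \<open>A nonzero Bochner integral forces integrability.\<close>
  have int_N: "integrable M (\<lambda>\<omega>. real (N [] \<omega>))"
    using gw.mean_gt_1 not_integrable_integral_eq by fastforce
  interpret S: gw_space D a
  proof (rule gw_space.intro)
    show "prob_space D" unfolding D_def by (rule gw.prob_space_distr) measurable
    show "sets D = UNIV" by (simp add: D_def)
    show "integrable D real" unfolding D_def using int_N by (subst integrable_distr_eq) auto
    show "a = (\<integral>k. real k \<partial>D)" unfolding D_def a_def gw_mean_def by (subst integral_distr) auto
    show "1 < a" using gw.mean_gt_1 by (simp add: a_def gw_mean_def)
  qed
  interpret regular_varying R l b
    using assms by unfold_locales auto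
  \<comment> \<open>The labelling seen at \<omega>. Its law is the product measure of the canonical
    space, so almost sure statements, moments and tails transfer along \<open>X\<close>.\<close>
  define X where "X \<omega> = (\<lambda>u. N u \<omega>)" for \<omega>
  have sets_P: "sets S.P = sets (PiM UNIV (\<lambda>_. count_space UNIV))"
    unfolding S.P_def by (intro sets_PiM_cong) (auto simp: D_def)
  have X_meas [measurable]: "X \<in> measurable M S.P"
    unfolding X_def measurable_cong_sets[OF refl sets_P] by (rule measurable_PiM_single') auto
  have distr_X: "distr M S.P X = S.P"
  proof -
    have "distr M (PiM UNIV (\<lambda>_. count_space UNIV)) (\<lambda>\<omega>. \<lambda>u\<in>UNIV. N u \<omega>)
        = PiM UNIV (\<lambda>u. distr M (count_space UNIV) (N u))"
      using gw.indep by (subst (asm) gw.indep_vars_iff_distr_eq_PiM) auto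
    moreover have "distr M (count_space UNIV) (N u) = D" for u
      unfolding D_def by (rule gw.ident)
    ultimately have "distr M (PiM UNIV (\<lambda>_. count_space UNIV)) X = S.P"
      by (simp add: X_def[abs_def] restrict_def S.P_def)
    moreover have "distr M S.P X = distr M (PiM UNIV (\<lambda>_. count_space UNIV)) X"
      by (rule distr_cong[OF refl sets_P refl])
    ultimately show ?thesis by simp
  qed
  have W_X: "W \<omega> = S.W (X \<omega>)" for \<omega>
    unfolding W_def gw_limit_def a_def[symmetric] S.W_def S.Mn_def X_def ..
  have AE_nonneg: "AE c in S.P. 0 \<le> S.W c"
    using S.AE_good by eventually_elim (rule S.good_W_nonneg)
  have transfer: "(\<integral>\<^sup>+\<omega>. ennreal (exp (R (d * W \<omega>))) \<partial>M) = (\<integral>\<^sup>+c. ennreal (exp (R (d * S.W c))) \<partial>S.P)" if "0 < d" for d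
  proof -
    have "AE c in distr M S.P X. 0 \<le> S.W c" using AE_nonneg by (simp only: distr_X)
    then show ?thesis
      unfolding W_X using nn_integral_exp_R_distr[OF X_meas S.W_measurable _ that] by (simp only: distr_X)
  qed
  have AE_nonneg': "AE \<omega> in M. 0 \<le> W \<omega>"
    unfolding W_X by (rule AE_distrD[OF X_meas]) (use AE_nonneg in \<open>simp only: distr_X\<close>)
  have W_meas: "W \<in> borel_measurable M"
    unfolding W_X[abs_def] by measurable
  have tail_eq: "measure M {\<omega> \<in> space M. W \<omega> > x} = measure S.P {c \<in> space S.P. S.W c > x}" for x
  proof -
    have "measure S.P {c \<in> space S.P. S.W c > x} = measure (distr M S.P X) {c \<in> space S.P. S.W c > x}"
      by (simp only: distr_X)
    also have "\<dots> = measure M (X -` {c \<in> space S.P. S.W c > x} \<inter> space M)"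
      by (rule measure_distr) measurable
    also have "X -` {c \<in> space S.P. S.W c > x} \<inter> space M = {\<omega> \<in> space M. W \<omega> > x}"
      by (auto simp: W_X)
    finally show ?thesis by simp
  qed
  \<comment> \<open>The upper tail bound yields a finite exponential moment and the second moment of
    \<open>W\<close>; the lower one yields an infinite exponential moment and a positive
    mean.\<close>
  obtain K K' where K: "0 < K" "0 < K'" and tail:
    "\<forall>\<^sub>F x in at_top. exp (- K * R x) \<le> measure M {\<omega> \<in> space M. W \<omega> > x} \<and> measure M {\<omega> \<in> space M. W \<omega> > x} \<le> exp (- K' * R x)"
  proof (rule asymp_comparable_tail[OF assms(11)])
    show "\<forall>\<^sub>F x in at_top. 0 < R x"
      using eventually_gt_at_top[of 0] by eventually_elim (rule R_pos)
  qed auto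
  obtain d0 where d0: "0 < d0" "(\<integral>\<^sup>+\<omega>. ennreal (exp (R (d0 * W \<omega>))) \<partial>M) < \<infinity>"
    by (rule exp_moment_finite_small[OF gw.prob_space_axioms W_meas AE_nonneg' K(2)])
      (use tail in \<open>auto elim: eventually_mono\<close>)
  obtain d1 where d1: "0 < d1" "(\<integral>\<^sup>+\<omega>. ennreal (exp (R (d1 * W \<omega>))) \<partial>M) = \<infinity>"
    by (rule exp_moment_infinite_large[OF gw.prob_space_axioms W_meas K(1)])
      (use tail in \<open>auto elim: eventually_mono\<close>)
  interpret gw_gauge_L2 D a R l b
  proof
    have "(phi2 a R \<longlongrightarrow> 0) (at_right 0)" using assms(10) by (simp add: gauges_def)
    moreover have "filterlim (\<lambda>k. exp (- real k)) (at_right 0) sequentially"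
      by real_asymp
    ultimately show "(\<lambda>k. phi2 a R (exp (- real k))) \<longlonglongrightarrow> 0"
      by (rule filterlim_compose)
    show W_sq: "integrable S.P (\<lambda>c. (S.W c)\<^sup>2)"
      using d0 transfer[OF d0(1)]
      by (intro square_integrable_if_exp_moment[OF S.P.prob_space_axioms S.W_measurable AE_nonneg d0(1)]) simp
    have int_W: "integrable S.P S.W"
      by (rule S.P.square_integrable_imp_integrable[OF S.W_measurable W_sq])
    \<comment> \<open>A vanishing mean would force \<open>W = 0\<close> almost surely, against the
      lower tail bound.\<close>
    show "0 < (\<integral>c. S.W c \<partial>S.P)"
    proof (rule ccontr)
      assume "\<not> ?thesis"
      moreover have "0 \<le> (\<integral>c. S.W c \<partial>S.P)" by (rule integral_nonneg_AE[OF AE_nonneg])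
      ultimately have "AE c in S.P. S.W c = 0"
        using integral_nonneg_eq_0_iff_AE[OF int_W AE_nonneg] by simp
      have "\<forall>\<^sub>F x in at_top. exp (- K * R x) \<le> measure S.P {c \<in> space S.P. S.W c > x} \<and> 0 < x"
        using tail eventually_gt_at_top[of 0] by eventually_elim (simp add: tail_eq)
      then obtain x where x: "exp (- K * R x) \<le> measure S.P {c \<in> space S.P. S.W c > x}" "0 < x"
        using eventually_happens[of _ "at_top :: real filter"] by auto
      have "measure S.P {c \<in> space S.P. S.W c > x} = 0"
      proof (subst S.P.prob_eq_0)
        show "{c \<in> space S.P. S.W c > x} \<in> sets S.P" by measurable
        show "AE c in S.P. c \<notin> {c \<in> space S.P. S.W c > x}"
          using \<open>AE c in S.P. S.W c = 0\<close> by eventually_elim (use x(2) in simp)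
      qed
      with x(1) show False using exp_gt_zero[of "- K * R x"] by simp
    qed
  qed
  show ?thesis
  proof (intro conjI allI impI)
    show "\<exists>!\<xi>. 0 < \<xi> \<and> is_critical M W R \<xi>"
      by (rule ex1_is_critical[OF AE_nonneg' d0 d1])
    fix \<xi> assume \<xi>: "0 < \<xi> \<and> is_critical M W R \<xi>"
    have "AE c in S.P. hausdorff_measure (phi2 a R) (gw_boundary c) = ennreal (\<xi> * S.W c)"
    proof (rule hausdorff_measure_eq)
      show "0 < \<xi>" using \<xi> by simp
      show "(\<integral>\<^sup>+c. ennreal (exp (R (d * S.W c))) \<partial>S.P) < \<infinity>" if "0 < d" "d < \<xi>" for d
        unfolding transfer[OF that(1), symmetric] using \<xi> that unfolding is_critical_def by blast
      show "(\<integral>\<^sup>+c. ennreal (exp (R (d * S.W c))) \<partial>S.P) = \<infinity>" if "\<xi> < d" for d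
      proof -
        have "0 < d" using \<xi> that by simp
        then show ?thesis
          unfolding transfer[OF \<open>0 < d\<close>, symmetric] using \<xi> that unfolding is_critical_def by blast
      qed
    qed
    then have "AE \<omega> in M. hausdorff_measure (phi2 a R) (gw_boundary (X \<omega>)) = ennreal (\<xi> * S.W (X \<omega>))"
      by (intro AE_distrD[OF X_meas]) (simp only: distr_X)
    then show "AE \<omega> in M. gw_boundary (\<lambda>u. N u \<omega>) \<noteq> {} \<longrightarrow>
        hausdorff_measure (phi2 a R) (gw_boundary (\<lambda>u. N u \<omega>)) = ennreal (\<xi> * W \<omega>)"
      by eventually_elim (simp add: W_X X_def)
  qed
qed

end
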